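(* Let $(\mathbf u,\mathbf W)$ be a minimizer for $J$ in $\mathcal F(\Omega)$. Suppose that the $f_i$ and the $g_i$, $1\le i\le N$, are bounded, that $F$ is Lipschitz, i.e. there is $C_F\ge0$ such that $$|F(\mathbf V)-F(\mathbf V')|\le C_F\sum_{i=1}^N|V_i\Delta V_i'|\quad\text{for all }\mathbf V,\mathbf V'\in\mathcal W(\Omega),$$ and that there are $\lambda>0$ and $\varepsilon>0$ such that the following nondegeneracy condition holds: for each measurable set $A\subset W_1$ with $0<|A|\le\varepsilon$, there are disjoint subsets $A_j\subset A$, $2\le j\le N$, such that $$F(W_1\setminus A,W_2\cup A_2,\dots,W_N\cup A_N)\le F(\mathbf W)-\lambda|A|.$$ Then for each $C_0\ge1$ we can find $r_0>0$ and $c_6>0$ such that if $x\in\mathbb R^n$ and $0<r\le r_0$ are such that $B(x,r)\subset\Omega$, $\mathbf u$ is $C_0$-Lipschitz on $B(x,r)$, and $B(x,r/2)$ meets the boundary of $\Omega_1=\{y\in\Omega: u_1(y)>0\}$, then $$\big|\{y\in B(x,r): u_1(y)\le0\}\big|\ge c_6r^n.$$ The constant $c_6$ depends only on $n$, the $\|f_i\|_\infty$, the $\|g_i\|_\infty$, $C_F$, $\lambda$, and $C_0$, and $r_0$ depends on these constants plus $\varepsilon$.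
   Context: $n\ge2$ and $N\ge1$ are integers; $|A|$ is the Lebesgue measure of $A$; $B(x,r)$ is the open ball; $A\Delta B=(A\setminus B)\cup(B\setminus A)$; $\Omega\subset\mathbb R^n$ is a Borel set with $|\Omega|<+\infty$. $W^{1,2}(\mathbb R^n)$ denotes the set of functions in $L^2_{loc}(\mathbb R^n)$ whose distributional gradient lies in $L^2(\mathbb R^n)$. $\mathcal W(\Omega)$ is the set of $N$-tuples $\mathbf W=(W_1,\dots,W_N)$ of pairwise disjoint Borel subsets of $\Omega$. $\mathcal F(\Omega)$ is the set of pairs $(\mathbf u,\mathbf W)$ with $\mathbf W\in\mathcal W(\Omega)$ and $\mathbf u=(u_1,\dots,u_N)$ an $N$-tuple of real-valued functions $u_i\in W^{1,2}(\mathbb R^n)$ such that $u_i(x)=0$ for almost every $x\in\mathbb R^n\setminus W_i$. For $(\mathbf u,\mathbf W)\in\mathcal F(\Omega)$ and $F:\mathcal W(\Omega)\to\mathbb R$, $$J(\mathbf u,\mathbf W)=\sum_{i=1}^N\int|\nabla u_i|^2\,dx+\sum_{i=1}^N\int[u_i^2f_i-u_ig_i]\,dx+F(W_1,\dots,W_N).$$ A minimizer for $J$ in $\mathcal F(\Omega)$ is a pair $(\mathbf u,\mathbf W)\in\mathcal F(\Omega)$ such that $J(\mathbf u,\mathbf W)\le J(\mathbf u^*,\mathbf W^* )$ for all $(\mathbf u^*,\mathbf W^* )\in\mathcal F(\Omega)$. *)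

theory Defs
  imports "HOL-Analysis.Analysis" "HOL-Probability.Essential_Supremum"
begin

text \<open>\<open>partial_deriv j \<phi>\<close> is meaningful only where \<open>\<phi>\<close>
  is differentiable, which \<open>C_k\<close> requires before it is used.\<close>

definition partial_deriv :: "'n \<Rightarrow> (real^'n \<Rightarrow> real) \<Rightarrow> real^'n \<Rightarrow> real" where
  "partial_deriv j \<phi> x = frechet_derivative \<phi> (at x) (axis j 1)"

primrec C_k :: "nat \<Rightarrow> (real^'n \<Rightarrow> real) \<Rightarrow> bool" where
  "C_k 0 \<phi> \<longleftrightarrow> continuous_on UNIV \<phi>"
| "C_k (Suc k) \<phi> \<longleftrightarrow> (\<forall>x. \<phi> differentiable (at x)) \<and> (\<forall>j. C_k k (partial_deriv j \<phi>))"

definition test_functions :: "(real^'n \<Rightarrow> real) set" where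
  "test_functions = {\<phi>. (\<forall>k. C_k k \<phi>) \<and> compact (closure {x. \<phi> x \<noteq> 0})}"

definition L2_loc :: "(real^'n \<Rightarrow> real) set" where
  "L2_loc = {u. u \<in> borel_measurable lebesgue \<and>
                (\<forall>K. compact K \<longrightarrow> set_integrable lebesgue K (\<lambda>x. (u x)\<^sup>2))}"

definition has_weak_gradient :: "(real^'n \<Rightarrow> real) \<Rightarrow> (real^'n \<Rightarrow> real^'n) \<Rightarrow> bool" where
  "has_weak_gradient u G \<longleftrightarrow>
     G \<in> borel_measurable lebesgue \<and>
     (\<forall>K. compact K \<longrightarrow> set_integrable lebesgue K G) \<and>
     (\<forall>\<phi>\<in>test_functions. \<forall>j.
        (LINT x|lebesgue. u x * partial_deriv j \<phi> x) = - (LINT x|lebesgue. G x $ j * \<phi> x))"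

text \<open>The weak gradient is unique almost everywhere, so integrals do not depend on the choice
  made here.\<close>

definition weak_gradient :: "(real^'n \<Rightarrow> real) \<Rightarrow> real^'n \<Rightarrow> real^'n" where
  "weak_gradient u = (SOME G. has_weak_gradient u G)"

text \<open>The function itself is only required to be locally square integrable.\<close>

definition W12 :: "(real^'n \<Rightarrow> real) set" where
  "W12 = {u \<in> L2_loc. \<exists>G. has_weak_gradient u G \<and> integrable lebesgue (\<lambda>x. (norm (G x))\<^sup>2)}"

text \<open>\<open>N\<close>-tuples of sets are extensional functions on \<open>{1..N}\<close>, so that two tuples with the same
  components are equal and a functional on tuples sees nothing but the components.\<close>

definition admissible_sets :: "nat \<Rightarrow> (real^'n) set \<Rightarrow> (nat \<Rightarrow> (real^'n) set) set" where
  "admissible_sets N \<Omega> =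
     {W \<in> {1..N} \<rightarrow>\<^sub>E {A \<in> sets borel. A \<subseteq> \<Omega>}. disjoint_family_on W {1..N}}"

definition admissible_pairs ::
  "nat \<Rightarrow> (real^'n) set \<Rightarrow> ((nat \<Rightarrow> real^'n \<Rightarrow> real) \<times> (nat \<Rightarrow> (real^'n) set)) set" where
  "admissible_pairs N \<Omega> =
     {(u, W). W \<in> admissible_sets N \<Omega> \<and>
        (\<forall>i\<in>{1..N}. u i \<in> W12 \<and> (AE x in lebesgue. x \<notin> W i \<longrightarrow> u i x = 0))}"

definition J_functional ::
  "nat \<Rightarrow> (nat \<Rightarrow> real^'n \<Rightarrow> real) \<Rightarrow> (nat \<Rightarrow> real^'n \<Rightarrow> real) \<Rightarrow> ((nat \<Rightarrow> (real^'n) set) \<Rightarrow> real) \<Rightarrow>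
   (nat \<Rightarrow> real^'n \<Rightarrow> real) \<Rightarrow> (nat \<Rightarrow> (real^'n) set) \<Rightarrow> real" where
  "J_functional N f g F u W =
     (\<Sum>i=1..N. LINT x|lebesgue. (norm (weak_gradient (u i) x))\<^sup>2) +
     (\<Sum>i=1..N. LINT x|lebesgue. (u i x)\<^sup>2 * f i x - u i x * g i x) +
     F W"

definition is_J_minimizer ::
  "nat \<Rightarrow> (real^'n) set \<Rightarrow> (nat \<Rightarrow> real^'n \<Rightarrow> real) \<Rightarrow> (nat \<Rightarrow> real^'n \<Rightarrow> real) \<Rightarrow>
   ((nat \<Rightarrow> (real^'n) set) \<Rightarrow> real) \<Rightarrow> (nat \<Rightarrow> real^'n \<Rightarrow> real) \<Rightarrow> (nat \<Rightarrow> (real^'n) set) \<Rightarrow> bool" where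
  "is_J_minimizer N \<Omega> f g F u W \<longleftrightarrow>
     (u, W) \<in> admissible_pairs N \<Omega> \<and>
     (\<forall>(u', W') \<in> admissible_pairs N \<Omega>. J_functional N f g F u W \<le> J_functional N f g F u' W')"

definition sup_norm :: "(real^'n \<Rightarrow> real) \<Rightarrow> ereal" where
  "sup_norm h = esssup lebesgue (\<lambda>x. ereal \<bar>h x\<bar>)"

definition F_Lipschitz ::
  "nat \<Rightarrow> (real^'n) set \<Rightarrow> real \<Rightarrow> ((nat \<Rightarrow> (real^'n) set) \<Rightarrow> real) \<Rightarrow> bool" where
  "F_Lipschitz N \<Omega> C F \<longleftrightarrow>
     (\<forall>V\<in>admissible_sets N \<Omega>. \<forall>V'\<in>admissible_sets N \<Omega>.
        \<bar>F V - F V'\<bar> \<le> C * (\<Sum>i=1..N. measure lebesgue ((V i - V' i) \<union> (V' i - V i))))"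

text \<open>\<open>A\<close> and the \<open>A' j\<close> are Borel because the modified tuple has to consist of Borel sets.\<close>

definition nondegenerate ::
  "nat \<Rightarrow> real \<Rightarrow> real \<Rightarrow> ((nat \<Rightarrow> (real^'n) set) \<Rightarrow> real) \<Rightarrow> (nat \<Rightarrow> (real^'n) set) \<Rightarrow> bool" where
  "nondegenerate N lam \<epsilon> F W \<longleftrightarrow>
     (\<forall>A\<in>sets borel. A \<subseteq> W 1 \<longrightarrow> 0 < measure lebesgue A \<longrightarrow> measure lebesgue A \<le> \<epsilon> \<longrightarrow>
        (\<exists>A'. (\<forall>j\<in>{2..N}. A' j \<in> sets borel \<and> A' j \<subseteq> A) \<and> disjoint_family_on A' {2..N} \<and>
           F (\<lambda>i\<in>{1..N}. if i = 1 then W 1 - A else W i \<union> A' i) \<le> F W - lam * measure lebesgue A))"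

text \<open>Lipschitz with respect to the Euclidean norm on \<open>N\<close>-tuples of reals.\<close>

definition tuple_lipschitz_on ::
  "nat \<Rightarrow> real \<Rightarrow> (real^'n) set \<Rightarrow> (nat \<Rightarrow> real^'n \<Rightarrow> real) \<Rightarrow> bool" where
  "tuple_lipschitz_on N C S u \<longleftrightarrow>
     (\<forall>y\<in>S. \<forall>z\<in>S. L2_set (\<lambda>i. u i y - u i z) {1..N} \<le> C * dist y z)"

end

theory Submission
  imports Defs
begin

text \<open>
  The free boundary point \<open>y\<close> is a zero of the Lipschitz function \<open>u\<^sub>1\<close>. Suppose that
  \<open>u\<^sub>1\<close> is positive on \<open>B(y, R)\<close> except for a set of measure at most \<open>\<kappa> R\<^sup>n\<close>, with \<open>R = r/2\<close>
  (the locale \<open>thin_contact_ball\<close>). Two competitors then give incompatible information.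

  The first one uses that almost all of the ball already belongs to \<open>W\<^sub>1\<close>. Giving the rest of
  \<open>B(y, R/2)\<close> to \<open>W\<^sub>1\<close> and cutting the other functions off costs \<open>O((\<kappa> + R) R\<^sup>n)\<close>, and
  afterwards \<open>u\<^sub>1\<close> may be perturbed freely. Optimality therefore
  makes \<open>\<integral> u\<^sub>1 \<Delta>\<theta>\<close> small for the radial bumps \<open>\<theta>\<close> supported in \<open>B(y, \<rho>)\<close> with
  \<open>\<rho> \<le> R/2\<close> (\<open>almost_harmonic\<close>). Up to a power of \<open>\<rho>\<close>, the Laplacian of such a bump is the
  derivative in \<open>\<rho>\<close> of a nonnegative kernel of mass independent of \<open>\<rho>\<close>
  (\<open>DERIV_averaging_kernel\<close>), so the averages of \<open>u\<^sub>1\<close> around \<open>y\<close> hardly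
  depend on the scale: this is the mean value property with an error term. At scale \<open>s R\<close>
  the average is at most a multiple of \<open>C\<^sub>0 s R\<close>, because \<open>u\<^sub>1\<close> vanishes at \<open>y\<close>; hence it is small
  compared with \<open>R\<close> at scale \<open>R/2\<close> as well. The negative part of \<open>u\<^sub>1\<close> lives on the
  thin set, so the \<open>L\<^sup>1\<close> norm of \<open>u\<^sub>1\<close> on \<open>B(y, R/4)\<close> is small compared with
  \<open>R\<^sup>n\<^sup>+\<^sup>1\<close> (\<open>L1_norm_le_average\<close>).

  The second competitor multiplies \<open>u\<^sub>1\<close> by \<open>1 - \<psi>\<^sup>2\<close> with a cutoff \<open>\<psi>\<close> equal to \<open>1\<close> on \<open>B(y, R/8)\<close>
  and removes this ball from \<open>W\<^sub>1\<close>. The Dirichlet energy grows by at most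
  \<open>4 \<integral> u\<^sub>1\<^sup>2 |\<nabla>\<psi>|\<^sup>2\<close>, which the smallness of the \<open>L\<^sup>1\<close> norm controls, while nondegeneracy gains
  \<open>\<lambda> |W\<^sub>1 \<inter> B(y, R/8)|\<close>, a fixed fraction of \<open>R\<^sup>n\<close> (\<open>nondegeneracy_estimate\<close>). With suitable
  \<open>s\<close>, perturbation size, \<open>\<kappa>\<close> and \<open>R\<close>, chosen in this order, the gain exceeds the cost
  (\<open>contradictory_parameters\<close>).

  All competitors are obtained from \<open>u\<close> by adding or multiplying smooth functions, so the only
  facts about Sobolev functions that enter are the uniqueness of weak gradients and the sum and product
  rules with smooth functions.
\<close>

section \<open>Calculus of smooth functions\<close>

definition smooth :: "(real^'n::finite \<Rightarrow> real) \<Rightarrow> bool" where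
  "smooth \<phi> \<longleftrightarrow> (\<forall>k. C_k k \<phi>)"

definition grad :: "(real^'n::finite \<Rightarrow> real) \<Rightarrow> real^'n \<Rightarrow> real^'n" where
  "grad \<phi> x = (\<chi> j. partial_deriv j \<phi> x)"

definition laplacian :: "(real^'n::finite \<Rightarrow> real) \<Rightarrow> real^'n \<Rightarrow> real" where
  "laplacian \<phi> x = (\<Sum>j\<in>UNIV. partial_deriv j (partial_deriv j \<phi>) x)"

lemma grad_nth [simp]: "grad \<phi> x $ j = partial_deriv j \<phi> x"
  by (simp add: grad_def)

lemma partial_deriv_eq:
  assumes "(\<phi> has_derivative D) (at x)"
  shows "partial_deriv j \<phi> x = D (axis j 1)"
  unfolding partial_deriv_def using assms frechet_derivative_at by metis

lemma C_k_SucD: "C_k (Suc k) \<phi> \<Longrightarrow> C_k k \<phi>"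
proof (induction k arbitrary: \<phi>)
  case 0
  then show ?case
    by (auto intro!: continuous_at_imp_continuous_on differentiable_imp_continuous_within)
next
  case (Suc k)
  then show ?case by (metis C_k.simps(2))
qed

lemma smooth_differentiable: "smooth \<phi> \<Longrightarrow> \<phi> differentiable (at x)"
  unfolding smooth_def by (metis C_k.simps(2))

lemma smooth_partial_deriv: "smooth \<phi> \<Longrightarrow> smooth (partial_deriv j \<phi>)"
  unfolding smooth_def by (metis C_k.simps(2))

lemma smooth_continuous: "smooth \<phi> \<Longrightarrow> continuous_on UNIV \<phi>"
  unfolding smooth_def by (metis C_k.simps(1))

lemma smooth_continuous_grad: "smooth \<phi> \<Longrightarrow> continuous_on UNIV (grad \<phi>)"
  unfolding grad_def
  by (intro continuous_on_vec_lambda smooth_continuous smooth_partial_deriv)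

lemma smooth_continuous_laplacian: "smooth \<phi> \<Longrightarrow> continuous_on UNIV (laplacian \<phi>)"
  unfolding laplacian_def
  by (intro continuous_on_sum smooth_continuous smooth_partial_deriv)

lemma smooth_has_derivative:
  assumes "smooth \<phi>"
  shows "(\<phi> has_derivative (\<lambda>h. grad \<phi> x \<bullet> h)) (at x)"
proof -
  have D: "(\<phi> has_derivative frechet_derivative \<phi> (at x)) (at x)"
    using smooth_differentiable[OF assms] frechet_derivative_works by blast
  have lin: "linear (frechet_derivative \<phi> (at x))"
    using D has_derivative_linear by blast
  have "frechet_derivative \<phi> (at x) h = grad \<phi> x \<bullet> h" for h
  proof -
    have "frechet_derivative \<phi> (at x) h
        = frechet_derivative \<phi> (at x) (\<Sum>j\<in>UNIV. (h $ j) *\<^sub>R axis j 1)"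
      using basis_expansion[of h] by (simp add: scalar_mult_eq_scaleR)
    also have "\<dots> = (\<Sum>j\<in>UNIV. (h $ j) * partial_deriv j \<phi> x)"
      by (simp add: linear_sum[OF lin] linear_cmul[OF lin] partial_deriv_def)
    also have "\<dots> = grad \<phi> x \<bullet> h"
      by (simp add: inner_vec_def mult.commute)
    finally show ?thesis .
  qed
  then show ?thesis using D by (metis (no_types, lifting) ext)
qed

lemma partial_deriv_const: "partial_deriv j (\<lambda>x. c) x = 0"
  by (subst partial_deriv_eq[OF has_derivative_const]) simp

lemma C_k_const: "C_k k (\<lambda>x. c)"
proof (induction k arbitrary: c)
  case (Suc k)
  have "partial_deriv j (\<lambda>x. c) = (\<lambda>x. 0)" for j :: 'a
    by (rule ext) (rule partial_deriv_const)
  then show ?case using Suc by simp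
qed simp

lemma partial_deriv_add:
  assumes "\<phi> differentiable (at x)" "\<psi> differentiable (at x)"
  shows "partial_deriv j (\<lambda>x. \<phi> x + \<psi> x) x = partial_deriv j \<phi> x + partial_deriv j \<psi> x"
proof -
  have "((\<lambda>x. \<phi> x + \<psi> x) has_derivative
      (\<lambda>h. frechet_derivative \<phi> (at x) h + frechet_derivative \<psi> (at x) h)) (at x)"
    using assms frechet_derivative_works by (blast intro: has_derivative_add)
  from partial_deriv_eq[OF this] show ?thesis by (simp add: partial_deriv_def)
qed

lemma partial_deriv_mult:
  assumes "\<phi> differentiable (at x)" "\<psi> differentiable (at x)"
  shows "partial_deriv j (\<lambda>x. \<phi> x * \<psi> x) x
    = \<phi> x * partial_deriv j \<psi> x + partial_deriv j \<phi> x * \<psi> x"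
proof -
  have "((\<lambda>x. \<phi> x * \<psi> x) has_derivative
      (\<lambda>h. \<phi> x * frechet_derivative \<psi> (at x) h + frechet_derivative \<phi> (at x) h * \<psi> x)) (at x)"
    using assms frechet_derivative_works by (blast intro: has_derivative_mult)
  from partial_deriv_eq[OF this] show ?thesis by (simp add: partial_deriv_def)
qed

lemma partial_deriv_compose:
  assumes "\<phi> differentiable (at x)" "(h has_real_derivative h') (at (\<phi> x))"
  shows "partial_deriv j (\<lambda>x. h (\<phi> x)) x = h' * partial_deriv j \<phi> x"
proof -
  have "((\<lambda>x. h (\<phi> x)) has_derivative (\<lambda>v. h' * frechet_derivative \<phi> (at x) v)) (at x)"
    using assms(1) assms(2)[unfolded has_field_derivative_def] frechet_derivative_works
    by (blast intro: has_derivative_compose)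
  from partial_deriv_eq[OF this] show ?thesis by (simp add: partial_deriv_def)
qed

lemma C_k_add: "C_k k \<phi> \<Longrightarrow> C_k k \<psi> \<Longrightarrow> C_k k (\<lambda>x. \<phi> x + \<psi> x)"
proof (induction k arbitrary: \<phi> \<psi>)
  case 0
  then show ?case by (simp add: continuous_on_add)
next
  case (Suc k)
  have "partial_deriv j (\<lambda>x. \<phi> x + \<psi> x) = (\<lambda>x. partial_deriv j \<phi> x + partial_deriv j \<psi> x)" for j
    by (rule ext, rule partial_deriv_add) (use Suc.prems in auto)
  then show ?case using Suc by (auto intro: differentiable_add)
qed

lemma C_k_mult: "C_k k \<phi> \<Longrightarrow> C_k k \<psi> \<Longrightarrow> C_k k (\<lambda>x. \<phi> x * \<psi> x)"
proof (induction k arbitrary: \<phi> \<psi>)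
  case 0
  then show ?case by (simp add: continuous_on_mult)
next
  case (Suc k)
  have pd: "partial_deriv j (\<lambda>x. \<phi> x * \<psi> x)
      = (\<lambda>x. \<phi> x * partial_deriv j \<psi> x + partial_deriv j \<phi> x * \<psi> x)" for j
    by (rule ext, rule partial_deriv_mult) (use Suc.prems in auto)
  have "C_k k \<phi>" "C_k k \<psi>" using Suc.prems C_k_SucD by blast+
  then show ?case using Suc by (auto simp: pd intro!: C_k_add differentiable_mult)
qed

lemma smooth_add: "smooth \<phi> \<Longrightarrow> smooth \<psi> \<Longrightarrow> smooth (\<lambda>x. \<phi> x + \<psi> x)"
  unfolding smooth_def using C_k_add by blast

lemma smooth_mult: "smooth \<phi> \<Longrightarrow> smooth \<psi> \<Longrightarrow> smooth (\<lambda>x. \<phi> x * \<psi> x)"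
  unfolding smooth_def using C_k_mult by blast

lemma smooth_const: "smooth (\<lambda>x. c)"
  unfolding smooth_def using C_k_const by blast

lemma smooth_cmult: "smooth \<phi> \<Longrightarrow> smooth (\<lambda>x. c * \<phi> x)"
  using smooth_mult[OF smooth_const] by blast

lemma smooth_diff: "smooth \<phi> \<Longrightarrow> smooth \<psi> \<Longrightarrow> smooth (\<lambda>x. \<phi> x - \<psi> x)"
  using smooth_add[OF _ smooth_cmult, of \<phi> \<psi> "-1"] by simp

definition smooth_real :: "(real \<Rightarrow> real) \<Rightarrow> bool" where
  "smooth_real h \<longleftrightarrow> (\<exists>D. D 0 = h \<and> (\<forall>k t. (D k has_real_derivative D (Suc k) t) (at t)))"

text \<open>The chain rule turns \<open>D i \<circ> \<phi>\<close> into \<open>D (i + 1) \<circ> \<phi>\<close> times a derivative of \<open>\<phi>\<close>, so the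
  induction has to treat all members of the tower \<open>D\<close> simultaneously.\<close>

lemma smooth_compose:
  assumes "smooth_real h" "smooth \<phi>"
  shows "smooth (\<lambda>x. h (\<phi> x))"
proof -
  obtain D where D: "D 0 = h" "\<And>k t. (D k has_real_derivative D (Suc k) t) (at t)"
    using assms(1) unfolding smooth_real_def by blast
  have "C_k k (\<lambda>x. D i (\<phi> x))" for k i
  proof (induction k arbitrary: i)
    case 0
    have "continuous_on UNIV (D i)"
      using D(2) by (meson DERIV_continuous continuous_at_imp_continuous_on)
    then show ?case
      using continuous_on_compose2[OF _ smooth_continuous[OF assms(2)]] by auto
  next
    case (Suc k)
    have "partial_deriv j (\<lambda>x. D i (\<phi> x)) = (\<lambda>x. D (Suc i) (\<phi> x) * partial_deriv j \<phi> x)" for j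
      by (rule ext, rule partial_deriv_compose[OF smooth_differentiable[OF assms(2)] D(2)])
    moreover have "(\<lambda>x. D i (\<phi> x)) differentiable (at x)" for x
      using differentiable_compose[of "D i" \<phi> x UNIV] D(2) smooth_differentiable[OF assms(2)]
      by (simp add: real_differentiable_def differentiable_def has_field_derivative_def o_def) blast
    ultimately show ?case
      using C_k_mult[OF Suc] smooth_partial_deriv[OF assms(2)] by (simp add: smooth_def)
  qed
  from this[of _ 0] show ?thesis by (simp add: D(1) smooth_def)
qed

lemma smooth_coordinate: "smooth (\<lambda>x::real^'n::finite. x $ i)"
  unfolding smooth_def
proof
  fix k show "C_k k (\<lambda>x::real^'n. x $ i)"
  proof (cases k)
    case 0
    then show ?thesis by (simp add: continuous_on_component)
  next
    case (Suc m)
    have d: "((\<lambda>x::real^'n. x $ i) has_derivative (\<lambda>h. h $ i)) (at x)" for x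
      by (rule bounded_linear_imp_has_derivative) (rule bounded_linear_vec_nth)
    have "partial_deriv j (\<lambda>x::real^'n. x $ i) = (\<lambda>x. axis j 1 $ i)" for j
      by (rule ext) (rule partial_deriv_eq[OF d])
    moreover have "(\<lambda>x::real^'n. x $ i) differentiable (at x)" for x
      using d[of x] unfolding differentiable_def by blast
    ultimately show ?thesis using Suc by (simp add: C_k_const)
  qed
qed

lemma smooth_sum:
  "finite I \<Longrightarrow> (\<And>i. i \<in> I \<Longrightarrow> smooth (\<phi> i)) \<Longrightarrow> smooth (\<lambda>x. \<Sum>i\<in>I. \<phi> i x)"
proof (induction I rule: finite_induct)
  case empty
  then show ?case using smooth_const[of 0] by simp
next
  case (insert i I)
  then show ?case using smooth_add[of "\<phi> i" "\<lambda>x. \<Sum>i\<in>I. \<phi> i x"] by auto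
qed

lemma smooth_norm_squared: "smooth (\<lambda>z::real^'n::finite. (norm (z - y))\<^sup>2)"
proof -
  have *: "(\<lambda>z::real^'n. (norm (z - y))\<^sup>2) = (\<lambda>z. \<Sum>i\<in>UNIV. (z $ i - y $ i) * (z $ i - y $ i))"
    by (simp only: power2_norm_eq_inner inner_vec_def) simp
  show ?thesis unfolding *
    by (intro smooth_sum smooth_mult smooth_diff smooth_coordinate smooth_const) auto
qed

section \<open>The flat exponential\<close>

definition flat_exp :: "real \<Rightarrow> real" where
  "flat_exp t = (if 0 < t then exp (- 1 / t) else 0)"

text \<open>The recursion is the one that differentiation imposes on \<open>P\<^sub>k(1/t) exp(-1/t)\<close>: the new
  polynomial in \<open>v = 1/t\<close> is \<open>v\<^sup>2 (P\<^sub>k(v) - P\<^sub>k'(v))\<close>.\<close>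

primrec flat_poly :: "nat \<Rightarrow> real poly" where
  "flat_poly 0 = 1"
| "flat_poly (Suc k) = [:0, 0, 1:] * (flat_poly k - pderiv (flat_poly k))"

definition flat_deriv :: "nat \<Rightarrow> real \<Rightarrow> real" where
  "flat_deriv k t = (if 0 < t then poly (flat_poly k) (1 / t) * exp (- 1 / t) else 0)"

lemma tendsto_poly_exp_0: "((\<lambda>v. poly p v * exp (- v)) \<longlongrightarrow> (0::real)) at_top"
proof -
  have "((\<lambda>v. \<Sum>i\<le>degree p. coeff p i * (v ^ i / exp v)) \<longlongrightarrow> (\<Sum>i\<le>degree p. coeff p i * 0)) at_top"
    by (intro tendsto_intros tendsto_power_div_exp_0)
  then show ?thesis
    by (simp add: poly_altdef sum_distrib_right exp_minus divide_inverse mult.assoc)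
qed

text \<open>Only \<open>t = 0\<close> needs an argument. There the right difference quotient is \<open>v P\<^sub>k(v) exp(-v)\<close>
  with \<open>v = 1/h\<close> tending to infinity, and the exponential beats the polynomial.\<close>

lemma DERIV_flat_deriv: "(flat_deriv k has_real_derivative flat_deriv (Suc k) t) (at t)"
proof -
  consider "t > 0" | "t < 0" | "t = 0" by linarith
  then show ?thesis
  proof cases
    case 1
    have "((\<lambda>t. poly (flat_poly k) (1 / t) * exp (- 1 / t)) has_real_derivative flat_deriv (Suc k) t) (at t)"
      using 1 by (auto intro!: derivative_eq_intros DERIV_chain'[OF _ poly_DERIV]
          simp: flat_deriv_def algebra_simps power2_eq_square divide_simps)
    moreover have ev: "\<forall>\<^sub>F x in nhds t. flat_deriv k x = poly (flat_poly k) (1 / x) * exp (- 1 / x)"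
      using 1 by (intro eventually_mono[OF eventually_nhds_in_open[of "{0<..}" t]])
        (auto simp: flat_deriv_def)
    ultimately show ?thesis by (subst DERIV_cong_ev[OF refl ev refl])
  next
    case 2
    have "\<forall>\<^sub>F x in nhds t. flat_deriv k x = 0"
      using 2 by (intro eventually_mono[OF eventually_nhds_in_open[of "{..<0}" t]])
        (auto simp: flat_deriv_def)
    then have "(flat_deriv k has_real_derivative 0) (at t)"
      using DERIV_cong_ev[OF refl _ refl, of "flat_deriv k" "\<lambda>_. 0" t 0] by simp
    then show ?thesis using 2 by (simp add: flat_deriv_def)
  next
    case 3
    have "((\<lambda>h. flat_deriv k h / h) \<longlongrightarrow> 0) (at 0)"
    proof (rule filterlim_split_at_real)
      have "\<forall>\<^sub>F h in at_left 0. flat_deriv k h / h = (0::real)"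
        by (rule eventually_at_leftI[of "-1"]) (auto simp: flat_deriv_def)
      then show "((\<lambda>h. flat_deriv k h / h) \<longlongrightarrow> 0) (at_left 0)"
        by (simp add: tendsto_eventually)
      have "((\<lambda>h. poly (pCons 0 (flat_poly k)) (inverse h) * exp (- inverse h)) \<longlongrightarrow> 0) (at_right 0)"
        by (rule filterlim_compose[OF tendsto_poly_exp_0 filterlim_inverse_at_top_right])
      moreover have "\<forall>\<^sub>F h in at_right 0.
          poly (pCons 0 (flat_poly k)) (inverse h) * exp (- inverse h) = flat_deriv k h / h"
        by (rule eventually_at_rightI[of 0 1]) (auto simp: flat_deriv_def divide_simps)
      ultimately show "((\<lambda>h. flat_deriv k h / h) \<longlongrightarrow> 0) (at_right 0)"
        by (rule Lim_transform_eventually)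
    qed
    then show ?thesis using 3 by (simp add: has_field_derivative_iff flat_deriv_def)
  qed
qed

lemma flat_deriv_0: "flat_deriv 0 = flat_exp"
  by (auto simp: flat_deriv_def flat_exp_def)

lemma smooth_real_flat_exp: "smooth_real flat_exp"
  unfolding smooth_real_def using DERIV_flat_deriv flat_deriv_0 by blast

lemma flat_deriv_1: "flat_deriv 1 t = (if 0 < t then exp (- 1 / t) / t\<^sup>2 else 0)"
  by (simp add: flat_deriv_def pderiv_1 power2_eq_square)

lemma continuous_flat_deriv: "continuous_on A (flat_deriv k)"
  using DERIV_flat_deriv by (meson DERIV_continuous continuous_at_imp_continuous_on)

lemma flat_exp_nonneg: "0 \<le> flat_exp t" and flat_exp_le_1: "flat_exp t \<le> 1"
  and flat_exp_pos_iff: "0 < flat_exp t \<longleftrightarrow> 0 < t"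
  by (auto simp: flat_exp_def)

lemma flat_exp_mono: "s \<le> t \<Longrightarrow> flat_exp s \<le> flat_exp t"
  by (auto simp: flat_exp_def frac_le)

lemma flat_deriv_1_nonneg: "0 \<le> flat_deriv 1 t"
  unfolding flat_deriv_1 by simp

lemma flat_deriv_bounded: "\<exists>L>0. \<forall>t\<le>1. \<bar>flat_deriv k t\<bar> \<le> L"
proof -
  have "compact (flat_deriv k ` {0..1})"
    by (intro compact_continuous_image continuous_flat_deriv) simp
  then obtain L where L: "L > 0" "\<And>t. t \<in> {0..1} \<Longrightarrow> \<bar>flat_deriv k t\<bar> \<le> L"
    using bounded_pos[THEN iffD1, OF compact_imp_bounded] by (metis image_eqI real_norm_def)
  have "\<bar>flat_deriv k t\<bar> \<le> L" if "t \<le> 1" for t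
    using L(2)[of t] that L(1) by (cases "0 \<le> t") (auto simp: flat_deriv_def)
  then show ?thesis using L(1) by blast
qed

section \<open>Test functions and integration by parts\<close>

lemma test_functions_iff:
  "\<phi> \<in> test_functions \<longleftrightarrow> smooth \<phi> \<and> bounded {x. \<phi> x \<noteq> 0}"
  by (simp add: test_functions_def smooth_def compact_closure)

lemma test_functions_smooth: "\<phi> \<in> test_functions \<Longrightarrow> smooth \<phi>"
  by (simp add: test_functions_iff)

lemma test_functions_mult:
  assumes "smooth w" "\<phi> \<in> test_functions"
  shows "(\<lambda>x. w x * \<phi> x) \<in> test_functions"
  using assms bounded_subset[of "{x. \<phi> x \<noteq> 0}" "{x. w x * \<phi> x \<noteq> 0}"]
  by (auto simp: test_functions_iff intro: smooth_mult)

lemma partial_deriv_eq_0: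
  assumes "x \<notin> closure {x. \<phi> x \<noteq> 0}"
  shows "partial_deriv j \<phi> x = 0"
proof -
  have "(\<phi> has_derivative (\<lambda>h. 0)) (at x)"
    by (rule has_derivative_transform_within_open[of "\<lambda>x. 0" _ _ _ "- closure {x. \<phi> x \<noteq> 0}"])
      (use assms closure_subset[of "{x. \<phi> x \<noteq> 0}"] in auto)
  from partial_deriv_eq[OF this] show ?thesis by simp
qed

lemma grad_eq_0: "x \<notin> closure {x. \<phi> x \<noteq> 0} \<Longrightarrow> grad \<phi> x = 0"
  by (simp add: vec_eq_iff partial_deriv_eq_0)

lemma test_functions_partial_deriv:
  assumes "\<phi> \<in> test_functions"
  shows "partial_deriv j \<phi> \<in> test_functions"
proof -
  have "{x. partial_deriv j \<phi> x \<noteq> 0} \<subseteq> closure {x. \<phi> x \<noteq> 0}"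
    using partial_deriv_eq_0 by blast
  then show ?thesis
    using assms bounded_subset[OF bounded_closure]
    by (auto simp: test_functions_iff smooth_partial_deriv)
qed

lemma bounded_support_grad:
  assumes "\<phi> \<in> test_functions"
  shows "bounded {x. grad \<phi> x \<noteq> 0}"
proof (rule bounded_subset)
  show "bounded (closure {x. \<phi> x \<noteq> 0})"
    using assms by (simp add: test_functions_iff bounded_closure)
qed (use grad_eq_0 in blast)

definition locally_integrable :: "(real^'n::finite \<Rightarrow> 'b::{banach, second_countable_topology}) \<Rightarrow> bool" where
  "locally_integrable u \<longleftrightarrow> u \<in> borel_measurable lebesgue \<and>
     (\<forall>K. compact K \<longrightarrow> set_integrable lebesgue K u)"

lemma continuous_lebesgue_measurable:
  fixes \<phi> :: "real^'n::finite \<Rightarrow> 'b::{second_countable_topology, topological_space}"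
  shows "continuous_on UNIV \<phi> \<Longrightarrow> \<phi> \<in> borel_measurable lebesgue"
  using borel_measurable_continuous_onI by (intro measurable_completion) auto

lemma locally_integrable_scaleR:
  fixes w :: "real^'n::finite \<Rightarrow> real"
  assumes "locally_integrable u" "continuous_on UNIV w"
  shows "locally_integrable (\<lambda>x. w x *\<^sub>R u x)"
  unfolding locally_integrable_def
proof (intro conjI allI impI)
  have [measurable]: "u \<in> borel_measurable lebesgue" "w \<in> borel_measurable lebesgue"
    using assms continuous_lebesgue_measurable by (auto simp: locally_integrable_def)
  show "(\<lambda>x. w x *\<^sub>R u x) \<in> borel_measurable lebesgue" by measurable
  fix K :: "(real^'n) set" assume K: "compact K"
  then have [measurable]: "K \<in> sets lebesgue" by (simp add: compact_imp_closed borel_closed)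
  have "bounded (w ` K)"
    using K assms(2) by (intro compact_imp_bounded compact_continuous_image)
      (auto intro: continuous_on_subset)
  then obtain B where B: "\<And>x. x \<in> K \<Longrightarrow> \<bar>w x\<bar> \<le> B"
    unfolding bounded_iff by auto
  have "integrable lebesgue (\<lambda>x. B *\<^sub>R (indicator K x *\<^sub>R u x))"
    using assms(1) K by (auto simp: locally_integrable_def set_integrable_def
        simp del: scaleR_scaleR real_scaleR_def intro!: integrable_scaleR_right)
  then show "set_integrable lebesgue K (\<lambda>x. w x *\<^sub>R u x)"
    unfolding set_integrable_def
    by (rule Bochner_Integration.integrable_bound)
      (use B in \<open>auto simp: indicator_def intro!: mult_right_mono order_trans[OF B abs_ge_self]\<close>)
qed

text \<open>The counterpart of the previous lemma in which the vector-valued factor is the continuous one;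
  weak gradients of products contain both kinds of terms.\<close>

lemma locally_integrable_scaleR_right:
  fixes v :: "real^'n::finite \<Rightarrow> 'b::{banach, second_countable_topology}"
  assumes "locally_integrable u" "continuous_on UNIV v"
  shows "locally_integrable (\<lambda>x. u x *\<^sub>R v x)"
  unfolding locally_integrable_def
proof (intro conjI allI impI)
  have [measurable]: "u \<in> borel_measurable lebesgue" "v \<in> borel_measurable lebesgue"
    using assms continuous_lebesgue_measurable by (auto simp: locally_integrable_def)
  show "(\<lambda>x. u x *\<^sub>R v x) \<in> borel_measurable lebesgue" by measurable
  fix K :: "(real^'n) set" assume K: "compact K"
  then have [measurable]: "K \<in> sets lebesgue" by (simp add: compact_imp_closed borel_closed)
  have "bounded (v ` K)"
    using K assms(2) by (intro compact_imp_bounded compact_continuous_image)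
      (auto intro: continuous_on_subset)
  then obtain B where B: "\<And>x. x \<in> K \<Longrightarrow> norm (v x) \<le> B"
    unfolding bounded_iff by auto
  have "integrable lebesgue (\<lambda>x. B *\<^sub>R (indicator K x *\<^sub>R u x))"
    using assms(1) K by (auto simp: locally_integrable_def set_integrable_def
        simp del: scaleR_scaleR real_scaleR_def intro!: integrable_scaleR_right)
  then show "set_integrable lebesgue K (\<lambda>x. u x *\<^sub>R v x)"
    unfolding set_integrable_def
    by (rule Bochner_Integration.integrable_bound)
      (use B in \<open>auto simp: indicator_def abs_mult mult.commute[of "\<bar>B\<bar>"]
        intro!: mult_left_mono order_trans[OF B abs_ge_self]\<close>)
qed

lemma locally_integrable_add:
  "locally_integrable u \<Longrightarrow> locally_integrable v \<Longrightarrow> locally_integrable (\<lambda>x. u x + v x)"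
  by (auto simp: locally_integrable_def intro: set_integral_add)

lemma locally_integrable_continuous:
  fixes v :: "real^'n::finite \<Rightarrow> 'b::euclidean_space"
  assumes "continuous_on UNIV v"
  shows "locally_integrable v"
  unfolding locally_integrable_def
proof (intro conjI allI impI)
  fix K :: "(real^'n) set" assume K: "compact K"
  have "set_integrable lborel K v"
    unfolding set_integrable_def
    using K assms continuous_on_subset by (intro borel_integrable_compact) auto
  then show "set_integrable lebesgue K v"
    using K unfolding set_integrable_def by (intro integrable_completion[THEN iffD2] borel_measurable_integrable)
qed (use assms continuous_lebesgue_measurable in blast)

lemma integrable_bounded_support:
  assumes "locally_integrable u" "bounded {x. u x \<noteq> 0}"
  shows "integrable lebesgue u"
proof -
  have "integrable lebesgue (\<lambda>x. indicator (closure {x. u x \<noteq> 0}) x *\<^sub>R u x)"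
    using assms by (auto simp: locally_integrable_def set_integrable_def compact_closure)
  moreover have "indicator (closure {x. u x \<noteq> 0}) x *\<^sub>R u x = u x" for x
    using closure_subset[of "{x. u x \<noteq> 0}"] by (auto simp: indicator_def)
  ultimately show ?thesis by simp
qed

lemma integrable_mult_bounded_support:
  fixes u :: "real^'n::finite \<Rightarrow> real"
  assumes "locally_integrable u" "continuous_on UNIV \<phi>" "bounded {x. \<phi> x \<noteq> 0}"
  shows "integrable lebesgue (\<lambda>x. u x * \<phi> x)"
proof (rule integrable_bounded_support)
  show "locally_integrable (\<lambda>x. u x * \<phi> x)"
    using locally_integrable_scaleR_right[OF assms(1,2)] by simp
  show "bounded {x. u x * \<phi> x \<noteq> 0}"
    by (rule bounded_subset[OF assms(3)]) auto
qed

lemma integrable_mult_test: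
  fixes u :: "real^'n::finite \<Rightarrow> real"
  assumes "locally_integrable u" "\<phi> \<in> test_functions"
  shows "integrable lebesgue (\<lambda>x. u x * \<phi> x)"
  using assms integrable_mult_bounded_support smooth_continuous
  by (auto simp: test_functions_iff)

lemma L2_loc_locally_integrable:
  fixes u :: "real^'n::finite \<Rightarrow> real"
  assumes "u \<in> L2_loc"
  shows "locally_integrable u"
  unfolding locally_integrable_def
proof (intro conjI allI impI)
  show [measurable]: "u \<in> borel_measurable lebesgue" using assms by (simp add: L2_loc_def)
  fix K :: "(real^'n) set" assume K: "compact K"
  then have [measurable]: "K \<in> sets lebesgue" by (simp add: compact_imp_closed borel_closed)
  have "set_integrable lebesgue K (\<lambda>x. 1 + (u x)\<^sup>2)"
    using assms K locally_integrable_continuous[of "\<lambda>_::real^'n. 1::real"]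
    by (intro set_integral_add) (auto simp: L2_loc_def locally_integrable_def)
  then show "set_integrable lebesgue K u"
    unfolding set_integrable_def
  proof (rule Bochner_Integration.integrable_bound)
    have "\<bar>t\<bar> \<le> 1 + t\<^sup>2" for t :: real
      using sum_squares_ge_zero[of "\<bar>t\<bar> - 1" 0] zero_le_power2[of t]
      by (simp add: power2_eq_square algebra_simps abs_if split: if_splits)
    then show "AE x in lebesgue. norm (indicator K x *\<^sub>R u x) \<le> norm (indicator K x *\<^sub>R (1 + (u x)\<^sup>2))"
      by (auto simp: indicator_def)
  qed measurable
qed

lemma lebesgue_integral_translation:
  fixes \<phi> :: "real^'n::finite \<Rightarrow> real"
  assumes "continuous_on UNIV \<phi>"
  shows "(LINT x|lebesgue. \<phi> (x + c)) = (LINT x|lebesgue. \<phi> x)"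
proof -
  have [measurable]: "\<phi> \<in> borel_measurable borel" using assms by (rule borel_measurable_continuous_onI)
  have "(LINT x|lborel. \<phi> x) = (LINT x|distr lborel borel ((+) c). \<phi> x)"
    by (simp add: lborel_distr_plus)
  also have "\<dots> = (LINT x|lborel. \<phi> (c + x))"
    by (subst integral_distr) auto
  finally show ?thesis
    by (simp add: integral_completion add.commute)
qed

text \<open>The integral of each difference quotient vanishes because Lebesgue measure is translation
  invariant. The quotients are bounded by the maximum of the gradient and live on one fixed
  ball, so dominated convergence passes to the derivative.\<close>

lemma integral_partial_deriv_test:
  fixes \<phi> :: "real^'n::finite \<Rightarrow> real"
  assumes \<phi>: "\<phi> \<in> test_functions"
  shows "(LINT x|lebesgue. partial_deriv j \<phi> x) = 0"
proof -
  have sm: "smooth \<phi>" using \<phi> by (rule test_functions_smooth)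
  obtain R where R: "\<And>x. \<phi> x \<noteq> 0 \<Longrightarrow> norm x \<le> R"
    using \<phi> by (auto simp: test_functions_iff bounded_iff)
  define h :: "nat \<Rightarrow> real" where "h k = 1 / (k + 1)" for k
  have h: "0 < h k" "h k \<le> 1" for k by (auto simp: h_def)
  have h0: "h \<longlonglongrightarrow> 0" unfolding h_def using LIMSEQ_inverse_real_of_nat
    by (simp add: divide_inverse add.commute)
  define e :: "real^'n" where "e = axis j 1"
  define q where "q k x = (\<phi> (x + h k *\<^sub>R e) - \<phi> x) / h k" for k x
  have "bounded (range (grad \<phi>))"
  proof -
    have "compact (grad \<phi> ` closure {x. grad \<phi> x \<noteq> 0})"
      using bounded_support_grad[OF \<phi>] smooth_continuous_grad[OF sm]
      by (intro compact_continuous_image) (auto simp: compact_closure intro: continuous_on_subset)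
    moreover have "range (grad \<phi>) \<subseteq> insert 0 (grad \<phi> ` closure {x. grad \<phi> x \<noteq> 0})"
      using closure_subset[of "{x. grad \<phi> x \<noteq> 0}"] by auto
    ultimately show ?thesis
      using bounded_subset compact_imp_bounded bounded_insert by metis
  qed
  then obtain B where B: "\<And>x. norm (grad \<phi> x) \<le> B" unfolding bounded_iff by auto
  have lip: "\<bar>\<phi> x - \<phi> y\<bar> \<le> B * norm (x - y)" for x y
  proof -
    have "norm (\<phi> x - \<phi> y) \<le> B * norm (x - y)"
    proof (rule differentiable_bound)
      show "(\<phi> has_derivative (\<lambda>h. grad \<phi> z \<bullet> h)) (at z within UNIV)" for z
        using smooth_has_derivative[OF sm] by simp
      show "onorm (\<lambda>h. grad \<phi> z \<bullet> h) \<le> B" for z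
      proof (rule onorm_le)
        fix v
        have "norm (grad \<phi> z \<bullet> v) \<le> norm (grad \<phi> z) * norm v"
          by (simp add: Cauchy_Schwarz_ineq2)
        also have "\<dots> \<le> B * norm v" using B by (intro mult_right_mono) auto
        finally show "norm (grad \<phi> z \<bullet> v) \<le> B * norm v" .
      qed
    qed auto
    then show ?thesis by simp
  qed
  have qb: "\<bar>q k x\<bar> \<le> B * indicator (cball 0 (R + 1)) x" for k x
  proof (cases "x \<in> cball 0 (R + 1)")
    case True
    have "norm (h k *\<^sub>R e) = h k" using h[of k] by (simp add: e_def)
    then show ?thesis using lip[of "x + h k *\<^sub>R e" x] h[of k] True
      by (simp add: q_def divide_simps)
  next
    case False
    have "norm (h k *\<^sub>R e) \<le> 1" using h[of k] by (simp add: e_def)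
    then have "\<not> norm (x + h k *\<^sub>R e) \<le> R" "\<not> norm x \<le> R"
      using False norm_triangle_ineq4[of "x + h k *\<^sub>R e" "h k *\<^sub>R e"] by auto
    then have "\<phi> (x + h k *\<^sub>R e) = 0" "\<phi> x = 0" using R by blast+
    then show ?thesis using False by (simp add: q_def)
  qed
  have cont: "continuous_on UNIV \<phi>" using sm by (rule smooth_continuous)
  have shift: "continuous_on UNIV (\<lambda>x. \<phi> (x + h k *\<^sub>R e))" for k
    by (intro continuous_on_compose2[OF cont] continuous_intros) auto
  have "(\<lambda>k. LINT x|lebesgue. q k x) \<longlonglongrightarrow> (LINT x|lebesgue. partial_deriv j \<phi> x)"
  proof (rule integral_dominated_convergence)
    show "partial_deriv j \<phi> \<in> borel_measurable lebesgue"
      by (intro continuous_lebesgue_measurable smooth_continuous smooth_partial_deriv sm)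
    show "q k \<in> borel_measurable lebesgue" for k
      unfolding q_def by (intro continuous_lebesgue_measurable continuous_intros shift cont)
        (use h[of k] in auto)
    have "integrable lebesgue (indicator (cball 0 (R + 1)) :: real^'n \<Rightarrow> real)"
      using emeasure_bounded_finite[OF bounded_cball, of "0::real^'n" "R + 1"]
      by (intro integrable_real_indicator) auto
    then show "integrable lebesgue (\<lambda>x::real^'n. B * indicator (cball 0 (R + 1)) x)"
      by simp
    show "AE x in lebesgue. norm (q k x) \<le> B * indicator (cball 0 (R + 1)) x" for k
      using qb by simp
    show "AE x in lebesgue. (\<lambda>k. q k x) \<longlonglongrightarrow> partial_deriv j \<phi> x"
    proof (intro AE_I2)
      fix x
      have "((\<lambda>s. \<phi> (x + s *\<^sub>R e)) has_derivative (\<lambda>s. grad \<phi> x \<bullet> (s *\<^sub>R e))) (at 0)"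
        by (rule has_derivative_compose[of "\<lambda>s. x + s *\<^sub>R e" "\<lambda>s. s *\<^sub>R e"])
          (use smooth_has_derivative[OF sm, of x] in \<open>auto intro!: derivative_eq_intros\<close>)
      moreover have "(\<lambda>s. grad \<phi> x \<bullet> (s *\<^sub>R e)) = (*) (partial_deriv j \<phi> x)"
        by (auto simp: e_def inner_axis)
      ultimately have "((\<lambda>s. \<phi> (x + s *\<^sub>R e)) has_real_derivative partial_deriv j \<phi> x) (at 0)"
        by (simp add: has_field_derivative_def)
      then have "((\<lambda>s. (\<phi> (x + s *\<^sub>R e) - \<phi> x) / s) \<longlongrightarrow> partial_deriv j \<phi> x) (at 0)"
        by (simp add: has_field_derivative_iff)
      then show "(\<lambda>k. q k x) \<longlonglongrightarrow> partial_deriv j \<phi> x"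
        unfolding q_def
        by (rule filterlim_compose) (use h0 h in \<open>auto simp: filterlim_at less_imp_neq[symmetric]\<close>)
    qed
  qed
  moreover have "(LINT x|lebesgue. q k x) = 0" for k
  proof -
    have int: "integrable lebesgue \<phi>"
      using \<phi> cont by (intro integrable_bounded_support locally_integrable_continuous)
        (auto simp: test_functions_iff)
    have "bounded {x. \<phi> (x + h k *\<^sub>R e) \<noteq> 0}"
      unfolding bounded_iff
    proof (intro exI ballI)
      fix x assume "x \<in> {x. \<phi> (x + h k *\<^sub>R e) \<noteq> 0}"
      then show "norm x \<le> R + norm (h k *\<^sub>R e)"
        using R[of "x + h k *\<^sub>R e"] norm_triangle_ineq4[of "x + h k *\<^sub>R e" "h k *\<^sub>R e"] by auto
    qed
    then have "integrable lebesgue (\<lambda>x. \<phi> (x + h k *\<^sub>R e))"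
      by (intro integrable_bounded_support locally_integrable_continuous shift)
    then show ?thesis unfolding q_def
      using int lebesgue_integral_translation[OF cont, of "h k *\<^sub>R e"]
      by (simp add: integral_divide_zero)
  qed
  ultimately show ?thesis by (simp add: LIMSEQ_const_iff)
qed

section \<open>Radial bumps and cutoff functions\<close>

text \<open>The bumps are radial functions of a single profile, so that the Laplacian of a bump
  can be compared with the derivative of a kernel in the radius.\<close>

definition bump :: "real^'n::finite \<Rightarrow> real \<Rightarrow> real^'n \<Rightarrow> real" where
  "bump y \<rho> z = flat_exp (1 - (norm (z - y))\<^sup>2 / \<rho>\<^sup>2)"

text \<open>This smooth step is \<open>0\<close> at \<open>0\<close> and \<open>1\<close> on \<open>{1..}\<close>. It flattens a bump into
  a cutoff with a plateau, and \<open>saturate (k * w)\<close> converges to the indicator of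
  \<open>{w > 0}\<close> for \<open>w \<ge> 0\<close> as \<open>k\<close> grows.\<close>

definition saturate :: "real \<Rightarrow> real" where
  "saturate v = 1 - flat_exp (1 - v) / flat_exp 1"

text \<open>The bump takes the value \<open>flat_exp (3/4)\<close> at distance \<open>R/2\<close> from \<open>y\<close>, so this normalization
  puts the plateau of the cutoff on the ball of half the radius.\<close>

definition cutoff :: "real^'n::finite \<Rightarrow> real \<Rightarrow> real^'n \<Rightarrow> real" where
  "cutoff y R z = saturate (bump y R z / flat_exp (3 / 4))"

lemma bump_nonneg: "0 \<le> bump y \<rho> z" and bump_le_1: "bump y \<rho> z \<le> 1"
  by (simp_all add: bump_def flat_exp_nonneg flat_exp_le_1)

lemma bump_pos_iff:
  assumes "0 < \<rho>"
  shows "0 < bump y \<rho> z \<longleftrightarrow> z \<in> ball y \<rho>"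
proof -
  have "0 < bump y \<rho> z \<longleftrightarrow> (norm (z - y))\<^sup>2 < \<rho>\<^sup>2"
    using assms by (simp add: bump_def flat_exp_pos_iff)
  also have "\<dots> \<longleftrightarrow> norm (z - y) < \<rho>"
    using assms by (auto intro: power2_less_imp_less power_strict_mono)
  finally show ?thesis by (simp add: dist_norm norm_minus_commute)
qed

lemma bump_nonzero_iff: "0 < \<rho> \<Longrightarrow> bump y \<rho> z \<noteq> 0 \<longleftrightarrow> z \<in> ball y \<rho>"
  using bump_pos_iff bump_nonneg by (metis less_eq_real_def less_irrefl)

lemma saturate_0: "saturate 0 = 0" and saturate_eq_1: "1 \<le> v \<Longrightarrow> saturate v = 1"
  by (auto simp: saturate_def flat_exp_def)

lemma saturate_nonneg: "0 \<le> v \<Longrightarrow> 0 \<le> saturate v" and saturate_le_1: "saturate v \<le> 1"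
  using flat_exp_mono[of "1 - v" 1] flat_exp_pos_iff[of 1] flat_exp_nonneg[of "1 - v"]
  by (auto simp: saturate_def divide_simps)

lemma smooth_saturate:
  assumes "smooth w"
  shows "smooth (\<lambda>x. saturate (c * w x))"
proof -
  have "smooth (\<lambda>x. 1 - (1 / flat_exp 1) * flat_exp (1 - c * w x))"
    by (intro smooth_diff smooth_const smooth_cmult smooth_compose[OF smooth_real_flat_exp] assms)
  then show ?thesis by (simp add: saturate_def)
qed

lemma test_functions_saturate:
  assumes "w \<in> test_functions"
  shows "(\<lambda>x. saturate (c * w x)) \<in> test_functions"
proof -
  have "{x. saturate (c * w x) \<noteq> 0} \<subseteq> {x. w x \<noteq> 0}" using saturate_0 by auto
  then show ?thesis using assms smooth_saturate bounded_subset by (auto simp: test_functions_iff)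
qed

lemma bump_test:
  assumes "0 < \<rho>"
  shows "bump y \<rho> \<in> test_functions"
proof -
  have "smooth (\<lambda>z. flat_exp (1 - (1 / \<rho>\<^sup>2) * (norm (z - y))\<^sup>2))"
    by (intro smooth_diff smooth_const smooth_cmult smooth_compose[OF smooth_real_flat_exp] smooth_norm_squared)
  then have "smooth (bump y \<rho>)" by (simp add: bump_def [abs_def])
  moreover have "{z. bump y \<rho> z \<noteq> 0} = ball y \<rho>" using bump_nonzero_iff[OF assms, of y] by blast
  ultimately show ?thesis by (simp add: test_functions_iff)
qed

lemma cutoff_test: "0 < R \<Longrightarrow> cutoff y R \<in> test_functions"
  using test_functions_saturate[OF bump_test, of R "1 / flat_exp (3 / 4)" y]
  by (simp add: cutoff_def[abs_def])

lemma cutoff_nonneg: "0 \<le> cutoff y R z" and cutoff_le_1: "cutoff y R z \<le> 1"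
  by (auto simp: cutoff_def saturate_le_1 intro!: saturate_nonneg divide_nonneg_nonneg bump_nonneg flat_exp_nonneg)

lemma cutoff_eq_0: "0 < R \<Longrightarrow> z \<notin> ball y R \<Longrightarrow> cutoff y R z = 0"
  using bump_nonzero_iff[of R y z] by (auto simp: cutoff_def saturate_0)

lemma cutoff_eq_1:
  assumes "0 < R" "dist y z \<le> R / 2"
  shows "cutoff y R z = 1"
proof -
  have "(norm (z - y))\<^sup>2 \<le> (R / 2)\<^sup>2"
    using assms by (intro power_mono) (auto simp: dist_norm norm_minus_commute)
  then have "3 / 4 \<le> 1 - (norm (z - y))\<^sup>2 / R\<^sup>2"
    using assms by (simp add: divide_simps power2_eq_square)
  then have "flat_exp (3 / 4) \<le> bump y R z" by (simp add: bump_def flat_exp_mono)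
  then show ?thesis using flat_exp_pos_iff[of "3 / 4"]
    by (auto simp: cutoff_def divide_simps intro!: saturate_eq_1)
qed

lemma partial_deriv_norm_squared:
  "partial_deriv j (\<lambda>z. (norm (z - y))\<^sup>2) z = 2 * (z $ j - y $ j)"
proof -
  have "((\<lambda>z. (norm (z - y))\<^sup>2) has_derivative (\<lambda>h. 2 * ((z - y) \<bullet> h))) (at z)"
    unfolding power2_norm_eq_inner
    by (auto intro!: derivative_eq_intros simp: inner_commute)
  from partial_deriv_eq[OF this] show ?thesis by (simp add: inner_axis)
qed

lemma partial_deriv_flat_deriv_radial:
  "partial_deriv j (\<lambda>z. flat_deriv k (1 - (norm (z - y))\<^sup>2 / \<rho>\<^sup>2)) z
    = - flat_deriv (Suc k) (1 - (norm (z - y))\<^sup>2 / \<rho>\<^sup>2) * (2 * (z $ j - y $ j) / \<rho>\<^sup>2)"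
proof -
  have "partial_deriv j (\<lambda>z. (\<lambda>s. flat_deriv k (1 - s / \<rho>\<^sup>2)) ((norm (z - y))\<^sup>2)) z
    = (flat_deriv (Suc k) (1 - (norm (z - y))\<^sup>2 / \<rho>\<^sup>2) * (0 - 1 / \<rho>\<^sup>2))
      * partial_deriv j (\<lambda>z. (norm (z - y))\<^sup>2) z"
    by (rule partial_deriv_compose[OF smooth_differentiable[OF smooth_norm_squared]],
        rule DERIV_chain2[OF DERIV_flat_deriv DERIV_diff[OF DERIV_const DERIV_cdivide[OF DERIV_ident]]])
  then show ?thesis by (simp add: partial_deriv_norm_squared)
qed

lemma partial_deriv_bump:
  "partial_deriv j (bump y \<rho>) z
    = - flat_deriv 1 (1 - (norm (z - y))\<^sup>2 / \<rho>\<^sup>2) * (2 * (z $ j - y $ j) / \<rho>\<^sup>2)"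
  using partial_deriv_flat_deriv_radial[of j 0 y \<rho> z]
  by (simp add: flat_deriv_0 bump_def[abs_def])

lemma grad_bump:
  "grad (bump y \<rho>) z = (- flat_deriv 1 (1 - (norm (z - y))\<^sup>2 / \<rho>\<^sup>2) * 2 / \<rho>\<^sup>2) *\<^sub>R (z - y)"
  by (simp add: vec_eq_iff partial_deriv_bump)

lemma laplacian_bump:
  fixes y z :: "real^'n::finite"
  shows "laplacian (bump y \<rho>) z
    = 4 * flat_deriv 2 (1 - (norm (z - y))\<^sup>2 / \<rho>\<^sup>2) * (norm (z - y))\<^sup>2 / \<rho>^4
      - 2 * real CARD('n) * flat_deriv 1 (1 - (norm (z - y))\<^sup>2 / \<rho>\<^sup>2) / \<rho>\<^sup>2"
proof -
  let ?p = "1 - (norm (z - y))\<^sup>2 / \<rho>\<^sup>2"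
  have "partial_deriv j (partial_deriv j (bump y \<rho>)) z
     = 4 * flat_deriv 2 ?p * (z $ j - y $ j)\<^sup>2 / \<rho>^4 - 2 * flat_deriv 1 ?p / \<rho>\<^sup>2" for j
  proof -
    have *: "partial_deriv j (bump y \<rho>)
       = (\<lambda>z. flat_deriv 1 (1 - (norm (z - y))\<^sup>2 / \<rho>\<^sup>2) * ((- 2 / \<rho>\<^sup>2) * (z $ j + (- y $ j))))"
      by (rule ext) (simp add: partial_deriv_bump)
    have d1: "(\<lambda>z. flat_deriv 1 (1 - (norm (z - y))\<^sup>2 / \<rho>\<^sup>2)) differentiable (at z)"
    proof -
      have "smooth_real (flat_deriv 1)"
        unfolding smooth_real_def
        by (rule exI[of _ "\<lambda>k. flat_deriv (Suc k)"]) (use DERIV_flat_deriv in auto)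
      then have "smooth (\<lambda>z. flat_deriv 1 (1 - (1 / \<rho>\<^sup>2) * (norm (z - y))\<^sup>2))"
        by (intro smooth_compose[of "flat_deriv 1"] smooth_diff smooth_const smooth_cmult smooth_norm_squared)
      from smooth_differentiable[OF this] show ?thesis by simp
    qed
    have d2: "((\<lambda>z. (- 2 / \<rho>\<^sup>2) * (z $ j + (- y $ j))) has_derivative (\<lambda>h. (- 2 / \<rho>\<^sup>2) * h $ j)) (at z)"
    proof -
      have "((\<lambda>z. (- 2 / \<rho>\<^sup>2) * (z $ j + (- y $ j))) has_derivative
          (\<lambda>h. (- 2 / \<rho>\<^sup>2) * (h $ j + 0))) (at z)"
        by (intro has_derivative_mult_right has_derivative_add has_derivative_const
            bounded_linear_imp_has_derivative bounded_linear_vec_nth)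
      then show ?thesis by (simp only: add_0_right)
    qed
    have "partial_deriv j (\<lambda>z. (- 2 / \<rho>\<^sup>2) * (z $ j + (- y $ j))) z = - 2 / \<rho>\<^sup>2"
      by (subst partial_deriv_eq[OF d2]) simp
    moreover have "(\<lambda>z. (- 2 / \<rho>\<^sup>2) * (z $ j + (- y $ j))) differentiable (at z)"
      using d2 differentiableI by blast
    moreover have "partial_deriv j (\<lambda>z. flat_deriv 1 (1 - (norm (z - y))\<^sup>2 / \<rho>\<^sup>2)) z
        = - flat_deriv 2 ?p * (2 * (z $ j - y $ j) / \<rho>\<^sup>2)"
      using partial_deriv_flat_deriv_radial[of j 1 y \<rho> z] by (simp add: numeral_2_eq_2)
    ultimately have "partial_deriv j (partial_deriv j (bump y \<rho>)) z
        = flat_deriv 1 ?p * (- 2 / \<rho>\<^sup>2)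
          + (- flat_deriv 2 ?p * (2 * (z $ j - y $ j) / \<rho>\<^sup>2)) * ((- 2 / \<rho>\<^sup>2) * (z $ j + (- y $ j)))"
      unfolding * by (simp only: partial_deriv_mult[OF d1])
    also have "\<dots> = 4 * flat_deriv 2 ?p * (z $ j - y $ j)\<^sup>2 / (\<rho>\<^sup>2 * \<rho>\<^sup>2) - 2 * flat_deriv 1 ?p / \<rho>\<^sup>2"
    proof -
      have "a * (- 2 / s) + (- b * (2 * d / s)) * ((- 2 / s) * d) = 4 * b * d\<^sup>2 / (s * s) - 2 * a / s"
        for a b d s :: real
        by (simp add: power2_eq_square mult_ac)
      then show ?thesis by (simp only: diff_conv_add_uminus)
    qed
    finally show ?thesis by (simp add: power_add[symmetric])
  qed
  then have "laplacian (bump y \<rho>) z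
      = (\<Sum>j\<in>UNIV. 4 * flat_deriv 2 ?p / \<rho>^4 * (z $ j - y $ j)\<^sup>2 - 2 * flat_deriv 1 ?p / \<rho>\<^sup>2)"
    by (simp add: laplacian_def)
  also have "\<dots> = 4 * flat_deriv 2 ?p / \<rho>^4 * (\<Sum>j\<in>UNIV. (z $ j - y $ j)\<^sup>2)
      - real CARD('n) * (2 * flat_deriv 1 ?p / \<rho>\<^sup>2)"
    by (simp add: sum_subtractf sum_distrib_left)
  also have "(\<Sum>j\<in>UNIV. (z $ j - y $ j)\<^sup>2) = (norm (z - y))\<^sup>2"
    unfolding power2_norm_eq_inner inner_vec_def by (simp add: power2_eq_square)
  finally show ?thesis by simp
qed

lemma flat_deriv_outside:
  assumes "0 < \<rho>" "z \<notin> ball y \<rho>"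
  shows "flat_deriv k (1 - (norm (z - y))\<^sup>2 / \<rho>\<^sup>2) = 0"
proof -
  have "\<rho>\<^sup>2 \<le> (norm (z - y))\<^sup>2"
    using assms by (intro power_mono) (auto simp: dist_norm norm_minus_commute)
  then have "1 - (norm (z - y))\<^sup>2 / \<rho>\<^sup>2 \<le> 0" using assms by simp
  then show ?thesis by (simp add: flat_deriv_def)
qed

lemma grad_bump_outside: "0 < \<rho> \<Longrightarrow> z \<notin> ball y \<rho> \<Longrightarrow> grad (bump y \<rho>) z = 0"
  by (simp add: grad_bump flat_deriv_outside del: mem_ball)

lemma laplacian_bump_outside: "0 < \<rho> \<Longrightarrow> z \<notin> ball y \<rho> \<Longrightarrow> laplacian (bump y \<rho>) z = 0"
  by (simp add: laplacian_bump flat_deriv_outside del: mem_ball)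

lemma norm_grad_bump_le:
  assumes "0 < \<rho>" and L: "\<And>t. t \<le> 1 \<Longrightarrow> \<bar>flat_deriv 1 t\<bar> \<le> L"
  shows "norm (grad (bump y \<rho>) z) \<le> 2 * L / \<rho>"
proof (cases "z \<in> ball y \<rho>")
  case True
  let ?p = "1 - (norm (z - y))\<^sup>2 / \<rho>\<^sup>2"
  have "0 \<le> L" using L[of 0] by linarith
  have "norm (grad (bump y \<rho>) z) = \<bar>flat_deriv 1 ?p\<bar> * 2 / \<rho>\<^sup>2 * norm (z - y)"
    by (simp add: grad_bump abs_mult)
  also have "\<dots> \<le> L * 2 / \<rho>\<^sup>2 * \<rho>"
    using True assms by (intro mult_mono divide_right_mono mult_right_mono L)
      (use \<open>0 \<le> L\<close> in \<open>auto simp: dist_norm norm_minus_commute\<close>)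
  finally show ?thesis using assms by (simp add: power2_eq_square mult.commute)
next
  case False
  moreover have "0 \<le> L" using L[of 0] by linarith
  ultimately show ?thesis using assms(1) by (simp add: grad_bump_outside)
qed

lemma grad_cutoff:
  assumes "0 < R"
  shows "grad (cutoff y R) z = (flat_deriv 1 (1 - bump y R z / flat_exp (3 / 4))
      / (flat_exp 1 * flat_exp (3 / 4))) *\<^sub>R grad (bump y R) z"
proof -
  have "partial_deriv j (cutoff y R) z = (flat_deriv 1 (1 - bump y R z / flat_exp (3 / 4))
      / (flat_exp 1 * flat_exp (3 / 4))) * partial_deriv j (bump y R) z" for j
  proof -
    have "((\<lambda>s. saturate (s / flat_exp (3 / 4))) has_real_derivative
        (flat_deriv 1 (1 - v / flat_exp (3 / 4)) / (flat_exp 1 * flat_exp (3 / 4)))) (at v)" for v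
      unfolding saturate_def
      using DERIV_diff[OF DERIV_const[of 1] DERIV_cdivide[OF DERIV_chain2[OF
            DERIV_flat_deriv[of 0, unfolded flat_deriv_0]
            DERIV_diff[OF DERIV_const[of 1] DERIV_cdivide[OF DERIV_ident]], of "flat_exp (3 / 4)" v], of "flat_exp 1"]]
      by (simp add: mult.commute)
    from partial_deriv_compose[OF smooth_differentiable[OF test_functions_smooth[OF bump_test[OF assms]]] this]
    show ?thesis by (simp add: cutoff_def[abs_def])
  qed
  then show ?thesis by (simp add: vec_eq_iff)
qed

text \<open>The constant is independent of the radius, because the profile is fixed and only
  its argument is rescaled.\<close>

lemma cutoff_gradient_bound:
  "\<exists>L>0. \<forall>(y::real^'n::finite) R z. 0 < R \<longrightarrow> norm (grad (cutoff y R) z) \<le> L / R"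
proof -
  obtain L where L: "L > 0" "\<And>t. t \<le> 1 \<Longrightarrow> \<bar>flat_deriv 1 t\<bar> \<le> L"
    using flat_deriv_bounded by blast
  let ?c = "flat_exp 1 * flat_exp (3 / 4)"
  have c: "0 < ?c" by (simp add: flat_exp_pos_iff)
  have "norm (grad (cutoff y R) z) \<le> (L / ?c * (2 * L)) / R" if "0 < R" for y z :: "real^'n" and R
  proof -
    have "\<bar>flat_deriv 1 (1 - bump y R z / flat_exp (3 / 4))\<bar> / ?c \<le> L / ?c"
      using c by (intro divide_right_mono L) (auto simp: bump_nonneg flat_exp_nonneg)
    then have "norm (grad (cutoff y R) z) \<le> L / ?c * (2 * L / R)"
      unfolding grad_cutoff[OF that] norm_scaleR
      using norm_grad_bump_le[OF that L(2)] c L(1) by (intro mult_mono) (auto simp: abs_mult abs_of_nonneg[OF flat_exp_nonneg])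
    then show ?thesis by simp
  qed
  moreover have "0 < L / ?c * (2 * L)" using L c by simp
  ultimately show ?thesis by blast
qed

lemma grad_cutoff_outside: "0 < R \<Longrightarrow> z \<notin> ball y R \<Longrightarrow> grad (cutoff y R) z = 0"
  by (simp add: grad_cutoff grad_bump_outside)

section \<open>The fundamental lemma of the calculus of variations\<close>

text \<open>These sets form a generator of the Borel sets that suits the fundamental lemma: it is closed
  under intersection, since the product of two test functions is a test function, and the
  indicator of each member is a bounded limit of test functions.\<close>

definition test_supports :: "(real^'n::finite) set set" where
  "test_supports = {{x. 0 < w x} | w. w \<in> test_functions \<and> (\<forall>x. 0 \<le> w x)}"

lemma ball_in_test_supports: "0 < \<rho> \<Longrightarrow> ball y \<rho> \<in> test_supports"
  unfolding test_supports_def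
  using bump_test[of \<rho> y] bump_pos_iff[of \<rho> y] bump_nonneg[of y \<rho>]
  by (auto intro!: exI[of _ "bump y \<rho>"] simp del: mem_ball)

lemma Int_stable_test_supports: "Int_stable test_supports"
proof (rule Int_stableI)
  fix A B :: "(real^'n) set" assume "A \<in> test_supports" "B \<in> test_supports"
  then obtain v w where *: "A = {x. 0 < v x}" "v \<in> test_functions" "\<forall>x. 0 \<le> v x"
      "B = {x. 0 < w x}" "w \<in> test_functions" "\<forall>x. 0 \<le> w x"
    unfolding test_supports_def by blast
  then have "A \<inter> B = {x. 0 < v x * w x}" "(\<lambda>x. v x * w x) \<in> test_functions" "\<forall>x. 0 \<le> v x * w x"
    by (auto simp: zero_less_mult_iff test_functions_smooth dest: spec[of _ "_::real^'n"]
        intro!: test_functions_mult) (metis less_le_not_le)+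
  then show "A \<inter> B \<in> test_supports"
    unfolding test_supports_def by (intro CollectI exI[of _ "\<lambda>x. v x * w x"] conjI) auto
qed

text \<open>The generator contains all balls, and by Lindelof's theorem an open set is a countable union of
  balls.\<close>

lemma borel_eq_test_supports: "sets borel = sigma_sets UNIV (test_supports :: (real^'n::finite) set set)"
proof
  have "S \<in> sigma_sets UNIV test_supports" if "open S" for S :: "(real^'n) set"
  proof -
    define F where "F = {ball x e | x e. 0 < e \<and> ball x e \<subseteq> S}"
    obtain F' where F': "F' \<subseteq> F" "countable F'" "\<Union>F' = \<Union>F"
      using Lindelof[of F] unfolding F_def by blast
    have "\<Union>F = S"
      using openE[OF that] centre_in_ball unfolding F_def by (auto, metis)
    then have "S = \<Union>F'" using F' by simp
    moreover have "F' \<subseteq> test_supports"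
      using F'(1) ball_in_test_supports unfolding F_def by blast
    ultimately show ?thesis
      using F'(2) by (auto intro: sigma_sets_UNION sigma_sets.Basic)
  qed
  then show "sets borel \<subseteq> sigma_sets UNIV (test_supports :: (real^'n) set set)"
    unfolding borel_def using sigma_sets_mono[of "{S. open S}" UNIV test_supports] by auto
  have "A \<in> sets borel" if A: "A \<in> test_supports" for A :: "(real^'n) set"
  proof -
    obtain w where w: "A = {x. 0 < w x}" "w \<in> test_functions"
      using A by (auto simp: test_supports_def)
    then have "w \<in> borel_measurable borel"
      by (intro borel_measurable_continuous_onI smooth_continuous test_functions_smooth)
    then show ?thesis using w(1) by (simp add: borel_measurable_iff_greater)
  qed
  then show "sigma_sets UNIV (test_supports :: (real^'n) set set) \<subseteq> sets borel"
    using sets.sigma_sets_subset[of test_supports "borel :: (real^'n) measure"] by auto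
qed

text \<open>The functions \<open>saturate (k * w)\<close> are test functions that converge to the indicator of \<open>{w > 0}\<close>
  and vanish outside the support of \<open>w\<close>, so dominated convergence applies.\<close>

lemma fundamental_lemma_test_supports:
  fixes D :: "real^'n::finite \<Rightarrow> real"
  assumes D: "locally_integrable D"
    and zero: "\<And>\<phi>. \<phi> \<in> test_functions \<Longrightarrow> (LINT x|lebesgue. D x * \<phi> x) = 0"
    and A: "A \<in> test_supports"
  shows "(LINT x:A|lebesgue. D x) = 0"
proof -
  obtain w where w: "A = {x. 0 < w x}" "w \<in> test_functions" "\<And>x. 0 \<le> w x"
    using A by (auto simp: test_supports_def)
  have [measurable]: "D \<in> borel_measurable lebesgue" "w \<in> borel_measurable lebesgue"
    using D w(2) by (auto simp: locally_integrable_def intro: continuous_lebesgue_measurable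
        smooth_continuous test_functions_smooth)
  define K where "K = closure {x. w x \<noteq> 0}"
  have K: "compact K" using w(2) by (simp add: K_def test_functions_iff compact_closure)
  have Kw: "w x \<noteq> 0 \<Longrightarrow> x \<in> K" for x using closure_subset[of "{x. w x \<noteq> 0}"] by (auto simp: K_def)
  have "(\<lambda>k. LINT x|lebesgue. D x * saturate (real k * w x)) \<longlonglongrightarrow> (LINT x|lebesgue. indicator A x *\<^sub>R D x)"
  proof (rule integral_dominated_convergence)
    have "A = w -` {0<..} \<inter> space lebesgue" using w(1) by auto
    then have [measurable]: "A \<in> sets lebesgue" by (metis \<open>w \<in> borel_measurable lebesgue\<close> measurable_sets borel_open open_greaterThan)
    show "(\<lambda>x. indicator A x *\<^sub>R D x) \<in> borel_measurable lebesgue" by measurable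
    show "(\<lambda>x. D x * saturate (real k * w x)) \<in> borel_measurable lebesgue" for k
      using integrable_mult_test[OF D test_functions_saturate[OF w(2)]] by blast
    show "integrable lebesgue (\<lambda>x. norm (indicator K x *\<^sub>R D x))"
      using D K by (intro integrable_norm) (simp add: locally_integrable_def set_integrable_def)
    have "\<bar>saturate (real k * w x)\<bar> \<le> indicator K x" for k x
      using saturate_le_1[of "real k * w x"] saturate_nonneg[of "real k * w x"] w(3)[of x] Kw[of x]
      by (cases "w x = 0") (auto simp: saturate_0)
    then show "AE x in lebesgue. norm (D x * saturate (real k * w x)) \<le> norm (indicator K x *\<^sub>R D x)" for k
      by (intro AE_I2) (auto simp: abs_mult mult.commute[of _ "\<bar>D _\<bar>"] intro!: mult_left_mono)
    show "AE x in lebesgue. (\<lambda>k. D x * saturate (real k * w x)) \<longlonglongrightarrow> indicator A x *\<^sub>R D x"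
    proof (intro AE_I2)
      fix x
      show "(\<lambda>k. D x * saturate (real k * w x)) \<longlonglongrightarrow> indicator A x *\<^sub>R D x"
      proof (cases "0 < w x")
        case True
        obtain n :: nat where n: "1 / w x \<le> real n" using real_arch_simple by blast
        have "\<forall>\<^sub>F k in sequentially. D x * saturate (real k * w x) = D x"
        proof (rule eventually_sequentiallyI[of n])
          fix k assume "n \<le> k"
          then have "1 / w x \<le> real k" using n by linarith
          then show "D x * saturate (real k * w x) = D x"
            using True by (simp add: saturate_eq_1 divide_simps)
        qed
        then show ?thesis using True w(1) by (simp add: tendsto_eventually)
      next
        case False
        then have "w x = 0" using w(3)[of x] by linarith
        then show ?thesis using w(1) by (simp add: saturate_0)
      qed
    qed
  qed
  moreover have "(LINT x|lebesgue. D x * saturate (real k * w x)) = 0" for k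
    by (rule zero[OF test_functions_saturate[OF w(2)]])
  ultimately show ?thesis by (simp add: LIMSEQ_const_iff set_lebesgue_integral_def)
qed

text \<open>On each ball the sets over which \<open>D\<close> has integral zero form a Dynkin system, which contains
  the intersection-stable generator and hence every Borel set.\<close>

lemma fundamental_lemma:
  fixes D :: "real^'n::finite \<Rightarrow> real"
  assumes D: "locally_integrable D"
    and zero: "\<And>\<phi>. \<phi> \<in> test_functions \<Longrightarrow> (LINT x|lebesgue. D x * \<phi> x) = 0"
  shows "AE x in lebesgue. D x = 0"
proof -
  have "AE x in lebesgue. x \<in> ball 0 (real (Suc k)) \<longrightarrow> D x = 0" for k
  proof -
    define B :: "(real^'n) set" where "B = ball 0 (real (Suc k))"
    define f where "f x = indicator B x *\<^sub>R D x" for x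
    have Bt: "B \<in> test_supports" unfolding B_def by (rule ball_in_test_supports) simp
    have "integrable lebesgue (\<lambda>x. indicator (cball 0 (real (Suc k))) x *\<^sub>R D x)"
      using D by (simp add: locally_integrable_def set_integrable_def)
    then have "integrable lebesgue (\<lambda>x. indicator B x *\<^sub>R (indicator (cball 0 (real (Suc k))) x *\<^sub>R D x))"
      by (rule integrable_mult_indicator[rotated]) (simp add: B_def)
    moreover have "(\<lambda>x. indicator B x *\<^sub>R (indicator (cball 0 (real (Suc k))) x *\<^sub>R D x)) = f"
      by (auto simp: f_def B_def indicator_def)
    ultimately have f: "integrable lebesgue f" by simp
    have int: "set_integrable lebesgue A f" if "A \<in> sets lebesgue" for A
      using integrable_mult_indicator[OF that f] by (simp add: set_integrable_def)
    have borel: "(LINT x:A|lebesgue. f x) = 0" if "A \<in> sigma_sets UNIV test_supports" for A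
    proof -
      have sub: "test_supports \<subseteq> Pow (UNIV :: (real^'n) set)" by simp
      show ?thesis using Int_stable_test_supports sub that
      proof (induction rule: sigma_sets_induct_disjoint)
        case (basic A)
        have "(LINT x:A|lebesgue. f x) = (LINT x:A \<inter> B|lebesgue. D x)"
          by (simp add: set_lebesgue_integral_def f_def indicator_inter_arith mult.assoc)
        also have "\<dots> = 0"
          using basic Bt Int_stable_test_supports
          by (intro fundamental_lemma_test_supports[OF D zero]) (auto simp: Int_stable_def)
        finally show ?case .
      next
        case empty
        show ?case by (simp add: set_lebesgue_integral_def)
      next
        case (compl A)
        then have A: "A \<in> sets lebesgue" using borel_eq_test_supports by (metis sets_completionI_sets sets_lborel)
        have "(LINT x:B|lebesgue. f x) = (LINT x:B|lebesgue. D x)"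
          by (simp add: set_lebesgue_integral_def f_def indicator_inter_arith[symmetric] mult.assoc[symmetric])
        then have "(LINT x:B|lebesgue. f x) = 0"
          using fundamental_lemma_test_supports[OF D zero Bt] by simp
        then have "(LINT x|lebesgue. f x) = 0"
          by (simp add: set_lebesgue_integral_def f_def indicator_inter_arith[symmetric] mult.assoc[symmetric])
        moreover have "(LINT x:UNIV - A|lebesgue. f x) = (LINT x|lebesgue. f x) - (LINT x:A|lebesgue. f x)"
          using set_integral_Un[of A "UNIV - A" lebesgue f] int[OF A] int[OF sets.compl_sets[OF A]] A
          by (simp add: set_lebesgue_integral_def)
        ultimately show ?case using compl by simp
      next
        case (union A)
        then have A: "A i \<in> sets lebesgue" for i
          using borel_eq_test_supports by (metis range_subsetD sets_completionI_sets sets_lborel)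
        have "(LINT x:(\<Union>i. A i)|lebesgue. f x) = (\<Sum>i. (LINT x:(A i)|lebesgue. f x))"
          using union(1) by (intro lebesgue_integral_countable_add A int sets.countable_UN)
            (auto simp: disjoint_family_on_def A)
        then show ?case using union by simp
      qed
    qed
    \<comment> \<open>a Lebesgue measurable set differs from a Borel set by a null set\<close>
    have "AE x in lebesgue. f x = 0"
    proof (rule density_unique_real[OF f])
      fix A :: "(real^'n) set" assume "A \<in> sets lebesgue"
      then obtain S N N' where *: "A = S \<union> N" "N \<subseteq> N'" "N' \<in> null_sets lborel" "S \<in> sets lborel"
        by (rule sets_completionE)
      have "AE x in lborel. x \<notin> N'" using *(3) by (rule AE_not_in)
      then have "AE x in lebesgue. x \<notin> N'" by (rule AE_completion)
      then have "(LINT x:A|lebesgue. f x) = (LINT x:S|lebesgue. f x)"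
        unfolding set_lebesgue_integral_def
        using f \<open>A \<in> sets lebesgue\<close> *(1,2) *(4)
        by (intro integral_cong_AE borel_measurable_scaleR borel_measurable_indicator)
          (auto simp: indicator_def elim!: eventually_mono)
      moreover have "S \<in> sigma_sets UNIV test_supports"
        using *(4) borel_eq_test_supports by (metis sets_lborel)
      ultimately show "(LINT x:A|lebesgue. f x) = (LINT x:A|lebesgue. 0)"
        using borel[of S] by (simp add: set_lebesgue_integral_def)
    qed simp
    then show ?thesis unfolding B_def[symmetric] by (auto simp: f_def elim!: eventually_mono)
  qed
  then have "AE x in lebesgue. \<forall>k. x \<in> ball 0 (real (Suc k)) \<longrightarrow> D x = 0"
    unfolding AE_all_countable ..
  then show ?thesis
  proof (rule eventually_mono)
    fix x :: "real^'n" assume x: "\<forall>k. x \<in> ball 0 (real (Suc k)) \<longrightarrow> D x = 0"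
    obtain k :: nat where "norm x \<le> real k" using real_arch_simple by blast
    then have "x \<in> ball 0 (real (Suc k))" by simp
    then show "D x = 0" using x by blast
  qed
qed

section \<open>Weak gradients\<close>

lemma has_weak_gradient_locally_integrable: "has_weak_gradient u G \<Longrightarrow> locally_integrable G"
  by (simp add: has_weak_gradient_def locally_integrable_def)

lemma has_weak_gradientD:
  "has_weak_gradient u G \<Longrightarrow> \<phi> \<in> test_functions \<Longrightarrow>
    (LINT x|lebesgue. u x * partial_deriv j \<phi> x) = - (LINT x|lebesgue. G x $ j * \<phi> x)"
  by (simp add: has_weak_gradient_def)

lemma has_weak_gradientI:
  assumes "locally_integrable G"
    and "\<And>\<phi> j. \<phi> \<in> test_functions \<Longrightarrow>
      (LINT x|lebesgue. u x * partial_deriv j \<phi> x) = - (LINT x|lebesgue. G x $ j * \<phi> x)"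
  shows "has_weak_gradient u G"
  using assms by (simp add: has_weak_gradient_def locally_integrable_def)

lemma locally_integrable_component:
  fixes G :: "real^'n::finite \<Rightarrow> real^'n"
  assumes "locally_integrable G"
  shows "locally_integrable (\<lambda>x. G x $ j)"
  unfolding locally_integrable_def
proof (intro conjI allI impI)
  have [measurable]: "G \<in> borel_measurable lebesgue" using assms by (simp add: locally_integrable_def)
  have "(\<lambda>x. G x \<bullet> axis j 1) \<in> borel_measurable lebesgue" by measurable
  then show "(\<lambda>x. G x $ j) \<in> borel_measurable lebesgue" by (simp add: inner_axis)
  fix K :: "(real^'n) set" assume "compact K"
  then have "integrable lebesgue (\<lambda>x. (indicator K x *\<^sub>R G x) \<bullet> axis j 1)"
    using assms by (intro integrable_inner_left) (auto simp: locally_integrable_def set_integrable_def)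
  then show "set_integrable lebesgue K (\<lambda>x. G x $ j)"
    by (simp add: set_integrable_def inner_axis)
qed

lemma integrable_component_mult_test:
  assumes "has_weak_gradient u G" "\<phi> \<in> test_functions"
  shows "integrable lebesgue (\<lambda>x. G x $ j * \<phi> x)"
  using assms by (intro integrable_mult_test locally_integrable_component
      has_weak_gradient_locally_integrable)

lemma weak_gradient_unique:
  assumes "has_weak_gradient u G" "has_weak_gradient u H"
  shows "AE x in lebesgue. G x = H x"
proof -
  have "AE x in lebesgue. G x $ j - H x $ j = 0" for j
  proof (rule fundamental_lemma)
    have "locally_integrable (\<lambda>x. G x $ j + (- 1) *\<^sub>R (H x $ j))"
      using assms by (intro locally_integrable_add locally_integrable_component
          locally_integrable_scaleR[of "\<lambda>x. H x $ j"] has_weak_gradient_locally_integrable) auto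
    then show "locally_integrable (\<lambda>x. G x $ j - H x $ j)" by simp
    fix \<phi> :: "real^'a \<Rightarrow> real" assume \<phi>: "\<phi> \<in> test_functions"
    have "(LINT x|lebesgue. (G x $ j - H x $ j) * \<phi> x)
        = (LINT x|lebesgue. G x $ j * \<phi> x) - (LINT x|lebesgue. H x $ j * \<phi> x)"
      using integrable_component_mult_test[OF assms(1) \<phi>] integrable_component_mult_test[OF assms(2) \<phi>]
      by (simp add: left_diff_distrib)
    then show "(LINT x|lebesgue. (G x $ j - H x $ j) * \<phi> x) = 0"
      using has_weak_gradientD[OF assms(1) \<phi>, of j] has_weak_gradientD[OF assms(2) \<phi>, of j] by simp
  qed
  then have "AE x in lebesgue. \<forall>j\<in>UNIV. G x $ j - H x $ j = 0"
    by (intro AE_finite_allI) auto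
  then show ?thesis by (rule eventually_mono) (simp add: vec_eq_iff)
qed

text \<open>This makes the arbitrary choice in \<open>weak_gradient\<close> harmless.\<close>

lemma weak_gradient_AE:
  assumes "has_weak_gradient u G"
  shows "AE x in lebesgue. weak_gradient u x = G x"
  using weak_gradient_unique[OF _ assms] assms
  unfolding weak_gradient_def by (metis someI_ex)

lemma has_weak_gradient_weak_gradient:
  "has_weak_gradient u G \<Longrightarrow> has_weak_gradient u (weak_gradient u)"
  unfolding weak_gradient_def using someI[of "has_weak_gradient u" G] by simp

lemma W12_weak_gradient:
  assumes "u \<in> W12"
  shows "u \<in> L2_loc" "has_weak_gradient u (weak_gradient u)"
    "integrable lebesgue (\<lambda>x. (norm (weak_gradient u x))\<^sup>2)"
proof -
  obtain G where G: "u \<in> L2_loc" "has_weak_gradient u G" "integrable lebesgue (\<lambda>x. (norm (G x))\<^sup>2)"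
    using assms by (auto simp: W12_def)
  show "u \<in> L2_loc" by fact
  show *: "has_weak_gradient u (weak_gradient u)"
    using G(2) by (rule has_weak_gradient_weak_gradient)
  have [measurable]: "weak_gradient u \<in> borel_measurable lebesgue" "G \<in> borel_measurable lebesgue"
    using * G(2) by (auto simp: has_weak_gradient_def)
  show "integrable lebesgue (\<lambda>x. (norm (weak_gradient u x))\<^sup>2)"
    using weak_gradient_AE[OF G(2)] G(3)
    by (subst integrable_cong_AE[of _ _ "\<lambda>x. (norm (G x))\<^sup>2"]) (auto elim!: eventually_mono)
qed

lemma integral_weak_gradient:
  assumes "has_weak_gradient u G"
  shows "(LINT x|lebesgue. (norm (weak_gradient u x))\<^sup>2) = (LINT x|lebesgue. (norm (G x))\<^sup>2)"
proof -
  have [measurable]: "weak_gradient u \<in> borel_measurable lebesgue" "G \<in> borel_measurable lebesgue"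
    using assms has_weak_gradient_weak_gradient[OF assms] by (auto simp: has_weak_gradient_def)
  show ?thesis
    using weak_gradient_AE[OF assms] by (intro integral_cong_AE) (auto elim!: eventually_mono)
qed

lemma W12I:
  assumes "u \<in> L2_loc" "has_weak_gradient u G" "integrable lebesgue (\<lambda>x. (norm (G x))\<^sup>2)"
  shows "u \<in> W12"
  using assms by (auto simp: W12_def)

lemma has_weak_gradient_mult:
  assumes u: "locally_integrable u" "has_weak_gradient u G" and w: "smooth w"
  shows "has_weak_gradient (\<lambda>x. w x * u x) (\<lambda>x. w x *\<^sub>R G x + u x *\<^sub>R grad w x)"
proof (rule has_weak_gradientI)
  show "locally_integrable (\<lambda>x. w x *\<^sub>R G x + u x *\<^sub>R grad w x)"
    using u w by (intro locally_integrable_add locally_integrable_scaleR locally_integrable_scaleR_right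
        has_weak_gradient_locally_integrable smooth_continuous smooth_continuous_grad)
  fix \<phi> :: "real^'a \<Rightarrow> real" and j assume \<phi>: "\<phi> \<in> test_functions"
  have w\<phi>: "(\<lambda>x. w x * \<phi> x) \<in> test_functions" by (rule test_functions_mult[OF w \<phi>])
  have dw: "(\<lambda>x. partial_deriv j w x * \<phi> x) \<in> test_functions"
    by (rule test_functions_mult[OF smooth_partial_deriv[OF w] \<phi>])
  have pd: "partial_deriv j (\<lambda>x. w x * \<phi> x) x
      = w x * partial_deriv j \<phi> x + partial_deriv j w x * \<phi> x" for x
    by (intro partial_deriv_mult smooth_differentiable w test_functions_smooth \<phi>)
  have i1: "integrable lebesgue (\<lambda>x. u x * partial_deriv j (\<lambda>x. w x * \<phi> x) x)"
    by (intro integrable_mult_test u test_functions_partial_deriv w\<phi>)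
  have i2: "integrable lebesgue (\<lambda>x. u x * (partial_deriv j w x * \<phi> x))"
    by (intro integrable_mult_test u dw)
  have i3: "integrable lebesgue (\<lambda>x. G x $ j * (w x * \<phi> x))"
    by (rule integrable_component_mult_test[OF u(2) w\<phi>])
  have "(LINT x|lebesgue. w x * u x * partial_deriv j \<phi> x)
      = (LINT x|lebesgue. u x * partial_deriv j (\<lambda>x. w x * \<phi> x) x - u x * (partial_deriv j w x * \<phi> x))"
    unfolding pd by (intro Bochner_Integration.integral_cong) (auto simp: algebra_simps)
  also have "\<dots> = - (LINT x|lebesgue. G x $ j * (w x * \<phi> x))
      - (LINT x|lebesgue. u x * (partial_deriv j w x * \<phi> x))"
    using i1 i2 by (simp add: has_weak_gradientD[OF u(2) w\<phi>])
  also have "\<dots> = - (LINT x|lebesgue. G x $ j * (w x * \<phi> x) + u x * (partial_deriv j w x * \<phi> x))"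
    using i2 i3 by simp
  also have "\<dots> = - (LINT x|lebesgue. (w x *\<^sub>R G x + u x *\<^sub>R grad w x) $ j * \<phi> x)"
    by (auto simp: algebra_simps intro!: Bochner_Integration.integral_cong)
  finally show "(LINT x|lebesgue. w x * u x * partial_deriv j \<phi> x)
      = - (LINT x|lebesgue. (w x *\<^sub>R G x + u x *\<^sub>R grad w x) $ j * \<phi> x)" .
qed

lemma has_weak_gradient_smooth:
  fixes w :: "real^'n::finite \<Rightarrow> real"
  assumes w: "smooth w"
  shows "has_weak_gradient w (grad w)"
proof (rule has_weak_gradientI)
  show "locally_integrable (grad w)"
    by (intro locally_integrable_continuous smooth_continuous_grad w)
  fix \<phi> :: "real^'n \<Rightarrow> real" and j assume \<phi>: "\<phi> \<in> test_functions"
  have li: "locally_integrable w" "locally_integrable (partial_deriv j w)"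
    by (intro locally_integrable_continuous smooth_continuous smooth_partial_deriv w)+
  have "(LINT x|lebesgue. partial_deriv j (\<lambda>x. w x * \<phi> x) x) = 0"
    by (intro integral_partial_deriv_test test_functions_mult w \<phi>)
  moreover have "partial_deriv j (\<lambda>x. w x * \<phi> x) x
      = w x * partial_deriv j \<phi> x + partial_deriv j w x * \<phi> x" for x
    by (intro partial_deriv_mult smooth_differentiable w test_functions_smooth \<phi>)
  ultimately show "(LINT x|lebesgue. w x * partial_deriv j \<phi> x)
      = - (LINT x|lebesgue. grad w x $ j * \<phi> x)"
    using integrable_mult_test[OF li(1) test_functions_partial_deriv[OF \<phi>]]
      integrable_mult_test[OF li(2) \<phi>] by simp
qed

lemma has_weak_gradient_add:
  assumes "locally_integrable u" "has_weak_gradient u G" "locally_integrable v" "has_weak_gradient v H"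
  shows "has_weak_gradient (\<lambda>x. u x + v x) (\<lambda>x. G x + H x)"
proof (rule has_weak_gradientI)
  show "locally_integrable (\<lambda>x. G x + H x)"
    using assms by (intro locally_integrable_add has_weak_gradient_locally_integrable)
  fix \<phi> :: "real^'a \<Rightarrow> real" and j assume \<phi>: "\<phi> \<in> test_functions"
  show "(LINT x|lebesgue. (u x + v x) * partial_deriv j \<phi> x)
      = - (LINT x|lebesgue. (G x + H x) $ j * \<phi> x)"
    using has_weak_gradientD[OF assms(2) \<phi>, of j] has_weak_gradientD[OF assms(4) \<phi>, of j]
      integrable_component_mult_test[OF assms(2) \<phi>, of j] integrable_component_mult_test[OF assms(4) \<phi>, of j]
      integrable_mult_test[OF assms(1) test_functions_partial_deriv[OF \<phi>], of j]
      integrable_mult_test[OF assms(3) test_functions_partial_deriv[OF \<phi>], of j]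
    by (simp add: distrib_right)
qed

lemma L2_loc_iff: "u \<in> L2_loc \<longleftrightarrow> u \<in> borel_measurable lebesgue \<and> locally_integrable (\<lambda>x. (u x)\<^sup>2)"
  by (auto simp: L2_loc_def locally_integrable_def)

lemma L2_loc_mult:
  assumes "u \<in> L2_loc" "continuous_on UNIV w"
  shows "(\<lambda>x. w x * u x) \<in> L2_loc"
  unfolding L2_loc_iff
proof
  show "(\<lambda>x. w x * u x) \<in> borel_measurable lebesgue"
    using assms continuous_lebesgue_measurable[OF assms(2)]
    by (auto simp: L2_loc_def intro: borel_measurable_times borel_measurable_add)
  have "locally_integrable (\<lambda>x. (w x)\<^sup>2 *\<^sub>R (u x)\<^sup>2)"
    using assms by (intro locally_integrable_scaleR continuous_intros) (auto simp: L2_loc_iff)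
  then show "locally_integrable (\<lambda>x. (w x * u x)\<^sup>2)" by (simp add: power_mult_distrib)
qed

lemma L2_loc_add_continuous:
  assumes "u \<in> L2_loc" "continuous_on UNIV w"
  shows "(\<lambda>x. u x + w x) \<in> L2_loc"
  unfolding L2_loc_iff
proof
  show "(\<lambda>x. u x + w x) \<in> borel_measurable lebesgue"
    using assms continuous_lebesgue_measurable[OF assms(2)]
    by (auto simp: L2_loc_def intro: borel_measurable_times borel_measurable_add)
  have "locally_integrable (\<lambda>x. (2 * w x) *\<^sub>R u x)"
    by (rule locally_integrable_scaleR[OF L2_loc_locally_integrable[OF assms(1)]])
      (intro continuous_intros assms)
  moreover have "locally_integrable (\<lambda>x. (w x)\<^sup>2)"
    by (rule locally_integrable_continuous) (intro continuous_intros assms)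
  ultimately have "locally_integrable (\<lambda>x. (u x)\<^sup>2 + ((2 * w x) *\<^sub>R u x + (w x)\<^sup>2))"
    using assms(1) by (intro locally_integrable_add) (auto simp: L2_loc_iff)
  then show "locally_integrable (\<lambda>x. (u x + w x)\<^sup>2)" by (simp add: power2_sum add_ac mult_ac)
qed

section \<open>Cutting off and perturbing Sobolev functions\<close>

text \<open>With \<open>p\<close> the value of the cutoff, \<open>H\<close> its gradient, \<open>s\<close> the value of \<open>u\<close> and \<open>G\<close> the weak
  gradient of \<open>u\<close>, the vector on the left is the weak gradient of \<open>(1 - p\<^sup>2) u\<close>. The factor
  \<open>1 - p\<^sup>2\<close> is chosen, rather than \<open>1 - p\<close>, because its gradient carries a factor \<open>p\<close>: Young's
  inequality bounds the cross term by \<open>(1 - p\<^sup>2) (p\<^sup>2 |G|\<^sup>2 + 4 s\<^sup>2 |H|\<^sup>2)\<close>, and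
  \<open>(1 - p\<^sup>2)\<^sup>2 + (1 - p\<^sup>2) p\<^sup>2\<close> is at most \<open>1\<close>. So \<open>|G|\<^sup>2\<close> reappears with coefficient \<open>1\<close>,
  and the error involves only \<open>s\<close> and \<open>H\<close>.\<close>

lemma norm_cutoff_product_le:
  fixes G H :: "'a::real_inner"
  assumes "0 \<le> p" "p \<le> (1::real)"
  shows "(norm ((1 - p\<^sup>2) *\<^sub>R G + s *\<^sub>R ((- 2 * p) *\<^sub>R H)))\<^sup>2 \<le> (norm G)\<^sup>2 + 4 * (s\<^sup>2 * (norm H)\<^sup>2)"
proof -
  have p2: "0 \<le> 1 - p\<^sup>2" using assms by (simp add: power_le_one)
  \<comment> \<open>Young's inequality for the cross term\<close>
  have "0 \<le> (norm (p *\<^sub>R G + (2 * s) *\<^sub>R H))\<^sup>2" by simp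
  then have *: "- (4 * (p * s * (G \<bullet> H))) \<le> p\<^sup>2 * (norm G)\<^sup>2 + 4 * (s\<^sup>2 * (norm H)\<^sup>2)"
    unfolding power2_norm_eq_inner
    by (simp add: algebra_simps inner_commute power2_eq_square)
  have "(norm ((1 - p\<^sup>2) *\<^sub>R G + s *\<^sub>R ((- 2 * p) *\<^sub>R H)))\<^sup>2
      = (1 - p\<^sup>2)\<^sup>2 * (norm G)\<^sup>2 + (1 - p\<^sup>2) * (- (4 * (p * s * (G \<bullet> H)))) + 4 * p\<^sup>2 * (s\<^sup>2 * (norm H)\<^sup>2)"
    unfolding power2_norm_eq_inner
    by (simp add: algebra_simps inner_commute power2_eq_square)
  also have "\<dots> \<le> (1 - p\<^sup>2)\<^sup>2 * (norm G)\<^sup>2 + (1 - p\<^sup>2) * (p\<^sup>2 * (norm G)\<^sup>2 + 4 * (s\<^sup>2 * (norm H)\<^sup>2))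
      + 4 * p\<^sup>2 * (s\<^sup>2 * (norm H)\<^sup>2)"
    using mult_left_mono[OF * p2] by simp
  also have "\<dots> = (1 - p\<^sup>2) * (norm G)\<^sup>2 + 4 * (s\<^sup>2 * (norm H)\<^sup>2)"
    by (simp add: algebra_simps power2_eq_square)
  also have "\<dots> \<le> (norm G)\<^sup>2 + 4 * (s\<^sup>2 * (norm H)\<^sup>2)"
    using mult_right_mono[of "1 - p\<^sup>2" 1 "(norm G)\<^sup>2"] by simp
  finally show ?thesis .
qed

text \<open>A Caccioppoli-type estimate for the competitor that switches \<open>u\<close> off where \<open>\<psi> = 1\<close>.\<close>

lemma W12_cut:
  fixes u \<psi> :: "real^'n::finite \<Rightarrow> real"
  assumes u: "u \<in> W12" and \<psi>: "\<psi> \<in> test_functions" "\<And>x. 0 \<le> \<psi> x" "\<And>x. \<psi> x \<le> 1"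
  shows "(\<lambda>x. (1 - (\<psi> x)\<^sup>2) * u x) \<in> W12"
    and "integrable lebesgue (\<lambda>x. (u x)\<^sup>2 * (norm (grad \<psi> x))\<^sup>2)"
    and "(LINT x|lebesgue. (norm (weak_gradient (\<lambda>x. (1 - (\<psi> x)\<^sup>2) * u x) x))\<^sup>2)
      \<le> (LINT x|lebesgue. (norm (weak_gradient u x))\<^sup>2)
        + 4 * (LINT x|lebesgue. (u x)\<^sup>2 * (norm (grad \<psi> x))\<^sup>2)"
proof -
  note W = W12_weak_gradient[OF u]
  let ?G = "weak_gradient u" and ?w = "\<lambda>x. 1 - (\<psi> x)\<^sup>2"
  have sm: "smooth \<psi>" using \<psi>(1) by (rule test_functions_smooth)
  have smw: "smooth ?w"
    unfolding power2_eq_square by (intro smooth_diff smooth_mult smooth_const sm)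
  have gw: "grad ?w x = (- 2 * \<psi> x) *\<^sub>R grad \<psi> x" for x
  proof -
    have "partial_deriv j ?w x = - 2 * \<psi> x * partial_deriv j \<psi> x" for j
    proof -
      have "((\<lambda>t. 1 - t\<^sup>2) has_real_derivative - 2 * \<psi> x) (at (\<psi> x))"
        by (auto intro!: derivative_eq_intros)
      from partial_deriv_compose[OF smooth_differentiable[OF sm] this] show ?thesis .
    qed
    then show ?thesis by (simp add: vec_eq_iff)
  qed
  define H where "H x = ?w x *\<^sub>R ?G x + u x *\<^sub>R grad ?w x" for x
  have H: "has_weak_gradient (\<lambda>x. ?w x * u x) H"
    unfolding H_def by (intro has_weak_gradient_mult L2_loc_locally_integrable W smw)
  show int2: "integrable lebesgue (\<lambda>x. (u x)\<^sup>2 * (norm (grad \<psi> x))\<^sup>2)"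
  proof (rule integrable_mult_bounded_support)
    show "locally_integrable (\<lambda>x. (u x)\<^sup>2)" using W(1) by (simp add: L2_loc_iff)
    show "continuous_on UNIV (\<lambda>x. (norm (grad \<psi> x))\<^sup>2)"
      by (intro continuous_intros smooth_continuous_grad sm)
    show "bounded {x. (norm (grad \<psi> x))\<^sup>2 \<noteq> 0}"
      using bounded_support_grad[OF \<psi>(1)] by simp
  qed
  have le: "(norm (H x))\<^sup>2 \<le> (norm (?G x))\<^sup>2 + 4 * ((u x)\<^sup>2 * (norm (grad \<psi> x))\<^sup>2)" for x
    unfolding H_def gw using \<psi>(2,3) by (rule norm_cutoff_product_le)
  have int: "integrable lebesgue (\<lambda>x. (norm (?G x))\<^sup>2 + 4 * ((u x)\<^sup>2 * (norm (grad \<psi> x))\<^sup>2))"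
    using W(3) int2 by simp
  have [measurable]: "H \<in> borel_measurable lebesgue" using H by (simp add: has_weak_gradient_def)
  have intH: "integrable lebesgue (\<lambda>x. (norm (H x))\<^sup>2)"
    using int by (rule Bochner_Integration.integrable_bound) (use le in \<open>auto intro: order_trans[OF _ abs_ge_self]\<close>)
  show "(\<lambda>x. (1 - (\<psi> x)\<^sup>2) * u x) \<in> W12"
    using L2_loc_mult[OF W(1) smooth_continuous[OF smw]] H intH by (rule W12I)
  have "(LINT x|lebesgue. (norm (weak_gradient (\<lambda>x. ?w x * u x) x))\<^sup>2) = (LINT x|lebesgue. (norm (H x))\<^sup>2)"
    by (rule integral_weak_gradient[OF H])
  also have "\<dots> \<le> (LINT x|lebesgue. (norm (?G x))\<^sup>2 + 4 * ((u x)\<^sup>2 * (norm (grad \<psi> x))\<^sup>2))"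
    by (intro integral_mono intH int le)
  also have "\<dots> = (LINT x|lebesgue. (norm (?G x))\<^sup>2)
        + 4 * (LINT x|lebesgue. (u x)\<^sup>2 * (norm (grad \<psi> x))\<^sup>2)"
    using W(3) int2 by simp
  finally show "(LINT x|lebesgue. (norm (weak_gradient (\<lambda>x. (1 - (\<psi> x)\<^sup>2) * u x) x))\<^sup>2)
      \<le> (LINT x|lebesgue. (norm (weak_gradient u x))\<^sup>2)
        + 4 * (LINT x|lebesgue. (u x)\<^sup>2 * (norm (grad \<psi> x))\<^sup>2)" .
qed

text \<open>Since \<open>\<phi>\<close> is smooth, the cross term \<open>2 \<tau> \<integral> \<nabla>u \<bullet> \<nabla>\<phi>\<close> can be moved onto \<open>\<phi>\<close> by the definition of
  the weak gradient, which leaves the Laplacian of \<open>\<phi>\<close> tested against \<open>u\<close>.\<close>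

lemma W12_perturb:
  fixes u \<phi> :: "real^'n::finite \<Rightarrow> real"
  assumes u: "u \<in> W12" and \<phi>: "\<phi> \<in> test_functions"
  shows "(\<lambda>x. u x + \<tau> * \<phi> x) \<in> W12"
    and "(LINT x|lebesgue. (norm (weak_gradient (\<lambda>x. u x + \<tau> * \<phi> x) x))\<^sup>2)
      = (LINT x|lebesgue. (norm (weak_gradient u x))\<^sup>2)
        - 2 * \<tau> * (LINT x|lebesgue. u x * laplacian \<phi> x)
        + \<tau>\<^sup>2 * (LINT x|lebesgue. (norm (grad \<phi> x))\<^sup>2)"
proof -
  note W = W12_weak_gradient[OF u]
  let ?G = "weak_gradient u"
  have sm: "smooth \<phi>" using \<phi> by (rule test_functions_smooth)
  have li: "locally_integrable u" using W(1) by (rule L2_loc_locally_integrable)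
  have gw: "grad (\<lambda>x. \<tau> * \<phi> x) x = \<tau> *\<^sub>R grad \<phi> x" for x
  proof -
    have "partial_deriv j (\<lambda>x. \<tau> * \<phi> x) x = \<tau> * partial_deriv j \<phi> x" for j
      using partial_deriv_compose[OF smooth_differentiable[OF sm] DERIV_cmult_Id] by simp
    then show ?thesis by (simp add: vec_eq_iff)
  qed
  have H: "has_weak_gradient (\<lambda>x. u x + \<tau> * \<phi> x) (\<lambda>x. ?G x + \<tau> *\<^sub>R grad \<phi> x)"
    using has_weak_gradient_add[OF li W(2) _ has_weak_gradient_smooth[OF smooth_cmult[OF sm, of \<tau>]]]
      locally_integrable_continuous[OF smooth_continuous[OF smooth_cmult[OF sm, of \<tau>]]]
    by (simp add: gw)
  have intc: "integrable lebesgue (\<lambda>x. ?G x $ j * partial_deriv j \<phi> x)" for j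
    by (intro integrable_component_mult_test[OF W(2)] test_functions_partial_deriv \<phi>)
  then have intGphi: "integrable lebesgue (\<lambda>x. ?G x \<bullet> grad \<phi> x)"
    by (simp add: inner_vec_def)
  have intl: "integrable lebesgue (\<lambda>x. u x * partial_deriv j (partial_deriv j \<phi>) x)" for j
    by (intro integrable_mult_test li test_functions_partial_deriv \<phi>)
  have cross: "(LINT x|lebesgue. ?G x \<bullet> grad \<phi> x) = - (LINT x|lebesgue. u x * laplacian \<phi> x)"
  proof -
    have "(LINT x|lebesgue. ?G x \<bullet> grad \<phi> x) = (\<Sum>j\<in>UNIV. LINT x|lebesgue. ?G x $ j * partial_deriv j \<phi> x)"
      using intc by (simp add: inner_vec_def)
    also have "\<dots> = (\<Sum>j\<in>UNIV. - (LINT x|lebesgue. u x * partial_deriv j (partial_deriv j \<phi>) x))"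
      by (intro sum.cong refl) (simp add: has_weak_gradientD[OF W(2) test_functions_partial_deriv[OF \<phi>]])
    also have "\<dots> = - (LINT x|lebesgue. u x * laplacian \<phi> x)"
      using intl by (simp add: laplacian_def sum_distrib_left sum_negf)
    finally show ?thesis .
  qed
  have intphi: "integrable lebesgue (\<lambda>x. (norm (grad \<phi> x))\<^sup>2)"
  proof (rule integrable_bounded_support)
    show "locally_integrable (\<lambda>x. (norm (grad \<phi> x))\<^sup>2)"
      by (intro locally_integrable_continuous continuous_intros smooth_continuous_grad sm)
    show "bounded {x. (norm (grad \<phi> x))\<^sup>2 \<noteq> 0}"
      using bounded_support_grad[OF \<phi>] by simp
  qed
  have expand: "(norm (?G x + \<tau> *\<^sub>R grad \<phi> x))\<^sup>2
      = (norm (?G x))\<^sup>2 + (2 * \<tau>) * (?G x \<bullet> grad \<phi> x) + \<tau>\<^sup>2 * (norm (grad \<phi> x))\<^sup>2" for x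
    unfolding power2_norm_eq_inner
    by (simp add: algebra_simps inner_commute power2_eq_square)
  have "integrable lebesgue (\<lambda>x. (norm (?G x + \<tau> *\<^sub>R grad \<phi> x))\<^sup>2)"
    unfolding expand using W(3) intGphi intphi by simp
  with L2_loc_add_continuous[OF W(1) smooth_continuous[OF smooth_cmult[OF sm]]] H
  show "(\<lambda>x. u x + \<tau> * \<phi> x) \<in> W12" by (rule W12I)
  show "(LINT x|lebesgue. (norm (weak_gradient (\<lambda>x. u x + \<tau> * \<phi> x) x))\<^sup>2)
      = (LINT x|lebesgue. (norm (weak_gradient u x))\<^sup>2)
        - 2 * \<tau> * (LINT x|lebesgue. u x * laplacian \<phi> x)
        + \<tau>\<^sup>2 * (LINT x|lebesgue. (norm (grad \<phi> x))\<^sup>2)"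
    unfolding integral_weak_gradient[OF H] expand
    using W(3) intGphi intphi cross by simp
qed

section \<open>Averages over concentric bumps\<close>

text \<open>The gradient of the bump of radius \<open>\<rho>\<close> at \<open>z\<close> is \<open>-(z - y)\<close> times \<open>\<rho>\<close> to the power \<open>n - 2\<close> times
  this kernel. Substituting \<open>z = y + \<rho> w\<close> shows that the mass of the kernel does not depend on \<open>\<rho>\<close>.\<close>

definition averaging_kernel :: "real^'n::finite \<Rightarrow> real \<Rightarrow> real^'n \<Rightarrow> real" where
  "averaging_kernel y \<rho> z = 2 * flat_deriv 1 (1 - (norm (z - y))\<^sup>2 / \<rho>\<^sup>2) / \<rho> ^ CARD('n)"

lemma averaging_kernel_nonneg: "0 < \<rho> \<Longrightarrow> 0 \<le> averaging_kernel y \<rho> z"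
  unfolding averaging_kernel_def using flat_deriv_1_nonneg by (intro divide_nonneg_nonneg mult_nonneg_nonneg) auto

lemma averaging_kernel_outside: "0 < \<rho> \<Longrightarrow> z \<notin> ball y \<rho> \<Longrightarrow> averaging_kernel y \<rho> z = 0"
  unfolding averaging_kernel_def using flat_deriv_outside by simp

lemma averaging_kernel_le:
  fixes y z :: "real^'n::finite"
  assumes "0 < \<rho>" and L: "\<And>t. t \<le> 1 \<Longrightarrow> \<bar>flat_deriv 1 t\<bar> \<le> L"
  shows "averaging_kernel y \<rho> z \<le> 2 * L / \<rho> ^ CARD('n)"
proof -
  have "flat_deriv 1 (1 - (norm (z - y))\<^sup>2 / \<rho>\<^sup>2) \<le> L"
    using L[of "1 - (norm (z - y))\<^sup>2 / \<rho>\<^sup>2"] by simp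
  then show ?thesis
    unfolding averaging_kernel_def using assms(1) by (intro divide_right_mono) auto
qed

text \<open>On the half ball the argument of \<open>flat_deriv 1\<close> is at least \<open>3/4\<close>, hence at least \<open>1/2\<close>, where
  \<open>exp (- 1 / v)\<close> is at least \<open>exp (- 2)\<close>.\<close>

lemma averaging_kernel_ge:
  fixes y z :: "real^'n::finite"
  assumes "0 < \<rho>" "dist y z \<le> \<rho> / 2"
  shows "2 * exp (- 2) / \<rho> ^ CARD('n) \<le> averaging_kernel y \<rho> z"
proof -
  define q where "q = (norm (z - y))\<^sup>2 / \<rho>\<^sup>2"
  let ?v = "1 - q"
  have "(norm (z - y))\<^sup>2 \<le> (\<rho> / 2)\<^sup>2"
    using assms by (intro power_mono) (auto simp: dist_norm norm_minus_commute)
  then have "q \<le> 1 / 4"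
    unfolding q_def using assms by (simp add: divide_simps)
  moreover have "0 \<le> q" by (simp add: q_def)
  ultimately have v: "1 / 2 \<le> ?v" "?v \<le> 1" by linarith+
  then have "exp (- 2) \<le> exp (- 1 / ?v)" by (simp add: divide_simps)
  also have "\<dots> \<le> exp (- 1 / ?v) / ?v\<^sup>2"
  proof -
    have "0 < ?v\<^sup>2" using v(1) by (intro zero_less_power) linarith
    moreover have "?v\<^sup>2 \<le> 1" using v by (intro power_le_one) auto
    ultimately show ?thesis
      using mult_left_mono[of "?v\<^sup>2" 1 "exp (- 1 / ?v)"] by (simp add: pos_le_divide_eq)
  qed
  also have "\<dots> = flat_deriv 1 ?v" using v(1) unfolding flat_deriv_1 by simp
  finally show ?thesis
    unfolding averaging_kernel_def q_def[symmetric] using assms(1) by (intro divide_right_mono) auto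
qed

lemma continuous_averaging_kernel: "continuous_on UNIV (averaging_kernel y \<rho>)"
proof (cases "\<rho> = 0")
  case False
  then show ?thesis unfolding averaging_kernel_def
    by (intro continuous_intros continuous_on_compose2[OF continuous_flat_deriv]) auto
next
  case True
  then show ?thesis unfolding averaging_kernel_def by (simp add: zero_power)
qed

text \<open>Changing the scale of a kernel of fixed mass moves mass along the rays from \<open>y\<close>: the
  derivative is the divergence of \<open>-(z - y)/\<rho>\<close> times the kernel, and this vector
  field is a power of \<open>\<rho>\<close> times the gradient of the bump. This identity replaces the fundamental
  solution in the proof of the mean value property.\<close>

lemma DERIV_averaging_kernel:
  fixes y z :: "real^'n::finite"
  assumes "\<rho> \<noteq> 0"
  shows "((\<lambda>\<rho>. averaging_kernel y \<rho> z) has_real_derivative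
    \<rho> / \<rho> ^ CARD('n) * laplacian (bump y \<rho>) z) (at \<rho>)"
proof -
  define s where "s = (norm (z - y))\<^sup>2"
  let ?n = "CARD('n)"
  have d1: "((\<lambda>\<rho>. 1 - s / \<rho>\<^sup>2) has_real_derivative 2 * s / \<rho>^3) (at \<rho>)"
    using assms by (auto intro!: derivative_eq_intros simp: power2_eq_square power3_eq_cube mult_ac)
  have d2: "((\<lambda>\<rho>. flat_deriv 1 (1 - s / \<rho>\<^sup>2)) has_real_derivative
      flat_deriv 2 (1 - s / \<rho>\<^sup>2) * (2 * s / \<rho>^3)) (at \<rho>)"
    using DERIV_chain2[OF DERIV_flat_deriv[of 1] d1] by (simp add: numeral_2_eq_2)
  have d3: "((\<lambda>\<rho>. \<rho> ^ ?n) has_real_derivative (real ?n * \<rho> ^ ?n / \<rho>)) (at \<rho>)"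
  proof -
    have "\<rho> ^ (?n - 1) = \<rho> ^ ?n / \<rho>"
      using assms power_minus_mult[of ?n \<rho>] by (simp add: divide_simps)
    then show ?thesis using DERIV_pow[of ?n \<rho>] by simp
  qed
  have "((\<lambda>\<rho>. 2 * flat_deriv 1 (1 - s / \<rho>\<^sup>2) / \<rho> ^ ?n) has_real_derivative
      (2 * (flat_deriv 2 (1 - s / \<rho>\<^sup>2) * (2 * s / \<rho>^3)) * \<rho> ^ ?n
        - 2 * flat_deriv 1 (1 - s / \<rho>\<^sup>2) * (real ?n * \<rho> ^ ?n / \<rho>)) / (\<rho> ^ ?n * \<rho> ^ ?n)) (at \<rho>)"
    using assms by (intro DERIV_divide DERIV_cmult d2 d3) auto
  moreover have "(2 * (a * (2 * s / \<rho>^3)) * p - 2 * b * (c * p / \<rho>)) / (p * p)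
      = \<rho> / p * (4 * a * s / \<rho>^4 - 2 * c * b / \<rho>\<^sup>2)" if "p \<noteq> 0" for a b c p :: real
    unfolding power2_eq_square power3_eq_cube power4_eq_xxxx
    using that assms by (simp add: field_simps)
  ultimately show ?thesis
    unfolding averaging_kernel_def laplacian_bump s_def[symmetric] using assms by simp
qed

lemma integral_eq_henstock:
  fixes h :: "real^'n::finite \<Rightarrow> real"
  assumes "continuous_on UNIV h" "\<And>z. z \<notin> cbox a b \<Longrightarrow> h z = 0"
  shows "(LINT z|lebesgue. h z) = integral (cbox a b) h"
proof -
  have "h absolutely_integrable_on cbox a b"
    using assms(1) by (intro absolutely_integrable_continuous) (rule continuous_on_subset, auto)
  then have "(LINT z:cbox a b|lebesgue. h z) = integral (cbox a b) h"
    by (rule set_lebesgue_integral_eq_integral(2))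
  moreover have "(\<lambda>z. indicator (cbox a b) z *\<^sub>R h z) = h"
    using assms(2) by (intro ext) (auto simp: indicator_def)
  ultimately show ?thesis by (simp add: set_lebesgue_integral_def del: real_scaleR_def)
qed

text \<open>For a harmonic function the right hand side vanishes and the averages are constant. The
  function is replaced by a continuous one on the whole space, through the closest point of a
  slightly smaller closed ball, so that the Leibniz rule on a box applies.\<close>

lemma DERIV_bump_average:
  fixes u :: "real^'n::finite \<Rightarrow> real"
  assumes u: "continuous_on (ball y R) u" and \<rho>: "0 < \<rho>" "\<rho> < R"
  shows "((\<lambda>\<rho>. LINT z|lebesgue. u z * averaging_kernel y \<rho> z) has_real_derivative
    \<rho> / \<rho> ^ CARD('n) * (LINT z|lebesgue. u z * laplacian (bump y \<rho>) z)) (at \<rho>)"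
proof -
  define R' where "R' = (\<rho> + R) / 2"
  have R': "\<rho> < R'" "R' < R" "0 < R'" using \<rho> by (auto simp: R'_def)
  \<comment> \<open>a continuous extension of \<open>u\<close> from the smaller ball; all kernels involved vanish off that ball\<close>
  define v where "v z = u (closest_point (cball y R') z)" for z
  have v_eq: "v z = u z" if "z \<in> cball y R'" for z
    using that by (simp add: v_def closest_point_self)
  have v: "continuous_on UNIV v"
    unfolding v_def
  proof (rule continuous_on_compose2[OF u])
    show "continuous_on UNIV (closest_point (cball y R'))"
      using R' by (intro continuous_on_closest_point) auto
    have "closest_point (cball y R') z \<in> ball y R" for z
      using closest_point_in_set[of "cball y R'" z] R' by auto
    then show "closest_point (cball y R') ` UNIV \<subseteq> ball y R" by blast
  qed
  obtain a b where ab: "cball y R' \<subseteq> cbox a b"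
    using bounded_subset_cbox_symmetric[OF bounded_cball] by metis
  have out: "z \<notin> ball y \<sigma>" if "z \<notin> cbox a b" "\<sigma> < R'" for z \<sigma>
    using ab that by force
  let ?U = "{0<..<R'}"
  let ?d = "\<lambda>\<sigma> z. v z * (\<sigma> / \<sigma> ^ CARD('n) * laplacian (bump y \<sigma>) z)"
  have "((\<lambda>\<sigma>. integral (cbox a b) (\<lambda>z. v z * averaging_kernel y \<sigma> z)) has_field_derivative
      integral (cbox a b) (?d \<rho>)) (at \<rho> within ?U)"
  proof (rule leibniz_rule_field_derivative)
    show "((\<lambda>\<sigma>. v z * averaging_kernel y \<sigma> z) has_real_derivative ?d \<sigma> z) (at \<sigma> within ?U)"
      if "\<sigma> \<in> ?U" for \<sigma> z
      using that by (intro DERIV_cmult has_field_derivative_at_within[OF DERIV_averaging_kernel]) auto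
    show "(\<lambda>z. v z * averaging_kernel y \<sigma> z) integrable_on cbox a b" for \<sigma>
      by (intro integrable_continuous continuous_on_mult continuous_on_subset[OF v]
          continuous_on_subset[OF continuous_averaging_kernel]) auto
    show "continuous_on (?U \<times> cbox a b) (\<lambda>(\<sigma>, z). ?d \<sigma> z)"
      unfolding laplacian_bump split_beta
      by (intro continuous_intros continuous_on_compose2[OF v] continuous_on_compose2[OF continuous_flat_deriv])
        auto
    show "\<rho> \<in> ?U" using \<rho> R' by simp
    show "convex ?U" by (rule convex_real_interval)
  qed
  then have D: "((\<lambda>\<sigma>. integral (cbox a b) (\<lambda>z. v z * averaging_kernel y \<sigma> z)) has_real_derivative
      integral (cbox a b) (?d \<rho>)) (at \<rho>)"
    using \<rho> R' by (subst (asm) at_within_open) auto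
  have eq: "(LINT z|lebesgue. u z * averaging_kernel y \<sigma> z)
      = integral (cbox a b) (\<lambda>z. v z * averaging_kernel y \<sigma> z)" if \<sigma>: "\<sigma> \<in> ?U" for \<sigma>
  proof -
    have "u z * averaging_kernel y \<sigma> z = v z * averaging_kernel y \<sigma> z" for z
      using averaging_kernel_outside[of \<sigma> z y] v_eq[of z] \<sigma> by (cases "z \<in> ball y \<sigma>") auto
    then have "(LINT z|lebesgue. u z * averaging_kernel y \<sigma> z)
        = (LINT z|lebesgue. v z * averaging_kernel y \<sigma> z)"
      by (rule Bochner_Integration.integral_cong[OF refl])
    also have "\<dots> = integral (cbox a b) (\<lambda>z. v z * averaging_kernel y \<sigma> z)"
      using \<sigma> out[of _ \<sigma>] averaging_kernel_outside[of \<sigma> _ y]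
      by (intro integral_eq_henstock continuous_on_mult v continuous_averaging_kernel) auto
    finally show ?thesis .
  qed
  have "u z * laplacian (bump y \<rho>) z = v z * laplacian (bump y \<rho>) z" for z
    using laplacian_bump_outside[of \<rho> z y] v_eq[of z] \<rho> R' by (cases "z \<in> ball y \<rho>") auto
  then have "(LINT z|lebesgue. u z * laplacian (bump y \<rho>) z) = (LINT z|lebesgue. v z * laplacian (bump y \<rho>) z)"
    by (rule Bochner_Integration.integral_cong[OF refl])
  then have "\<rho> / \<rho> ^ CARD('n) * (LINT z|lebesgue. u z * laplacian (bump y \<rho>) z)
      = (LINT z|lebesgue. ?d \<rho> z)"
    by (simp only: mult.left_commute[of "v _" "\<rho> / \<rho> ^ CARD('n)"] integral_mult_right_zero)
  also have "\<dots> = integral (cbox a b) (?d \<rho>)"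
    using \<rho> R' out[of _ \<rho>] laplacian_bump_outside[of \<rho> _ y]
    by (intro integral_eq_henstock continuous_on_mult v continuous_on_const
        smooth_continuous_laplacian test_functions_smooth bump_test) auto
  finally have eq': "\<rho> / \<rho> ^ CARD('n) * (LINT z|lebesgue. u z * laplacian (bump y \<rho>) z)
      = integral (cbox a b) (?d \<rho>)" .
  have "\<forall>\<^sub>F \<sigma> in nhds \<rho>. (LINT z|lebesgue. u z * averaging_kernel y \<sigma> z)
      = integral (cbox a b) (\<lambda>z. v z * averaging_kernel y \<sigma> z)"
    using \<rho> R' eq by (intro eventually_mono[OF eventually_nhds_in_open[of ?U]]) auto
  from DERIV_cong_ev[OF refl this eq'] D show ?thesis by blast
qed

section \<open>Changing the potential term\<close>

text \<open>If \<open>a\<close> is not integrable then neither is \<open>b\<close>, both integrals are \<open>0\<close> by convention, and the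
  estimate persists. It therefore applies to the potential term of a function
  that is only known to be locally square integrable.\<close>

lemma integral_diff_le_of_bound:
  fixes a b c :: "'a \<Rightarrow> real"
  assumes meas: "a \<in> borel_measurable M" "b \<in> borel_measurable M"
    and c: "integrable M c" and bound: "AE z in M. \<bar>b z - a z\<bar> \<le> c z"
  shows "integral\<^sup>L M b - integral\<^sup>L M a \<le> integral\<^sup>L M c"
proof -
  have d: "integrable M (\<lambda>z. b z - a z)"
    by (rule Bochner_Integration.integrable_bound[OF c])
      (use meas bound in \<open>auto elim!: eventually_mono\<close>)
  show ?thesis
  proof (cases "integrable M a")
    case True
    then have b: "integrable M b" using Bochner_Integration.integrable_add[OF d True] by simp
    have "integral\<^sup>L M b - integral\<^sup>L M a = (LINT z|M. b z - a z)"
      using True b by simp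
    also have "\<dots> \<le> integral\<^sup>L M c"
      using bound by (intro integral_mono_AE d c) (auto elim!: eventually_mono)
    finally show ?thesis .
  next
    case False
    then have "\<not> integrable M b" using Bochner_Integration.integrable_diff[OF _ d, of b] by auto
    moreover have "0 \<le> integral\<^sup>L M c"
      using bound by (intro integral_nonneg_AE) (auto elim!: eventually_mono)
    ultimately show ?thesis using False by (simp add: not_integrable_integral_eq)
  qed
qed

lemma potential_change:
  fixes u v f g :: "real^'n::finite \<Rightarrow> real"
  assumes meas: "u \<in> borel_measurable lebesgue" "v \<in> borel_measurable lebesgue"
      "f \<in> borel_measurable lebesgue" "g \<in> borel_measurable lebesgue"
    and f: "AE z in lebesgue. \<bar>f z\<bar> \<le> M" and g: "AE z in lebesgue. \<bar>g z\<bar> \<le> M"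
    and E: "E \<in> lmeasurable"
    and same: "AE z in lebesgue. z \<notin> E \<longrightarrow> v z = u z"
    and S: "\<And>z. z \<in> E \<Longrightarrow> \<bar>u z\<bar> \<le> S" "\<And>z. z \<in> E \<Longrightarrow> \<bar>v z\<bar> \<le> S"
  shows "(LINT z|lebesgue. (v z)\<^sup>2 * f z - v z * g z) - (LINT z|lebesgue. (u z)\<^sup>2 * f z - u z * g z)
    \<le> M * (2 * S\<^sup>2 + 2 * S) * measure lebesgue E"
proof -
  have "(LINT z|lebesgue. (v z)\<^sup>2 * f z - v z * g z) - (LINT z|lebesgue. (u z)\<^sup>2 * f z - u z * g z)
      \<le> (LINT z|lebesgue. M * (2 * S\<^sup>2 + 2 * S) * indicator E z)"
  proof (rule integral_diff_le_of_bound)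
    show "integrable lebesgue (\<lambda>z. M * (2 * S\<^sup>2 + 2 * S) * indicator E z)"
      using E by (intro integrable_mult_right integrable_real_indicator) (auto simp: fmeasurable_def)
    show "AE z in lebesgue. \<bar>(v z)\<^sup>2 * f z - v z * g z - ((u z)\<^sup>2 * f z - u z * g z)\<bar>
        \<le> M * (2 * S\<^sup>2 + 2 * S) * indicator E z"
      using f g same
    proof eventually_elim
      case (elim z)
      show ?case
      proof (cases "z \<in> E")
        case True
        have sq: "\<bar>(v z)\<^sup>2 - (u z)\<^sup>2\<bar> \<le> 2 * S\<^sup>2"
          using power_mono[OF S(1)[OF True], of 2] power_mono[OF S(2)[OF True], of 2]
          by (simp add: abs_le_iff) (smt (verit) zero_le_power2)
        have lin: "\<bar>v z - u z\<bar> \<le> 2 * S" using S[OF True] by linarith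
        have "(v z)\<^sup>2 * f z - v z * g z - ((u z)\<^sup>2 * f z - u z * g z)
            = ((v z)\<^sup>2 - (u z)\<^sup>2) * f z - (v z - u z) * g z" by (simp add: algebra_simps)
        also have "\<bar>\<dots>\<bar> \<le> \<bar>(v z)\<^sup>2 - (u z)\<^sup>2\<bar> * \<bar>f z\<bar> + \<bar>v z - u z\<bar> * \<bar>g z\<bar>"
          unfolding abs_mult[symmetric] by (rule abs_triangle_ineq4)
        also have "\<dots> \<le> 2 * S\<^sup>2 * M + 2 * S * M"
          using sq lin elim by (intro add_mono mult_mono) (auto intro: order_trans[OF abs_ge_zero])
        finally show ?thesis using True by (simp add: algebra_simps)
      qed (use elim in auto)
    qed
  qed (use meas in measurable)
  then show ?thesis using E by simp
qed

section \<open>Minimizers near a thin contact set\<close>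

lemma measure_lebesgue_ball:
  "0 \<le> \<rho> \<Longrightarrow> measure lebesgue (ball (y::real^'n::finite) \<rho>) = unit_ball_vol (real CARD('n)) * \<rho> ^ CARD('n)"
  using content_ball[of \<rho> y] by simp

lemma measure_lebesgue_mono_AE:
  assumes "AE z in lebesgue. z \<in> A \<longrightarrow> z \<in> B" "B \<in> lmeasurable"
  shows "measure lebesgue A \<le> measure lebesgue B"
  unfolding measure_def using assms emeasure_mono_AE[of A B lebesgue]
  by (intro enn2real_mono) (auto simp: fmeasurable_def)

lemma integral_le_measure:
  assumes "integrable lebesgue h" "E \<in> lmeasurable" "AE z in lebesgue. h z \<le> c * indicator E z"
  shows "(LINT z|lebesgue. h z) \<le> c * measure lebesgue E"
proof -
  have "(LINT z|lebesgue. h z) \<le> (LINT z|lebesgue. c * indicator E z)"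
    using assms by (intro integral_mono_AE integrable_mult_right integrable_real_indicator)
      (auto simp: fmeasurable_def)
  then show ?thesis using assms(2) by simp
qed

text \<open>A zero \<open>y\<close> of \<open>u 1\<close> and a ball around it in which \<open>u 1\<close> is positive up to a set of small
  measure. The number \<open>M\<close> bounds all the coefficients, and \<open>L\<close> is a common bound for the slopes
  of the cutoffs and of the bump profile. Since \<open>\<kappa>\<close> is smaller than the volume of the unit
  ball, the contact set cannot fill the ball.\<close>

locale thin_contact_ball =
  fixes N :: nat and \<Omega> :: "(real^'n::finite) set"
    and f g u :: "nat \<Rightarrow> real^'n \<Rightarrow> real"
    and F :: "(nat \<Rightarrow> (real^'n) set) \<Rightarrow> real" and W :: "nat \<Rightarrow> (real^'n) set"
    and C\<^sub>F C\<^sub>0 M \<kappa> R L vol :: real and y :: "real^'n"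
  assumes N: "1 \<le> N"
    and minimizer: "is_J_minimizer N \<Omega> f g F u W"
    and F_Lipschitz: "F_Lipschitz N \<Omega> C\<^sub>F F" and C\<^sub>F: "0 \<le> C\<^sub>F"
    and f_measurable: "\<And>i. i \<in> {1..N} \<Longrightarrow> f i \<in> borel_measurable lebesgue"
    and g_measurable: "\<And>i. i \<in> {1..N} \<Longrightarrow> g i \<in> borel_measurable lebesgue"
    and f_bound: "\<And>i. i \<in> {1..N} \<Longrightarrow> AE z in lebesgue. \<bar>f i z\<bar> \<le> M"
    and g_bound: "\<And>i. i \<in> {1..N} \<Longrightarrow> AE z in lebesgue. \<bar>g i z\<bar> \<le> M"
    and M: "0 \<le> M" and C\<^sub>0: "1 \<le> C\<^sub>0"
    and R: "0 < R" "R \<le> 1"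
    and ball_sub: "ball y R \<subseteq> \<Omega>"
    and lipschitz: "\<And>i z z'. i \<in> {1..N} \<Longrightarrow> z \<in> ball y R \<Longrightarrow> z' \<in> ball y R \<Longrightarrow>
      \<bar>u i z - u i z'\<bar> \<le> C\<^sub>0 * dist z z'"
    and contact: "u 1 y = 0"
    and thin: "measure lebesgue {z \<in> ball y R. u 1 z \<le> 0} \<le> \<kappa> * R ^ CARD('n)"
    and vol: "vol = unit_ball_vol (real CARD('n))"
    and \<kappa>: "0 < \<kappa>" "\<kappa> < vol"
    and cutoff_slope: "\<And>(a::real^'n) \<rho> z. 0 < \<rho> \<Longrightarrow> norm (grad (cutoff a \<rho>) z) \<le> L / \<rho>"
    and bump_slope: "\<And>t. t \<le> 1 \<Longrightarrow> \<bar>flat_deriv 1 t\<bar> \<le> L"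
begin

definition contact_set :: "(real^'n) set" where "contact_set = {z \<in> ball y R. u 1 z \<le> 0}"

lemma one_mem: "1 \<in> {1..N}" using N by simp

lemma W_admissible: "W \<in> admissible_sets N \<Omega>"
  using minimizer by (auto simp: is_J_minimizer_def admissible_pairs_def)

lemma W_borel: "i \<in> {1..N} \<Longrightarrow> W i \<in> sets borel" and W_sub: "i \<in> {1..N} \<Longrightarrow> W i \<subseteq> \<Omega>"
  and W_disjoint: "i \<in> {1..N} \<Longrightarrow> j \<in> {1..N} \<Longrightarrow> i \<noteq> j \<Longrightarrow> W i \<inter> W j = {}"
  using W_admissible by (auto simp: admissible_sets_def disjoint_family_on_def PiE_iff)

lemma u_W12: "i \<in> {1..N} \<Longrightarrow> u i \<in> W12"
  and u_outside: "i \<in> {1..N} \<Longrightarrow> AE z in lebesgue. z \<notin> W i \<longrightarrow> u i z = 0"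
  using minimizer by (auto simp: is_J_minimizer_def admissible_pairs_def)

lemma u_measurable: "i \<in> {1..N} \<Longrightarrow> u i \<in> borel_measurable lebesgue"
  using u_W12 by (auto simp: W12_def L2_loc_def)

lemma contact_set_lmeasurable: "contact_set \<in> lmeasurable"
proof -
  have [measurable]: "u 1 \<in> borel_measurable lebesgue" using u_measurable one_mem by blast
  have "{z. u 1 z \<le> 0} \<in> sets lebesgue"
    using borel_measurable_le[OF \<open>u 1 \<in> borel_measurable lebesgue\<close> borel_measurable_const, of 0] by simp
  then have "ball y R \<inter> {z. u 1 z \<le> 0} \<in> lmeasurable"
    by (intro fmeasurable_Int_fmeasurable lmeasurable_ball)
  then show ?thesis by (simp add: contact_set_def Collect_conj_eq[symmetric] Int_def)
qed

lemma contact_set_measure: "measure lebesgue contact_set \<le> \<kappa> * R ^ CARD('n)"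
  using thin by (simp add: contact_set_def)

text \<open>Where \<open>u 1\<close> does not vanish the point belongs to \<open>W 1\<close>, up to a null set.\<close>

lemma AE_in_W1: "AE z in lebesgue. z \<in> ball y R \<and> z \<notin> contact_set \<longrightarrow> z \<in> W 1"
  using u_outside[OF one_mem] by (rule eventually_mono) (auto simp: contact_set_def)

lemma AE_other_zero:
  assumes "i \<in> {2..N}"
  shows "AE z in lebesgue. z \<in> ball y R \<and> z \<notin> contact_set \<longrightarrow> u i z = 0"
proof -
  have i: "i \<in> {1..N}" "i \<noteq> 1" using assms by auto
  show ?thesis using AE_in_W1 u_outside[OF i(1)]
    by eventually_elim (use W_disjoint[OF i(1) one_mem i(2)] in auto)
qed

text \<open>The functions with \<open>i \<ge> 2\<close> vanish almost everywhere off the contact set, which does not have full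
  measure in the ball. Together with the Lipschitz bound this controls their size.\<close>

lemma exists_zero:
  assumes "i \<in> {1..N}"
  shows "\<exists>z\<in>ball y R. u i z = 0"
proof (cases "i = 1")
  case True
  then show ?thesis using contact R by (intro bexI[of _ y]) auto
next
  case False
  then have i: "i \<in> {2..N}" using assms by auto
  show ?thesis
  proof (rule ccontr)
    assume "\<not> ?thesis"
    then have "AE z in lebesgue. z \<in> ball y R \<longrightarrow> z \<in> contact_set"
      using AE_other_zero[OF i] by (auto elim!: eventually_mono)
    then have "measure lebesgue (ball y R) \<le> measure lebesgue contact_set"
      using contact_set_lmeasurable by (intro measure_lebesgue_mono_AE)
    also have "\<dots> \<le> \<kappa> * R ^ CARD('n)" by (rule contact_set_measure)
    also have "\<dots> < vol * R ^ CARD('n)" using \<kappa> R by simp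
    finally show False
      unfolding vol using measure_lebesgue_ball[OF less_imp_le[OF R(1)], of y] by simp
  qed
qed

lemma u_bound:
  assumes "i \<in> {1..N}" "z \<in> ball y R"
  shows "\<bar>u i z\<bar> \<le> 2 * C\<^sub>0 * R"
proof -
  obtain z' where z': "z' \<in> ball y R" "u i z' = 0" using exists_zero[OF assms(1)] by blast
  have "dist z z' \<le> 2 * R"
    using assms(2) z'(1) dist_triangle2[of z z' y] by (simp add: dist_commute)
  then have "C\<^sub>0 * dist z z' \<le> C\<^sub>0 * (2 * R)" using C\<^sub>0 by (intro mult_left_mono) auto
  then show ?thesis using lipschitz[OF assms z'(1)] z'(2) by simp
qed

lemma u1_bound: "z \<in> ball y R \<Longrightarrow> \<bar>u 1 z\<bar> \<le> C\<^sub>0 * dist y z"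
  using lipschitz[OF one_mem, of z y] contact R by (simp add: dist_commute)

lemma R_power_le: "R ^ CARD('n) \<le> R"
  using R power_decreasing[of 1 "CARD('n)" R] by (simp add: Suc_le_eq)

section \<open>Almost harmonicity\<close>

definition energy :: "(real^'n \<Rightarrow> real) \<Rightarrow> nat \<Rightarrow> real" where
  "energy v i = (LINT z|lebesgue. (norm (weak_gradient v z))\<^sup>2)
    + (LINT z|lebesgue. (v z)\<^sup>2 * f i z - v z * g i z)"

lemma J_functional_energy: "J_functional N f g F v V = (\<Sum>i=1..N. energy (v i) i) + F V"
  by (simp add: J_functional_def energy_def sum.distrib)

text \<open>The first function is charged \<open>c\<close> in addition to \<open>d\<close>, so that the sum over all indices
  takes the simple form \<open>N * c + d\<close>.\<close>

lemma competitor_inequality: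
  assumes adm: "(v, V) \<in> admissible_pairs N \<Omega>"
    and e1: "energy (v 1) 1 \<le> energy (u 1) 1 + d"
    and e: "\<And>i. i \<in> {2..N} \<Longrightarrow> energy (v i) i \<le> energy (u i) i + c"
    and c: "0 \<le> c"
  shows "0 \<le> real N * c + d + (F V - F W)"
proof -
  have "J_functional N f g F u W \<le> J_functional N f g F v V"
    using minimizer adm by (auto simp: is_J_minimizer_def)
  moreover have "(\<Sum>i=1..N. energy (v i) i) \<le> (\<Sum>i=1..N. energy (u i) i + (c + (if i = 1 then d else 0)))"
    using e1 e c by (intro sum_mono) force
  ultimately show ?thesis
    using one_mem by (simp add: J_functional_energy sum.distrib sum.delta)
qed

lemma potential_constant: "M * (2 * (2 * C\<^sub>0 * R)\<^sup>2 + 2 * (2 * C\<^sub>0 * R)) \<le> 12 * M * C\<^sub>0\<^sup>2 * R"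
proof -
  have "C\<^sub>0 * R \<le> C\<^sub>0\<^sup>2 * R" "C\<^sub>0\<^sup>2 * R\<^sup>2 \<le> C\<^sub>0\<^sup>2 * R"
    using C\<^sub>0 R self_le_power[of C\<^sub>0 2] power_decreasing[of 1 2 R]
    by (auto intro!: mult_left_mono mult_right_mono)
  then have "2 * (2 * C\<^sub>0 * R)\<^sup>2 + 2 * (2 * C\<^sub>0 * R) \<le> 12 * C\<^sub>0\<^sup>2 * R"
    by (simp add: power_mult_distrib)
  from mult_left_mono[OF this M] show ?thesis by (simp add: mult_ac)
qed

text \<open>The set \<open>E\<close> is where \<open>u i\<close> may differ from its cut version: the contact set for \<open>i \<ge> 2\<close>, and the
  whole ball for \<open>i = 1\<close>.\<close>

lemma energy_cut:
  assumes i: "i \<in> {1..N}" and \<rho>: "0 < \<rho>" "\<rho> \<le> R" and E: "E \<in> lmeasurable"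
    and zero: "AE z in lebesgue. z \<in> ball y \<rho> \<and> z \<notin> E \<longrightarrow> u i z = 0" and sub: "E \<subseteq> ball y R"
  shows "energy (\<lambda>z. (1 - (cutoff y \<rho> z)\<^sup>2) * u i z) i
    \<le> energy (u i) i + 4 * (LINT z|lebesgue. (u i z)\<^sup>2 * (norm (grad (cutoff y \<rho>) z))\<^sup>2)
      + 12 * M * C\<^sub>0\<^sup>2 * R * measure lebesgue E"
proof -
  let ?v = "\<lambda>z. (1 - (cutoff y \<rho> z)\<^sup>2) * u i z"
  note cut = W12_cut[OF u_W12[OF i] cutoff_test[OF \<rho>(1)] cutoff_nonneg cutoff_le_1, of y]
  have pot: "(LINT z|lebesgue. (?v z)\<^sup>2 * f i z - ?v z * g i z) - (LINT z|lebesgue. (u i z)\<^sup>2 * f i z - u i z * g i z)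
      \<le> M * (2 * (2 * C\<^sub>0 * R)\<^sup>2 + 2 * (2 * C\<^sub>0 * R)) * measure lebesgue E"
  proof (rule potential_change[OF u_measurable[OF i] _ f_measurable[OF i] g_measurable[OF i]
        f_bound[OF i] g_bound[OF i] E])
    show "?v \<in> borel_measurable lebesgue" using cut(1) by (simp add: W12_def L2_loc_def)
    show "AE z in lebesgue. z \<notin> E \<longrightarrow> ?v z = u i z"
      using zero
    proof eventually_elim
      case (elim z)
      then show ?case using cutoff_eq_0[OF \<rho>(1), of z y] by (cases "z \<in> ball y \<rho>") auto
    qed
    show ub: "\<bar>u i z\<bar> \<le> 2 * C\<^sub>0 * R" if "z \<in> E" for z using u_bound[OF i] sub that by blast
    fix z assume "z \<in> E"
    have "0 \<le> 1 - (cutoff y \<rho> z)\<^sup>2" "1 - (cutoff y \<rho> z)\<^sup>2 \<le> 1"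
      using cutoff_nonneg[of y \<rho> z] cutoff_le_1[of y \<rho> z] by (auto simp: power_le_one)
    then have "\<bar>?v z\<bar> \<le> 1 * \<bar>u i z\<bar>" unfolding abs_mult by (intro mult_right_mono) auto
    then show "\<bar>?v z\<bar> \<le> 2 * C\<^sub>0 * R" using ub[OF \<open>z \<in> E\<close>] by simp
  qed
  also have "\<dots> \<le> 12 * M * C\<^sub>0\<^sup>2 * R * measure lebesgue E"
    using potential_constant by (intro mult_right_mono) auto
  finally show ?thesis using cut(3) unfolding energy_def by linarith
qed

definition harmonicity_constant :: real where
  "harmonicity_constant = real N * (16 * C\<^sub>0\<^sup>2 * L\<^sup>2 + 12 * M * C\<^sub>0\<^sup>2 + C\<^sub>F) + 12 * M * C\<^sub>0\<^sup>2 * vol"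

lemma L_nonneg: "0 \<le> L" using bump_slope[of 0] by linarith

text \<open>On the contact set the gradient of the cutoff is at most \<open>L / R\<close> and \<open>u i\<close> is at most a multiple of
  \<open>C\<^sub>0 R\<close>, so the scales cancel and the cost is proportional to the measure of the contact set.\<close>

lemma energy_cut_other:
  assumes i: "i \<in> {2..N}"
  shows "energy (\<lambda>z. (1 - (cutoff y R z)\<^sup>2) * u i z) i
    \<le> energy (u i) i + (16 * C\<^sub>0\<^sup>2 * L\<^sup>2 + 12 * M * C\<^sub>0\<^sup>2) * (\<kappa> * R ^ CARD('n))"
proof -
  have i1: "i \<in> {1..N}" using i by auto
  have "(LINT z|lebesgue. (u i z)\<^sup>2 * (norm (grad (cutoff y R) z))\<^sup>2)
      \<le> (4 * C\<^sub>0\<^sup>2 * L\<^sup>2) * measure lebesgue contact_set"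
  proof (rule integral_le_measure[OF _ contact_set_lmeasurable])
    show "integrable lebesgue (\<lambda>z. (u i z)\<^sup>2 * (norm (grad (cutoff y R) z))\<^sup>2)"
      by (rule W12_cut(2)[OF u_W12[OF i1] cutoff_test[OF R(1)] cutoff_nonneg cutoff_le_1])
    show "AE z in lebesgue. (u i z)\<^sup>2 * (norm (grad (cutoff y R) z))\<^sup>2
        \<le> 4 * C\<^sub>0\<^sup>2 * L\<^sup>2 * indicator contact_set z"
      using AE_other_zero[OF i]
    proof eventually_elim
      case (elim z)
      show ?case
      proof (cases "z \<in> contact_set")
        case True
        then have "z \<in> ball y R" by (simp add: contact_set_def)
        then have "(u i z)\<^sup>2 \<le> (2 * C\<^sub>0 * R)\<^sup>2"
          using power_mono[OF u_bound[OF i1] abs_ge_zero, of z 2] by simp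
        moreover have "(norm (grad (cutoff y R) z))\<^sup>2 \<le> (L / R)\<^sup>2"
          using cutoff_slope[OF R(1)] by (intro power_mono) auto
        ultimately have "(u i z)\<^sup>2 * (norm (grad (cutoff y R) z))\<^sup>2 \<le> (2 * C\<^sub>0 * R)\<^sup>2 * (L / R)\<^sup>2"
          by (intro mult_mono) auto
        also have "\<dots> = 4 * C\<^sub>0\<^sup>2 * L\<^sup>2" using R by (simp add: power_mult_distrib power_divide)
        finally show ?thesis using True by simp
      next
        case False
        then show ?thesis using elim grad_cutoff_outside[OF R(1), of z y]
          by (cases "z \<in> ball y R") auto
      qed
    qed
  qed
  moreover have "energy (\<lambda>z. (1 - (cutoff y R z)\<^sup>2) * u i z) i
    \<le> energy (u i) i + 4 * (LINT z|lebesgue. (u i z)\<^sup>2 * (norm (grad (cutoff y R) z))\<^sup>2)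
      + 12 * M * C\<^sub>0\<^sup>2 * R * measure lebesgue contact_set"
    by (rule energy_cut[OF i1 R(1) order_refl contact_set_lmeasurable AE_other_zero[OF i]])
      (auto simp: contact_set_def)
  moreover have "12 * M * C\<^sub>0\<^sup>2 * R * measure lebesgue contact_set \<le> 12 * M * C\<^sub>0\<^sup>2 * measure lebesgue contact_set"
    using R M by (intro mult_right_mono mult_left_le) auto
  ultimately have "energy (\<lambda>z. (1 - (cutoff y R z)\<^sup>2) * u i z) i
    \<le> energy (u i) i + (16 * C\<^sub>0\<^sup>2 * L\<^sup>2 + 12 * M * C\<^sub>0\<^sup>2) * measure lebesgue contact_set"
    by (simp add: algebra_simps)
  also have "\<dots> \<le> energy (u i) i + (16 * C\<^sub>0\<^sup>2 * L\<^sup>2 + 12 * M * C\<^sub>0\<^sup>2) * (\<kappa> * R ^ CARD('n))"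
    using M by (intro add_left_mono mult_left_mono contact_set_measure) auto
  finally show ?thesis .
qed

lemma energy_perturb:
  assumes \<rho>: "0 < \<rho>" "\<rho> \<le> R" and \<tau>: "0 \<le> \<tau>" "\<tau> \<le> R"
  shows "energy (\<lambda>z. u 1 z + \<tau> * bump y \<rho> z) 1 \<le> energy (u 1) 1
    + (- 2 * \<tau> * (LINT z|lebesgue. u 1 z * laplacian (bump y \<rho>) z)
      + \<tau>\<^sup>2 * ((2 * L / \<rho>)\<^sup>2 * (vol * R ^ CARD('n))) + 12 * M * C\<^sub>0\<^sup>2 * R * (vol * R ^ CARD('n)))"
proof -
  let ?v = "\<lambda>z. u 1 z + \<tau> * bump y \<rho> z"
  note pert = W12_perturb[OF u_W12[OF one_mem] bump_test[OF \<rho>(1)], of \<tau> y]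
  have m: "measure lebesgue (ball y R) = vol * R ^ CARD('n)" 
    unfolding vol using measure_lebesgue_ball[OF less_imp_le[OF R(1)], of y] by simp
  have "(LINT z|lebesgue. (norm (grad (bump y \<rho>) z))\<^sup>2) \<le> (2 * L / \<rho>)\<^sup>2 * measure lebesgue (ball y R)"
  proof (rule integral_le_measure[OF _ lmeasurable_ball])
    show "integrable lebesgue (\<lambda>z. (norm (grad (bump y \<rho>) z))\<^sup>2)"
      using bounded_support_grad[OF bump_test[OF \<rho>(1)], of y]
      by (intro integrable_bounded_support locally_integrable_continuous continuous_intros
          smooth_continuous_grad test_functions_smooth bump_test \<rho>) auto
    show "AE z in lebesgue. (norm (grad (bump y \<rho>) z))\<^sup>2 \<le> (2 * L / \<rho>)\<^sup>2 * indicator (ball y R) z"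
    proof (intro AE_I2)
      fix z
      show "(norm (grad (bump y \<rho>) z))\<^sup>2 \<le> (2 * L / \<rho>)\<^sup>2 * indicator (ball y R) z"
        using power_mono[OF norm_grad_bump_le[OF \<rho>(1) bump_slope, of y z] norm_ge_zero, of 2]
          grad_bump_outside[OF \<rho>(1), of z y] \<rho>(2) by (cases "z \<in> ball y R") auto
    qed
  qed
  then have "\<tau>\<^sup>2 * (LINT z|lebesgue. (norm (grad (bump y \<rho>) z))\<^sup>2) \<le> \<tau>\<^sup>2 * ((2 * L / \<rho>)\<^sup>2 * (vol * R ^ CARD('n)))"
    unfolding m by (intro mult_left_mono) auto
  moreover have "(LINT z|lebesgue. (?v z)\<^sup>2 * f 1 z - ?v z * g 1 z) - (LINT z|lebesgue. (u 1 z)\<^sup>2 * f 1 z - u 1 z * g 1 z)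
      \<le> M * (2 * (2 * C\<^sub>0 * R)\<^sup>2 + 2 * (2 * C\<^sub>0 * R)) * measure lebesgue (ball y R)"
  proof (rule potential_change[OF u_measurable[OF one_mem] _ f_measurable[OF one_mem] g_measurable[OF one_mem]
        f_bound[OF one_mem] g_bound[OF one_mem] lmeasurable_ball])
    show "?v \<in> borel_measurable lebesgue" using pert(1) by (simp add: W12_def L2_loc_def)
    show "AE z in lebesgue. z \<notin> ball y R \<longrightarrow> ?v z = u 1 z"
      using bump_nonzero_iff[OF \<rho>(1), of y] \<rho>(2) by (intro AE_I2) auto
    fix z assume z: "z \<in> ball y R"
    have "C\<^sub>0 * dist y z \<le> C\<^sub>0 * R" using z C\<^sub>0 by (intro mult_left_mono) auto
    then have ub: "\<bar>u 1 z\<bar> \<le> C\<^sub>0 * R" using u1_bound[OF z] by linarith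
    have C\<^sub>0R: "R \<le> C\<^sub>0 * R" using C\<^sub>0 R by simp
    then show "\<bar>u 1 z\<bar> \<le> 2 * C\<^sub>0 * R" using ub R by linarith
    have "\<tau> * bump y \<rho> z \<le> R * 1"
      using \<tau> R bump_nonneg bump_le_1 by (intro mult_mono) auto
    moreover have "0 \<le> \<tau> * bump y \<rho> z" using \<tau>(1) bump_nonneg[of y \<rho> z] by simp
    ultimately show "\<bar>?v z\<bar> \<le> 2 * C\<^sub>0 * R" using ub C\<^sub>0R by linarith
  qed
  moreover have "M * (2 * (2 * C\<^sub>0 * R)\<^sup>2 + 2 * (2 * C\<^sub>0 * R)) * measure lebesgue (ball y R)
      \<le> 12 * M * C\<^sub>0\<^sup>2 * R * (vol * R ^ CARD('n))"
    unfolding m[symmetric] using potential_constant by (intro mult_right_mono) auto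
  ultimately show ?thesis using pert(2) unfolding energy_def by linarith
qed

text \<open>All of \<open>ball y (R / 2)\<close> is given to \<open>W 1\<close>, which makes room for an arbitrary perturbation of
  \<open>u 1\<close> there. The cutoff equals \<open>1\<close> on that ball, so the other functions leave it.\<close>

lemma transfer_ball_admissible:
  assumes \<rho>: "0 < \<rho>" "\<rho> \<le> R / 2"
  defines "B \<equiv> ball y (R / 2)"
  shows "((\<lambda>i. if i = 1 then (\<lambda>z. u 1 z + \<tau> * bump y \<rho> z) else (\<lambda>z. (1 - (cutoff y R z)\<^sup>2) * u i z)),
      (\<lambda>i\<in>{1..N}. if i = 1 then W 1 \<union> B else W i - B)) \<in> admissible_pairs N \<Omega>"
    (is "(?v, ?V) \<in> _")
proof -
  have B: "B \<in> sets borel" "B \<subseteq> \<Omega>"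
    using ball_sub R by (auto simp: B_def intro: subset_trans[OF subset_ball])
  have "?V \<in> admissible_sets N \<Omega>"
    unfolding admissible_sets_def mem_Collect_eq
  proof
    show "?V \<in> {1..N} \<rightarrow>\<^sub>E {A \<in> sets borel. A \<subseteq> \<Omega>}"
      unfolding restrict_PiE_iff using B W_borel W_sub by (simp add: le_infI1 Diff_subset[THEN subset_trans])
    show "disjoint_family_on ?V {1..N}"
      unfolding disjoint_family_on_def
    proof (intro ballI impI)
      fix i j assume ij: "i \<in> {1..N}" "j \<in> {1..N}" "i \<noteq> j"
      then show "?V i \<inter> ?V j = {}"
        using W_disjoint[OF ij] by (cases "i = 1"; cases "j = 1") (simp_all, blast+)
    qed
  qed
  moreover have "?v i \<in> W12" if "i \<in> {1..N}" for i
    using W12_perturb(1)[OF u_W12[OF one_mem] bump_test[OF \<rho>(1)]]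
      W12_cut(1)[OF u_W12[OF that] cutoff_test[OF R(1)] cutoff_nonneg cutoff_le_1] by auto
  moreover have "AE z in lebesgue. z \<notin> ?V i \<longrightarrow> ?v i z = 0" if i: "i \<in> {1..N}" for i
    using u_outside[OF i]
  proof eventually_elim
    case (elim z)
    have "bump y \<rho> z = 0" if "z \<notin> B"
      using that bump_nonzero_iff[OF \<rho>(1), of y z] \<rho>(2) by (auto simp: B_def)
    moreover have "cutoff y R z = 1" if "z \<in> B"
      using that R by (intro cutoff_eq_1) (auto simp: B_def)
    ultimately show ?case using elim i by auto
  qed
  ultimately show ?thesis by (simp add: admissible_pairs_def)
qed

text \<open>Almost all of the ball belongs to \<open>W 1\<close> before the transfer, so every component changes only
  inside the contact set, up to a null set.\<close>

lemma transfer_ball_volume: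
  defines "B \<equiv> ball y (R / 2)"
  shows "F (\<lambda>i\<in>{1..N}. if i = 1 then W 1 \<union> B else W i - B) - F W \<le> C\<^sub>F * (real N * (\<kappa> * R ^ CARD('n)))"
    (is "F ?V - F W \<le> _")
proof -
  have "?V \<in> admissible_sets N \<Omega>"
    unfolding B_def using transfer_ball_admissible[of "R / 2" 0] R by (simp add: admissible_pairs_def)
  then have "\<bar>F ?V - F W\<bar> \<le> C\<^sub>F * (\<Sum>i=1..N. measure lebesgue ((?V i - W i) \<union> (W i - ?V i)))"
    using F_Lipschitz W_admissible unfolding F_Lipschitz_def by blast
  also have "\<dots> \<le> C\<^sub>F * (\<Sum>i=1..N. \<kappa> * R ^ CARD('n))"
  proof (intro mult_left_mono sum_mono C\<^sub>F)
    fix i assume i: "i \<in> {1..N}"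
    have "AE z in lebesgue. z \<in> (?V i - W i) \<union> (W i - ?V i) \<longrightarrow> z \<in> contact_set"
      using AE_in_W1
    proof eventually_elim
      case (elim z)
      then show ?case using i R W_disjoint[OF one_mem i] by (auto simp: B_def split: if_splits)
    qed
    then have "measure lebesgue ((?V i - W i) \<union> (W i - ?V i)) \<le> measure lebesgue contact_set"
      using contact_set_lmeasurable by (rule measure_lebesgue_mono_AE)
    then show "measure lebesgue ((?V i - W i) \<union> (W i - ?V i)) \<le> \<kappa> * R ^ CARD('n)"
      using contact_set_measure by linarith
  qed
  finally show ?thesis by simp
qed

text \<open>The linear term in \<open>\<tau>\<close> is bounded by the quadratic one plus the cost of making room
  for the perturbation. Dividing by \<open>\<tau>\<close> and choosing it small, but large compared with
  \<open>\<kappa> + R\<close>, shows that \<open>u 1\<close> is nearly harmonic in the weak sense.\<close>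

lemma almost_harmonic:
  assumes \<rho>: "0 < \<rho>" "\<rho> \<le> R / 2" and \<tau>: "0 \<le> \<tau>" "\<tau> \<le> R"
  shows "2 * \<tau> * (LINT z|lebesgue. u 1 z * laplacian (bump y \<rho>) z)
    \<le> \<tau>\<^sup>2 * ((2 * L / \<rho>)\<^sup>2 * (vol * R ^ CARD('n))) + harmonicity_constant * (\<kappa> + R) * R ^ CARD('n)"
proof -
  define p where "p = R ^ CARD('n)"
  have p: "0 < p" using R by (simp add: p_def)
  define a where "a = 16 * C\<^sub>0\<^sup>2 * L\<^sup>2 + 12 * M * C\<^sub>0\<^sup>2"
  have a: "0 \<le> a" using M by (simp add: a_def)
  define e where "e = - 2 * \<tau> * (LINT z|lebesgue. u 1 z * laplacian (bump y \<rho>) z)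
      + \<tau>\<^sup>2 * ((2 * L / \<rho>)\<^sup>2 * (vol * p)) + 12 * M * C\<^sub>0\<^sup>2 * R * (vol * p)"
  have \<rho>R: "\<rho> \<le> R" using \<rho> R by linarith
  have "0 \<le> real N * (a * (\<kappa> * p)) + e + (F (\<lambda>i\<in>{1..N}. if i = 1 then W 1 \<union> ball y (R / 2) else W i - ball y (R / 2)) - F W)"
    using energy_perturb[OF \<rho>(1) \<rho>R \<tau>] energy_cut_other a \<kappa> p
    by (intro competitor_inequality[OF transfer_ball_admissible[OF \<rho>, of \<tau>]]) (auto simp: a_def e_def p_def)
  also have "\<dots> \<le> real N * (a * (\<kappa> * p)) + e + C\<^sub>F * (real N * (\<kappa> * p))"
    using transfer_ball_volume by (simp add: p_def)
  also have "\<dots> = e + real N * (a + C\<^sub>F) * (\<kappa> * p)" by (simp add: algebra_simps)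
  also have "\<dots> \<le> e + real N * (a + C\<^sub>F) * ((\<kappa> + R) * p)"
    using a C\<^sub>F R p by (intro add_left_mono mult_left_mono mult_right_mono) auto
  finally have "- e \<le> real N * (a + C\<^sub>F) * ((\<kappa> + R) * p)" by simp
  moreover have "12 * M * C\<^sub>0\<^sup>2 * R * (vol * p) \<le> 12 * M * C\<^sub>0\<^sup>2 * vol * ((\<kappa> + R) * p)"
  proof -
    have "0 \<le> 12 * M * C\<^sub>0\<^sup>2 * vol * (\<kappa> * p)" using M \<kappa> p by (intro mult_nonneg_nonneg) auto
    then show ?thesis by (simp add: algebra_simps)
  qed
  ultimately show ?thesis
    unfolding e_def harmonicity_constant_def a_def p_def[symmetric] by (simp add: algebra_simps)
qed

end

section \<open>Averages of the minimizer around a contact point\<close>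

context thin_contact_ball
begin

lemma u1_locally_integrable: "locally_integrable (u 1)"
  using u_W12[OF one_mem] by (intro L2_loc_locally_integrable) (simp add: W12_def)

lemma u1_continuous: "continuous_on (ball y R) (u 1)"
proof (rule continuous_onI)
  fix z e assume z: "z \<in> ball y R" and e: "(0::real) < e"
  show "\<exists>d>0. \<forall>z'\<in>ball y R. dist z' z < d \<longrightarrow> dist (u 1 z') (u 1 z) \<le> e"
  proof (intro exI[of _ "e / C\<^sub>0"] conjI ballI impI)
    show "0 < e / C\<^sub>0" using e C\<^sub>0 by simp
    fix z' assume z': "z' \<in> ball y R" "dist z' z < e / C\<^sub>0"
    have "C\<^sub>0 * dist z' z \<le> e" using z'(2) C\<^sub>0 by (simp add: pos_less_divide_eq mult.commute)
    then show "dist (u 1 z') (u 1 z) \<le> e"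
      using lipschitz[OF one_mem z'(1) z] by (simp add: dist_real_def)
  qed
qed

lemma integrable_u1_averaging_kernel:
  assumes "0 < \<rho>"
  shows "integrable lebesgue (\<lambda>z. u 1 z * averaging_kernel y \<rho> z)"
proof (rule integrable_mult_bounded_support[OF u1_locally_integrable continuous_averaging_kernel])
  show "bounded {z. averaging_kernel y \<rho> z \<noteq> 0}"
    using averaging_kernel_outside[OF assms] by (intro bounded_subset[OF bounded_ball[of y \<rho>]]) blast
qed

text \<open>The average of a Lipschitz function around one of its zeros is at most proportional to the scale.\<close>

lemma average_at_small_scale:
  assumes \<rho>: "0 < \<rho>" "\<rho> \<le> R"
  shows "(LINT z|lebesgue. u 1 z * averaging_kernel y \<rho> z) \<le> 2 * C\<^sub>0 * L * vol * \<rho>"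
proof -
  have "(LINT z|lebesgue. u 1 z * averaging_kernel y \<rho> z)
      \<le> (C\<^sub>0 * \<rho> * (2 * L / \<rho> ^ CARD('n))) * measure lebesgue (ball y \<rho>)"
  proof (rule integral_le_measure[OF integrable_u1_averaging_kernel[OF \<rho>(1)] lmeasurable_ball], rule AE_I2)
    fix z
    show "u 1 z * averaging_kernel y \<rho> z \<le> C\<^sub>0 * \<rho> * (2 * L / \<rho> ^ CARD('n)) * indicator (ball y \<rho>) z"
    proof (cases "z \<in> ball y \<rho>")
      case True
      then have "C\<^sub>0 * dist y z \<le> C\<^sub>0 * \<rho>" using C\<^sub>0 by (intro mult_left_mono) auto
      moreover have "\<bar>u 1 z\<bar> \<le> C\<^sub>0 * dist y z" using True \<rho> by (intro u1_bound) auto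
      ultimately have "u 1 z \<le> C\<^sub>0 * \<rho>" by linarith
      then have "u 1 z * averaging_kernel y \<rho> z \<le> C\<^sub>0 * \<rho> * (2 * L / \<rho> ^ CARD('n))"
        using averaging_kernel_le[OF \<rho>(1) bump_slope] averaging_kernel_nonneg[OF \<rho>(1)] C\<^sub>0 \<rho>
        by (intro mult_mono) auto
      then show ?thesis using True by simp
    qed (simp add: averaging_kernel_outside[OF \<rho>(1)] del: mem_ball)
  qed
  also have "\<dots> = 2 * C\<^sub>0 * L * vol * \<rho>"
    unfolding measure_lebesgue_ball[OF less_imp_le[OF \<rho>(1)]] vol[symmetric] using \<rho> by simp
  finally show ?thesis .
qed

text \<open>Half of what \<open>almost_harmonic\<close> allows for \<open>\<tau> = t R\<close> and \<open>\<rho> = s R\<close>, divided by \<open>t R\<^sup>n\<close>.\<close>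

definition average_error :: "real \<Rightarrow> real \<Rightarrow> real" where
  "average_error s t = 2 * t * L\<^sup>2 * vol / s\<^sup>2 + harmonicity_constant * (\<kappa> + R) / (2 * t)"

lemma harmonicity_constant_nonneg: "0 \<le> harmonicity_constant"
proof -
  have "0 \<le> vol" using \<kappa> by linarith
  then show ?thesis unfolding harmonicity_constant_def using M C\<^sub>F by simp
qed

lemma average_error_nonneg: "0 < t \<Longrightarrow> 0 \<le> average_error s t"
  unfolding average_error_def using harmonicity_constant_nonneg \<kappa> R by simp

text \<open>This is \<open>almost_harmonic\<close> with \<open>\<tau> = t R\<close>. The negative powers of \<open>\<rho>\<close> are estimated
  at the smallest scale \<open>s R\<close>, which is harmless because \<open>s\<close> is fixed before \<open>t\<close>, \<open>\<kappa>\<close> and \<open>R\<close>.\<close>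

lemma average_derivative_le:
  assumes s: "0 < s" and t: "0 < t" "t \<le> 1" and \<rho>: "s * R \<le> \<rho>" "\<rho> \<le> R / 2"
  shows "\<rho> / \<rho> ^ CARD('n) * (LINT z|lebesgue. u 1 z * laplacian (bump y \<rho>) z)
    \<le> average_error s t / s ^ CARD('n)"
proof -
  let ?I = "LINT z|lebesgue. u 1 z * laplacian (bump y \<rho>) z"
  define p where "p = R ^ CARD('n)"
  have p: "0 < p" using R by (simp add: p_def)
  have sR: "0 < s * R" using s R by simp
  then have \<rho>0: "0 < \<rho>" using \<rho>(1) by linarith
  have vol0: "0 < vol" using \<kappa> by linarith
  have "2 * (t * R) * ?I \<le> (t * R)\<^sup>2 * ((2 * L / \<rho>)\<^sup>2 * (vol * p)) + harmonicity_constant * (\<kappa> + R) * p"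
    unfolding p_def using t R by (intro almost_harmonic[OF \<rho>0 \<rho>(2)]) (auto simp: mult_left_le_one_le)
  also have "\<dots> \<le> (t * R)\<^sup>2 * ((2 * L / (s * R))\<^sup>2 * (vol * p)) + harmonicity_constant * (\<kappa> + R) * p"
    using \<rho> sR L_nonneg vol0 p
    by (intro add_right_mono mult_left_mono mult_right_mono power_mono divide_left_mono) auto
  also have "\<dots> = 2 * (t * R) * (p / R * average_error s t)"
    unfolding average_error_def using s t R by (simp add: field_simps power2_eq_square)
  finally have I: "?I \<le> p / R * average_error s t"
    using mult_le_cancel_left_pos[of "2 * (t * R)"] t R by (auto simp: pos_le_divide_eq mult.commute)
  have "\<rho> / \<rho> ^ CARD('n) * ?I \<le> \<rho> / \<rho> ^ CARD('n) * (p / R * average_error s t)"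
    using \<rho>0 by (intro mult_left_mono I) auto
  also have "\<dots> \<le> R / (s * R) ^ CARD('n) * (p / R * average_error s t)"
    using \<rho> \<rho>0 s sR R p average_error_nonneg[OF t(1)]
    by (intro mult_right_mono frac_le power_mono mult_nonneg_nonneg) auto
  also have "\<dots> = average_error s t / s ^ CARD('n)"
    using s R by (simp add: p_def power_mult_distrib)
  finally show ?thesis .
qed

text \<open>The mean value theorem in the scale parameter carries the smallness from \<open>s R\<close> to \<open>R / 2\<close>.\<close>

lemma average_at_unit_scale:
  assumes s: "0 < s" "s < 1 / 2" and t: "0 < t" "t \<le> 1"
  shows "(LINT z|lebesgue. u 1 z * averaging_kernel y (R / 2) z)
    \<le> R * (2 * C\<^sub>0 * L * vol * s + average_error s t / s ^ CARD('n))"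
proof -
  let ?m = "\<lambda>\<rho>. LINT z|lebesgue. u 1 z * averaging_kernel y \<rho> z"
  let ?m' = "\<lambda>\<rho>. \<rho> / \<rho> ^ CARD('n) * (LINT z|lebesgue. u 1 z * laplacian (bump y \<rho>) z)"
  have sR: "0 < s * R" "s * R < R / 2" "s * R \<le> R" using s R by (auto simp: mult_le_cancel_right1)
  obtain \<rho> where \<rho>: "s * R < \<rho>" "\<rho> < R / 2" "?m (R / 2) - ?m (s * R) = (R / 2 - s * R) * ?m' \<rho>"
    using MVT2[OF sR(2), of ?m ?m'] DERIV_bump_average[OF u1_continuous] sR R by force
  have "(R / 2 - s * R) * ?m' \<rho> \<le> (R / 2 - s * R) * (average_error s t / s ^ CARD('n))"
    using sR s t \<rho> by (intro mult_left_mono average_derivative_le) auto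
  also have "\<dots> \<le> R * (average_error s t / s ^ CARD('n))"
  proof (rule mult_right_mono)
    show "R / 2 - s * R \<le> R" using sR R by linarith
    show "0 \<le> average_error s t / s ^ CARD('n)" using s average_error_nonneg[OF t(1)] by simp
  qed
  finally have "?m (R / 2) \<le> 2 * C\<^sub>0 * L * vol * (s * R) + R * (average_error s t / s ^ CARD('n))"
    using average_at_small_scale[OF sR(1,3)] \<rho>(3) by linarith
  then show ?thesis by (simp add: algebra_simps)
qed

lemma integrable_u1_ball: "integrable lebesgue (\<lambda>z. indicator (ball y (R / 4)) z * \<bar>u 1 z\<bar>)"
proof -
  have "integrable lebesgue (\<lambda>z. indicator (cball y (R / 4)) z *\<^sub>R u 1 z)"
    using u1_locally_integrable by (simp add: locally_integrable_def set_integrable_def)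
  then have "integrable lebesgue (\<lambda>z. indicator (ball y (R / 4)) z *\<^sub>R (indicator (cball y (R / 4)) z *\<^sub>R u 1 z))"
    by (rule integrable_mult_indicator[rotated]) simp
  then have "integrable lebesgue (\<lambda>z. \<bar>indicator (ball y (R / 4)) z *\<^sub>R (indicator (cball y (R / 4)) z *\<^sub>R u 1 z)\<bar>)"
    by (rule integrable_abs)
  moreover have "(\<lambda>z. \<bar>indicator (ball y (R / 4)) z *\<^sub>R (indicator (cball y (R / 4)) z *\<^sub>R u 1 z)\<bar>)
      = (\<lambda>z. indicator (ball y (R / 4)) z * \<bar>u 1 z\<bar>)"
    by (intro ext) (auto simp: indicator_def)
  ultimately show ?thesis by simp
qed

text \<open>Since \<open>|u|\<close> is \<open>u\<close> plus twice its negative part, and the negative part is supported on the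
  contact set, the average of \<open>u 1\<close> controls that of \<open>|u 1|\<close>. On \<open>ball y (R / 4)\<close>, which is
  half the ball of radius \<open>R / 2\<close>, the kernel is bounded below.\<close>

lemma L1_norm_le_average:
  "(LINT z|lebesgue. indicator (ball y (R / 4)) z * \<bar>u 1 z\<bar>)
    \<le> R ^ CARD('n) * exp 2 / (2 * 2 ^ CARD('n)) *
      ((LINT z|lebesgue. u 1 z * averaging_kernel y (R / 2) z) + 4 * C\<^sub>0 * L * 2 ^ CARD('n) * \<kappa> * R)"
proof -
  define p where "p = R ^ CARD('n)"
  define q where "q = (2::real) ^ CARD('n)"
  have p: "0 < p" and q: "0 < q" using R by (simp_all add: p_def q_def)
  have R2: "0 < R / 2" "(R / 2) ^ CARD('n) = p / q" using R by (simp_all add: p_def q_def power_divide)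
  let ?k = "averaging_kernel y (R / 2)"
  define a where "a = p * exp 2 / (2 * q)"
  have a: "0 < a" using p q by (simp add: a_def)
  define b where "b = 2 * (C\<^sub>0 * R) * (2 * L / (p / q))"
  have b: "0 \<le> b" using C\<^sub>0 R L_nonneg p q by (simp add: b_def)
  have int_b: "integrable lebesgue (\<lambda>z. b * indicator contact_set z)"
    using contact_set_lmeasurable by (intro integrable_mult_right integrable_real_indicator) (auto simp: fmeasurable_def)
  have "(LINT z|lebesgue. indicator (ball y (R / 4)) z * \<bar>u 1 z\<bar>)
      \<le> (LINT z|lebesgue. a * (u 1 z * ?k z + b * indicator contact_set z))"
  proof (rule integral_mono[OF integrable_u1_ball])
    show "integrable lebesgue (\<lambda>z. a * (u 1 z * ?k z + b * indicator contact_set z))"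
      using integrable_u1_averaging_kernel[OF R2(1)] int_b by simp
    fix z
    have k0: "0 \<le> ?k z" by (rule averaging_kernel_nonneg[OF R2(1)])
    have k_le: "?k z \<le> 2 * L / (p / q)" using averaging_kernel_le[OF R2(1) bump_slope, of y z] R2(2) by simp
    \<comment> \<open>\<open>|u| = u + 2 u\<^sup>-\<close>, and twice the negative part times the kernel is at most \<open>b\<close>\<close>
    have "\<bar>u 1 z\<bar> * ?k z \<le> u 1 z * ?k z + b * indicator contact_set z"
    proof (cases "z \<in> ball y (R / 2) \<and> u 1 z \<le> 0")
      case True
      then have z: "z \<in> ball y R" using R by auto
      have "C\<^sub>0 * dist y z \<le> C\<^sub>0 * R" using z C\<^sub>0 by (intro mult_left_mono) auto
      then have "\<bar>u 1 z\<bar> \<le> C\<^sub>0 * R" using u1_bound[OF z] by linarith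
      then have "2 * \<bar>u 1 z\<bar> * ?k z \<le> b"
        unfolding b_def using k_le k0 C\<^sub>0 R by (intro mult_mono) auto
      moreover have "\<bar>u 1 z\<bar> = - u 1 z" "z \<in> contact_set" using True z by (auto simp: contact_set_def)
      ultimately show ?thesis by simp
    next
      case False
      have "0 \<le> b * indicator contact_set z" using b by simp
      moreover have "\<bar>u 1 z\<bar> * ?k z = u 1 z * ?k z"
        using False averaging_kernel_outside[OF R2(1), of z y] by auto
      ultimately show ?thesis by linarith
    qed
    moreover have "indicator (ball y (R / 4)) z * \<bar>u 1 z\<bar> \<le> a * (\<bar>u 1 z\<bar> * ?k z)"
    proof (cases "z \<in> ball y (R / 4)")
      case True
      have "2 * exp (- 2) / (p / q) \<le> ?k z"
        using averaging_kernel_ge[OF R2(1), of y z] True R2(2) by simp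
      then have "a * (2 * exp (- 2) / (p / q)) \<le> a * ?k z" using a by (intro mult_left_mono) auto
      moreover have "a * (2 * exp (- 2) / (p / q)) = 1"
        unfolding a_def using p q by (simp add: exp_minus)
      ultimately have "\<bar>u 1 z\<bar> * 1 \<le> \<bar>u 1 z\<bar> * (a * ?k z)" by (intro mult_left_mono) auto
      then show ?thesis using True by (simp add: mult_ac)
    next
      case False
      then show ?thesis using a k0 by simp
    qed
    ultimately show "indicator (ball y (R / 4)) z * \<bar>u 1 z\<bar> \<le> a * (u 1 z * ?k z + b * indicator contact_set z)"
      using a by (meson mult_left_mono less_imp_le order_trans)
  qed
  also have "\<dots> = a * ((LINT z|lebesgue. u 1 z * ?k z) + b * measure lebesgue contact_set)"
    using integrable_u1_averaging_kernel[OF R2(1)] int_b contact_set_lmeasurable by simp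
  also have "\<dots> \<le> a * ((LINT z|lebesgue. u 1 z * ?k z) + b * (\<kappa> * p))"
    unfolding p_def using a b contact_set_measure by (intro mult_left_mono add_left_mono) auto
  also have "b * (\<kappa> * p) = 4 * C\<^sub>0 * L * q * \<kappa> * R" using p q by (simp add: b_def)
  finally show ?thesis by (simp add: a_def p_def q_def)
qed

end

section \<open>The gain from nondegeneracy\<close>

context thin_contact_ball
begin

lemma remove_ball_admissible:
  assumes A: "A \<in> sets borel" "A \<subseteq> W 1" "A \<subseteq> ball y (R / 8)"
    and A': "\<forall>j\<in>{2..N}. A' j \<in> sets borel \<and> A' j \<subseteq> A" "disjoint_family_on A' {2..N}"
  shows "((\<lambda>i. if i = 1 then (\<lambda>z. (1 - (cutoff y (R / 4) z)\<^sup>2) * u 1 z) else u i),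
      (\<lambda>i\<in>{1..N}. if i = 1 then W 1 - A else W i \<union> A' i)) \<in> admissible_pairs N \<Omega>"
    (is "(?v, ?V) \<in> _")
proof -
  have A'_mem: "A' i \<in> sets borel \<and> A' i \<subseteq> A" if "i \<in> {1..N}" "i \<noteq> 1" for i
    using A'(1) that by auto
  have "?V \<in> admissible_sets N \<Omega>"
    unfolding admissible_sets_def mem_Collect_eq
  proof
    have "W i \<union> A' i \<in> sets borel \<and> W i \<union> A' i \<subseteq> \<Omega>" if "i \<in> {1..N}" "i \<noteq> 1" for i
      using A'_mem[OF that] W_borel[OF that(1)] W_sub[OF that(1)] A(2) W_sub[OF one_mem] by auto
    moreover have "W 1 - A \<in> sets borel \<and> W 1 - A \<subseteq> \<Omega>"
      using A(1) W_borel[OF one_mem] W_sub[OF one_mem] by auto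
    ultimately show "?V \<in> {1..N} \<rightarrow>\<^sub>E {A \<in> sets borel. A \<subseteq> \<Omega>}"
      unfolding restrict_PiE_iff by simp
    show "disjoint_family_on ?V {1..N}"
      unfolding disjoint_family_on_def
    proof (intro ballI impI)
      fix i j assume ij: "i \<in> {1..N}" "j \<in> {1..N}" "i \<noteq> j"
      consider "i = 1" "j \<noteq> 1" | "i \<noteq> 1" "j = 1" | "i \<noteq> 1" "j \<noteq> 1" using ij(3) by blast
      then show "?V i \<inter> ?V j = {}"
      proof cases
        case 1
        have "(W 1 - A) \<inter> (W j \<union> A' j) = {}"
          using W_disjoint[OF one_mem ij(2)] A'_mem[OF ij(2)] 1 by blast
        then show ?thesis using 1 ij by simp
      next
        case 2
        have "(W i \<union> A' i) \<inter> (W 1 - A) = {}"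
          using W_disjoint[OF ij(1) one_mem] A'_mem[OF ij(1)] 2 by blast
        then show ?thesis using 2 ij by simp
      next
        case 3
        then have "A' i \<inter> A' j = {}"
          using A'(2) ij unfolding disjoint_family_on_def by auto
        moreover have "W i \<inter> W 1 = {}" "W j \<inter> W 1 = {}"
          using W_disjoint[OF ij(1) one_mem] W_disjoint[OF ij(2) one_mem] 3 by auto
        ultimately have "(W i \<union> A' i) \<inter> (W j \<union> A' j) = {}"
          using W_disjoint[OF ij] A'_mem[OF ij(1)] A'_mem[OF ij(2)] A(2) 3 by blast
        then show ?thesis using 3 ij by simp
      qed
    qed
  qed
  moreover have "?v i \<in> W12" if "i \<in> {1..N}" for i
    using W12_cut(1)[OF u_W12[OF one_mem] cutoff_test cutoff_nonneg cutoff_le_1] u_W12[OF that] R by auto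
  moreover have "AE z in lebesgue. z \<notin> ?V i \<longrightarrow> ?v i z = 0" if i: "i \<in> {1..N}" for i
    using u_outside[OF i]
  proof eventually_elim
    case (elim z)
    have "cutoff y (R / 4) z = 1" if "z \<in> A"
      using that A(3) R by (intro cutoff_eq_1) auto
    then show ?case using elim i by auto
  qed
  ultimately show ?thesis by (simp add: admissible_pairs_def)
qed

text \<open>Almost every point of the ball lies in \<open>W 1\<close> or in the contact set.\<close>

lemma W1_ball_measure:
  "(vol / 8 ^ CARD('n) - \<kappa>) * R ^ CARD('n) \<le> measure lebesgue (W 1 \<inter> ball y (R / 8))"
  "measure lebesgue (W 1 \<inter> ball y (R / 8)) \<le> vol * R ^ CARD('n)"
proof -
  let ?A = "W 1 \<inter> ball y (R / 8)"
  have lm: "?A \<in> lmeasurable"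
    using W_borel[OF one_mem] fmeasurable_Int_fmeasurable[OF lmeasurable_ball, of "W 1" y "R / 8"]
    by (simp add: Int_commute)
  have "AE z in lebesgue. z \<in> ball y (R / 8) \<longrightarrow> z \<in> ?A \<union> contact_set"
    using AE_in_W1 by eventually_elim (use R in auto)
  then have "measure lebesgue (ball y (R / 8)) \<le> measure lebesgue (?A \<union> contact_set)"
    using lm contact_set_lmeasurable by (intro measure_lebesgue_mono_AE) auto
  also have "\<dots> \<le> measure lebesgue ?A + measure lebesgue contact_set"
    using lm contact_set_lmeasurable by (intro measure_Un_le) auto
  finally have "measure lebesgue (ball y (R / 8)) \<le> measure lebesgue ?A + \<kappa> * R ^ CARD('n)"
    using contact_set_measure by linarith
  moreover have "measure lebesgue (ball y (R / 8)) = vol / 8 ^ CARD('n) * R ^ CARD('n)"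
    using measure_lebesgue_ball[of "R / 8" y] R vol by (simp add: power_divide)
  ultimately show "(vol / 8 ^ CARD('n) - \<kappa>) * R ^ CARD('n) \<le> measure lebesgue ?A"
    by (simp add: left_diff_distrib)
  have "measure lebesgue ?A \<le> measure lebesgue (ball y R)"
    using R by (intro measure_lebesgue_mono_AE AE_I2) auto
  then show "measure lebesgue ?A \<le> vol * R ^ CARD('n)"
    using measure_lebesgue_ball[of R y] R vol by simp
qed

text \<open>Removing \<open>A = W 1 \<inter> ball y (R / 8)\<close> from \<open>W 1\<close> gains \<open>lam\<close> times the measure of \<open>A\<close>, while
  cutting \<open>u 1\<close> off costs \<open>4 \<integral> u\<^sup>2 |\<nabla>\<psi>|\<^sup>2\<close>. In that integral one factor \<open>u\<close> is estimated by
  \<open>C\<^sub>0 R\<close>, so the \<open>L\<^sup>1\<close> norm of \<open>u 1\<close> suffices.\<close>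

lemma nondegeneracy_estimate:
  assumes nondeg: "nondegenerate N lam \<epsilon> F W" and lam: "0 < lam" and \<epsilon>: "vol * R \<le> \<epsilon>"
    and \<kappa>8: "\<kappa> < vol / 8 ^ CARD('n)"
  shows "lam * ((vol / 8 ^ CARD('n) - \<kappa>) * R ^ CARD('n))
    \<le> 64 * L\<^sup>2 * C\<^sub>0 / R * (LINT z|lebesgue. indicator (ball y (R / 4)) z * \<bar>u 1 z\<bar>)
      + 12 * M * C\<^sub>0\<^sup>2 * R * (vol * R ^ CARD('n))"
proof -
  define A where "A = W 1 \<inter> ball y (R / 8)"
  have A: "A \<in> sets borel" "A \<subseteq> W 1" "A \<subseteq> ball y (R / 8)"
    using W_borel[OF one_mem] by (auto simp: A_def)
  have "0 < (vol / 8 ^ CARD('n) - \<kappa>) * R ^ CARD('n)" using \<kappa>8 R by simp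
  then have A_pos: "0 < measure lebesgue A" using W1_ball_measure(1) by (simp add: A_def)
  \<comment> \<open>nondegeneracy only concerns sets of measure at most \<open>\<epsilon>\<close>; here \<open>R \<le> 1\<close> enters\<close>
  have "vol * R ^ CARD('n) \<le> vol * R" using R_power_le \<kappa> by (intro mult_left_mono) auto
  then have A_small: "measure lebesgue A \<le> \<epsilon>" using W1_ball_measure(2) \<epsilon> by (simp add: A_def)
  have "\<exists>A'. (\<forall>j\<in>{2..N}. A' j \<in> sets borel \<and> A' j \<subseteq> A) \<and> disjoint_family_on A' {2..N} \<and>
      F (\<lambda>i\<in>{1..N}. if i = 1 then W 1 - A else W i \<union> A' i) \<le> F W - lam * measure lebesgue A"
    by (rule nondeg[unfolded nondegenerate_def, rule_format, OF A(1,2) A_pos A_small])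
  then obtain A' where A': "\<forall>j\<in>{2..N}. A' j \<in> sets borel \<and> A' j \<subseteq> A" "disjoint_family_on A' {2..N}"
    and gain: "F (\<lambda>i\<in>{1..N}. if i = 1 then W 1 - A else W i \<union> A' i) \<le> F W - lam * measure lebesgue A"
    by (elim exE conjE)
  have R4: "0 < R / 4" "R / 4 \<le> R" using R by auto
  define D where "D = (LINT z|lebesgue. (u 1 z)\<^sup>2 * (norm (grad (cutoff y (R / 4)) z))\<^sup>2)"
  have cut: "energy (\<lambda>z. (1 - (cutoff y (R / 4) z)\<^sup>2) * u 1 z) 1
      \<le> energy (u 1) 1 + (4 * D + 12 * M * C\<^sub>0\<^sup>2 * R * measure lebesgue (ball y R))"
    using energy_cut[OF one_mem R4 lmeasurable_ball[of y R]] R4 unfolding D_def by (auto simp: add_ac)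
  have "0 \<le> real N * 0 + (4 * D + 12 * M * C\<^sub>0\<^sup>2 * R * measure lebesgue (ball y R))
      + (F (\<lambda>i\<in>{1..N}. if i = 1 then W 1 - A else W i \<union> A' i) - F W)"
    by (rule competitor_inequality[OF remove_ball_admissible[OF A A']]) (use cut in auto)
  then have "lam * measure lebesgue A \<le> 4 * D + 12 * M * C\<^sub>0\<^sup>2 * R * (vol * R ^ CARD('n))"
    using gain measure_lebesgue_ball[of R y] R vol by simp
  moreover have "lam * ((vol / 8 ^ CARD('n) - \<kappa>) * R ^ CARD('n)) \<le> lam * measure lebesgue A"
    using W1_ball_measure(1) lam by (simp add: A_def)
  moreover have "4 * D \<le> 64 * L\<^sup>2 * C\<^sub>0 / R * (LINT z|lebesgue. indicator (ball y (R / 4)) z * \<bar>u 1 z\<bar>)"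
  proof -
    have "D \<le> (LINT z|lebesgue. 16 * L\<^sup>2 * C\<^sub>0 / R * (indicator (ball y (R / 4)) z * \<bar>u 1 z\<bar>))"
      unfolding D_def
    proof (rule integral_mono)
      show "integrable lebesgue (\<lambda>z. (u 1 z)\<^sup>2 * (norm (grad (cutoff y (R / 4)) z))\<^sup>2)"
        by (rule W12_cut(2)[OF u_W12[OF one_mem] cutoff_test[OF R4(1)] cutoff_nonneg cutoff_le_1])
      show "integrable lebesgue (\<lambda>z. 16 * L\<^sup>2 * C\<^sub>0 / R * (indicator (ball y (R / 4)) z * \<bar>u 1 z\<bar>))"
        by (intro integrable_mult_right integrable_u1_ball)
      fix z
      show "(u 1 z)\<^sup>2 * (norm (grad (cutoff y (R / 4)) z))\<^sup>2
          \<le> 16 * L\<^sup>2 * C\<^sub>0 / R * (indicator (ball y (R / 4)) z * \<bar>u 1 z\<bar>)"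
      proof (cases "z \<in> ball y (R / 4)")
        case True
        then have z: "z \<in> ball y R" using R by auto
        have "C\<^sub>0 * dist y z \<le> C\<^sub>0 * R" using z C\<^sub>0 by (intro mult_left_mono) auto
        then have "\<bar>u 1 z\<bar> \<le> C\<^sub>0 * R" using u1_bound[OF z] by linarith
        then have "\<bar>u 1 z\<bar> * \<bar>u 1 z\<bar> \<le> C\<^sub>0 * R * \<bar>u 1 z\<bar>" by (intro mult_right_mono) auto
        then have sq: "(u 1 z)\<^sup>2 \<le> C\<^sub>0 * R * \<bar>u 1 z\<bar>" by (simp add: power2_eq_square abs_mult[symmetric])
        have "(norm (grad (cutoff y (R / 4)) z))\<^sup>2 \<le> (L / (R / 4))\<^sup>2"
          using cutoff_slope[OF R4(1)] by (intro power_mono) auto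
        with sq have "(u 1 z)\<^sup>2 * (norm (grad (cutoff y (R / 4)) z))\<^sup>2 \<le> C\<^sub>0 * R * \<bar>u 1 z\<bar> * (L / (R / 4))\<^sup>2"
          using C\<^sub>0 R by (intro mult_mono) auto
        also have "\<dots> = 16 * L\<^sup>2 * C\<^sub>0 / R * \<bar>u 1 z\<bar>"
          using R by (simp add: power2_eq_square divide_simps)
        finally show ?thesis using True by simp
      next
        case False
        then show ?thesis using grad_cutoff_outside[OF R4(1) False] by simp
      qed
    qed
    then show ?thesis by simp
  qed
  ultimately show ?thesis by linarith
qed

text \<open>Every term on the right can be made small by the choice of \<open>s\<close>, \<open>t\<close>, \<open>\<kappa>\<close> and \<open>R\<close>, whereas the left
  hand side stays near \<open>lam * vol / 8 ^ CARD('n)\<close>.\<close>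

lemma thin_contact_inequality:
  assumes nondeg: "nondegenerate N lam \<epsilon> F W" and lam: "0 < lam" and \<epsilon>: "vol * R \<le> \<epsilon>"
    and \<kappa>8: "\<kappa> < vol / 8 ^ CARD('n)"
    and s: "0 < s" "s < 1 / 2" and t: "0 < t" "t \<le> 1"
  shows "lam * (vol / 8 ^ CARD('n) - \<kappa>)
    \<le> 64 * L\<^sup>2 * C\<^sub>0 * exp 2 * (2 * C\<^sub>0 * L * vol * s + average_error s t / s ^ CARD('n)
        + 4 * C\<^sub>0 * L * 2 ^ CARD('n) * \<kappa>) + 12 * M * C\<^sub>0\<^sup>2 * vol * R"
proof -
  define p where "p = R ^ CARD('n)"
  have p: "0 < p" using R by (simp add: p_def)
  define Q where "Q = 2 * C\<^sub>0 * L * vol * s + average_error s t / s ^ CARD('n) + 4 * C\<^sub>0 * L * 2 ^ CARD('n) * \<kappa>"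
  have Q: "0 \<le> Q"
    unfolding Q_def using C\<^sub>0 L_nonneg \<kappa> s average_error_nonneg[OF t(1)]
    by (intro add_nonneg_nonneg mult_nonneg_nonneg divide_nonneg_nonneg) auto
  let ?I = "LINT z|lebesgue. indicator (ball y (R / 4)) z * \<bar>u 1 z\<bar>"
  have "?I \<le> p * exp 2 / (2 * 2 ^ CARD('n)) *
      ((LINT z|lebesgue. u 1 z * averaging_kernel y (R / 2) z) + 4 * C\<^sub>0 * L * 2 ^ CARD('n) * \<kappa> * R)"
    unfolding p_def by (rule L1_norm_le_average)
  also have "\<dots> \<le> p * exp 2 / (2 * 2 ^ CARD('n)) * (R * Q)"
  proof (rule mult_left_mono)
    show "(LINT z|lebesgue. u 1 z * averaging_kernel y (R / 2) z) + 4 * C\<^sub>0 * L * 2 ^ CARD('n) * \<kappa> * R \<le> R * Q"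
      using average_at_unit_scale[OF s t] by (simp add: Q_def algebra_simps)
  qed (use p in simp)
  also have "\<dots> \<le> p * exp 2 * (R * Q)"
  proof (rule mult_right_mono)
    have "(1::real) \<le> 2 * 2 ^ CARD('n)" using one_le_power[of "2::real" "CARD('n)"] by linarith
    then show "p * exp 2 / (2 * 2 ^ CARD('n)) \<le> p * exp 2"
      using p by (simp add: divide_le_eq mult_le_cancel_left1 mult_less_0_iff)
  qed (use Q R in auto)
  finally have "64 * L\<^sup>2 * C\<^sub>0 / R * ?I \<le> 64 * L\<^sup>2 * C\<^sub>0 / R * (p * exp 2 * (R * Q))"
    using C\<^sub>0 R by (intro mult_left_mono) auto
  also have "\<dots> = p * (64 * L\<^sup>2 * C\<^sub>0 * exp 2 * Q)" using R by (simp add: field_simps)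
  finally have "p * (lam * (vol / 8 ^ CARD('n) - \<kappa>)) \<le> p * (64 * L\<^sup>2 * C\<^sub>0 * exp 2 * Q + 12 * M * C\<^sub>0\<^sup>2 * vol * R)"
    using nondegeneracy_estimate[OF nondeg lam \<epsilon> \<kappa>8] unfolding p_def[symmetric]
    by (simp add: algebra_simps)
  then show ?thesis using p unfolding Q_def by (simp add: mult_le_cancel_left_pos)
qed

end

section \<open>Choice of constants\<close>

text \<open>At a point of the ball where \<open>h\<close> is nonzero, its sign is constant nearby, so the point is interior
  to the positivity set or exterior to it.\<close>

lemma lipschitz_zero_on_frontier:
  fixes h :: "'a::metric_space \<Rightarrow> real"
  assumes lip: "\<And>z z'. z \<in> ball x r \<Longrightarrow> z' \<in> ball x r \<Longrightarrow> \<bar>h z - h z'\<bar> \<le> C * dist z z'" and C: "0 < C"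
    and sub: "ball x r \<subseteq> \<Omega>" and y: "y \<in> ball x r" "y \<in> frontier {z \<in> \<Omega>. 0 < h z}"
  shows "h y = 0"
proof (rule ccontr)
  assume "h y \<noteq> 0"
  define \<delta> where "\<delta> = min (r - dist x y) (\<bar>h y\<bar> / C)"
  have \<delta>: "0 < \<delta>" using y(1) C \<open>h y \<noteq> 0\<close> by (simp add: \<delta>_def)
  have near: "z \<in> ball x r \<and> \<bar>h z - h y\<bar> < \<bar>h y\<bar>" if "z \<in> ball y \<delta>" for z
  proof
    show z: "z \<in> ball x r" using that dist_triangle[of x z y] by (simp add: \<delta>_def)
    have "C * dist z y < \<bar>h y\<bar>"
      using that C by (simp add: \<delta>_def pos_less_divide_eq dist_commute mult.commute)
    then show "\<bar>h z - h y\<bar> < \<bar>h y\<bar>" using lip[OF z y(1)] by linarith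
  qed
  show False
  proof (cases "0 < h y")
    case True
    have "ball y \<delta> \<subseteq> {z \<in> \<Omega>. 0 < h z}"
    proof
      fix z assume "z \<in> ball y \<delta>"
      then show "z \<in> {z \<in> \<Omega>. 0 < h z}" using near[of z] sub True by auto
    qed
    then have "y \<in> interior {z \<in> \<Omega>. 0 < h z}"
      using \<delta> by (meson centre_in_ball interiorI open_ball)
    then show False using y(2) by (simp add: frontier_def)
  next
    case False
    have "ball y \<delta> \<inter> {z \<in> \<Omega>. 0 < h z} = {}"
      using near False by fastforce
    moreover have "y \<in> closure {z \<in> \<Omega>. 0 < h z}" using y(2) by (simp add: frontier_def)
    ultimately show False
      using \<delta> open_Int_closure_eq_empty[OF open_ball, of y \<delta> "{z \<in> \<Omega>. 0 < h z}"]
      by (metis IntI centre_in_ball empty_iff)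
  qed
qed

lemma AE_le_of_sup_norm:
  assumes "sup_norm h = ereal m"
  shows "AE z in lebesgue. \<bar>h z\<bar> \<le> \<bar>m\<bar>"
proof -
  have "AE z in lebesgue. ereal \<bar>h z\<bar> \<le> ereal m"
    using esssup_AE[of "\<lambda>z. ereal \<bar>h z\<bar>" lebesgue] assms by (simp add: sup_norm_def)
  then show ?thesis by (rule eventually_mono) simp
qed

lemma small_multiple:
  fixes B c d :: real
  assumes "0 \<le> B" "0 < c" "0 < d"
  shows "\<exists>a>0. a \<le> c \<and> B * a < d"
proof (intro exI[of _ "min c (d / (B + 1))"] conjI)
  have "B * min c (d / (B + 1)) \<le> B * (d / (B + 1))" using assms by (intro mult_left_mono) auto
  also have "\<dots> < d" using assms by (simp add: divide_less_eq algebra_simps)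
  finally show "B * min c (d / (B + 1)) < d" .
qed (use assms in auto)

text \<open>Each of the four parameters is responsible for a quarter of \<open>lam * v\<close>. They are chosen in the
  order \<open>s\<close>, \<open>t\<close>, \<open>\<kappa>\<close>, \<open>\<rho>\<close>, since the coefficient of each one in the estimate may involve
  earlier ones through negative powers.\<close>

lemma contradictory_parameters:
  fixes A Bs Bt K c v lam :: real
  assumes nonneg: "0 \<le> A" "0 \<le> Bs" "0 \<le> Bt" "0 \<le> K" "0 \<le> B\<kappa>" "0 \<le> BR" and pos: "0 < lam" "0 < v"
  shows "\<exists>s t \<kappa> \<rho>. 0 < s \<and> s < 1 / 2 \<and> 0 < t \<and> t \<le> 1 \<and> 0 < \<kappa> \<and> \<kappa> < v \<and> 0 < \<rho> \<and>
    (\<forall>R. R \<le> \<rho> \<longrightarrow>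
      A * (Bs * s + (Bt * t / s\<^sup>2 + K * (\<kappa> + R) / (2 * t)) / s ^ n + B\<kappa> * \<kappa>) + BR * R < lam * (v - \<kappa>))"
proof -
  \<comment> \<open>the strict inequality to be reached is \<open>\<dots> + lam * \<kappa> < 4 * d\<close>\<close>
  define d where "d = lam * v / 4"
  have d: "0 < d" using pos by (simp add: d_def)
  obtain s where s: "0 < s" "s \<le> 1 / 4" "A * Bs * s < d"
    using small_multiple[of "A * Bs" "1 / 4" d] nonneg d by auto
  obtain t where t: "0 < t" "t \<le> 1" "A * Bt / s\<^sup>2 / s ^ n * t < d"
    using small_multiple[of "A * Bt / s\<^sup>2 / s ^ n" 1 d] nonneg d s by auto
  define E where "E = A * K / (2 * t) / s ^ n"
  have E: "0 \<le> E" using nonneg s t by (simp add: E_def)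
  obtain \<kappa> where \<kappa>: "0 < \<kappa>" "\<kappa> \<le> v / 2" "(E + A * B\<kappa> + lam) * \<kappa> < d"
    using small_multiple[of "E + A * B\<kappa> + lam" "v / 2" d] nonneg pos d E by auto
  obtain \<rho> where \<rho>: "0 < \<rho>" "(E + BR) * \<rho> < d"
    using small_multiple[of "E + BR" 1 d] nonneg d E by auto
  have "A * (Bs * s + (Bt * t / s\<^sup>2 + K * (\<kappa> + R) / (2 * t)) / s ^ n + B\<kappa> * \<kappa>) + BR * R < lam * (v - \<kappa>)"
    if "R \<le> \<rho>" for R
  proof -
    have "(E + BR) * R \<le> (E + BR) * \<rho>" using that E nonneg by (intro mult_left_mono) auto
    moreover have "A * (Bs * s + (Bt * t / s\<^sup>2 + K * (\<kappa> + R) / (2 * t)) / s ^ n + B\<kappa> * \<kappa>) + BR * R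
        = A * Bs * s + A * Bt / s\<^sup>2 / s ^ n * t + (E + A * B\<kappa>) * \<kappa> + (E + BR) * R"
      unfolding E_def by (simp add: algebra_simps add_divide_distrib)
    moreover have "lam * (v - \<kappa>) = 4 * d - lam * \<kappa>" by (simp add: d_def right_diff_distrib)
    ultimately show ?thesis using s(3) t(3) \<kappa>(3) \<rho>(2) by (simp add: distrib_right)
  qed
  moreover have "s < 1 / 2" "\<kappa> < v" using s \<kappa> pos by auto
  ultimately show ?thesis using s(1) t(1,2) \<kappa>(1) \<rho>(1) by blast
qed

theorem theorem15p4:
  fixes N :: nat and Mf Mg :: "nat \<Rightarrow> real" and C\<^sub>F lam C\<^sub>0 :: real
  assumes "CARD('n::finite) \<ge> 2" and "N \<ge> 1"
    and "C\<^sub>F \<ge> 0" and "lam > 0" and "C\<^sub>0 \<ge> 1"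
  shows "\<exists>c\<^sub>6>0. \<forall>\<epsilon>>0. \<exists>r\<^sub>0>0.
    \<forall>(\<Omega> :: (real^'n) set) f g F u W.
      \<Omega> \<in> sets borel \<longrightarrow> emeasure lebesgue \<Omega> < \<infinity> \<longrightarrow>
      (\<forall>i\<in>{1..N}. f i \<in> borel_measurable lebesgue \<and> sup_norm (f i) = ereal (Mf i)) \<longrightarrow>
      (\<forall>i\<in>{1..N}. g i \<in> borel_measurable lebesgue \<and> sup_norm (g i) = ereal (Mg i)) \<longrightarrow>
      F_Lipschitz N \<Omega> C\<^sub>F F \<longrightarrow>
      is_J_minimizer N \<Omega> f g F u W \<longrightarrow>
      nondegenerate N lam \<epsilon> F W \<longrightarrow>
      (\<forall>x r. 0 < r \<longrightarrow> r \<le> r\<^sub>0 \<longrightarrow> ball x r \<subseteq> \<Omega> \<longrightarrow>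
         tuple_lipschitz_on N C\<^sub>0 (ball x r) u \<longrightarrow>
         ball x (r/2) \<inter> frontier {y \<in> \<Omega>. u 1 y > 0} \<noteq> {} \<longrightarrow>
         measure lebesgue {y \<in> ball x r. u 1 y \<le> 0} \<ge> c\<^sub>6 * r ^ CARD('n))"
proof -
  obtain L\<^sub>1 where L\<^sub>1: "\<And>(a::real^'n) \<rho> z. 0 < \<rho> \<Longrightarrow> norm (grad (cutoff a \<rho>) z) \<le> L\<^sub>1 / \<rho>"
    using cutoff_gradient_bound by blast
  obtain L\<^sub>2 where L\<^sub>2: "0 < L\<^sub>2" "\<And>t. t \<le> 1 \<Longrightarrow> \<bar>flat_deriv 1 t\<bar> \<le> L\<^sub>2"
    using flat_deriv_bounded by blast
  define L where "L = max L\<^sub>1 L\<^sub>2"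
  have L: "0 < L" using L\<^sub>2(1) by (simp add: L_def)
  define vol where "vol = unit_ball_vol (real CARD('n))"
  have vol: "0 < vol" by (simp add: vol_def)
  define M where "M = (\<Sum>i=1..N. \<bar>Mf i\<bar> + \<bar>Mg i\<bar>)"
  have M: "0 \<le> M" by (auto simp: M_def intro!: sum_nonneg)
  define K where "K = real N * (16 * C\<^sub>0\<^sup>2 * L\<^sup>2 + 12 * M * C\<^sub>0\<^sup>2 + C\<^sub>F) + 12 * M * C\<^sub>0\<^sup>2 * vol"
  have K: "0 \<le> K" using M assms(3) vol by (simp add: K_def)
  obtain s t \<kappa> \<rho> where s: "0 < s" "s < 1 / 2" and t: "0 < t" "t \<le> 1"
    and \<kappa>_pos: "0 < \<kappa>" and \<kappa>_small: "\<kappa> < vol / 8 ^ CARD('n)" and \<rho>: "0 < \<rho>"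
    and contra: "\<And>R. R \<le> \<rho> \<Longrightarrow> 64 * L\<^sup>2 * C\<^sub>0 * exp 2 * (2 * C\<^sub>0 * L * vol * s
        + (2 * L\<^sup>2 * vol * t / s\<^sup>2 + K * (\<kappa> + R) / (2 * t)) / s ^ CARD('n)
        + 4 * C\<^sub>0 * L * 2 ^ CARD('n) * \<kappa>) + 12 * M * C\<^sub>0\<^sup>2 * vol * R < lam * (vol / 8 ^ CARD('n) - \<kappa>)"
    using contradictory_parameters[of "64 * L\<^sup>2 * C\<^sub>0 * exp 2" "2 * C\<^sub>0 * L * vol" "2 * L\<^sup>2 * vol" K
        "4 * C\<^sub>0 * L * 2 ^ CARD('n)" "12 * M * C\<^sub>0\<^sup>2 * vol" lam "vol / 8 ^ CARD('n)" "CARD('n)"]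
      L vol M K assms(4,5) by auto
  have "vol / 8 ^ CARD('n) \<le> vol" using vol by (simp add: divide_le_eq)
  then have \<kappa>_vol: "\<kappa> < vol" using \<kappa>_small by linarith
  show ?thesis
  proof (rule exI[of _ "\<kappa> / 2 ^ CARD('n)"], intro conjI allI impI)
    show "0 < \<kappa> / 2 ^ CARD('n)" using \<kappa>_pos by simp
    fix \<epsilon> :: real assume \<epsilon>: "0 < \<epsilon>"
    \<comment> \<open>radii up to \<open>1\<close> satisfy the standing assumptions, and \<open>\<epsilon> / vol\<close> keeps the removed set small enough\<close>
    define \<rho>' where "\<rho>' = min (min 1 \<rho>) (\<epsilon> / vol)"
    have "0 < \<rho>'" using \<rho> \<epsilon> vol by (simp add: \<rho>'_def)
    show "\<exists>r\<^sub>0>0. \<forall>(\<Omega> :: (real^'n) set) f g F u W.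
      \<Omega> \<in> sets borel \<longrightarrow> emeasure lebesgue \<Omega> < \<infinity> \<longrightarrow>
      (\<forall>i\<in>{1..N}. f i \<in> borel_measurable lebesgue \<and> sup_norm (f i) = ereal (Mf i)) \<longrightarrow>
      (\<forall>i\<in>{1..N}. g i \<in> borel_measurable lebesgue \<and> sup_norm (g i) = ereal (Mg i)) \<longrightarrow>
      F_Lipschitz N \<Omega> C\<^sub>F F \<longrightarrow>
      is_J_minimizer N \<Omega> f g F u W \<longrightarrow>
      nondegenerate N lam \<epsilon> F W \<longrightarrow>
      (\<forall>x r. 0 < r \<longrightarrow> r \<le> r\<^sub>0 \<longrightarrow> ball x r \<subseteq> \<Omega> \<longrightarrow>
         tuple_lipschitz_on N C\<^sub>0 (ball x r) u \<longrightarrow>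
         ball x (r/2) \<inter> frontier {y \<in> \<Omega>. u 1 y > 0} \<noteq> {} \<longrightarrow>
         measure lebesgue {y \<in> ball x r. u 1 y \<le> 0} \<ge> \<kappa> / 2 ^ CARD('n) * r ^ CARD('n))"
    proof (intro exI[of _ \<rho>'] conjI allI impI)
      show "0 < \<rho>'" by fact
      fix \<Omega> :: "(real^'n) set" and f g F u W x r
      assume f: "\<forall>i\<in>{1..N}. f i \<in> borel_measurable lebesgue \<and> sup_norm (f i) = ereal (Mf i)"
        and g: "\<forall>i\<in>{1..N}. g i \<in> borel_measurable lebesgue \<and> sup_norm (g i) = ereal (Mg i)"
        and F: "F_Lipschitz N \<Omega> C\<^sub>F F" and min: "is_J_minimizer N \<Omega> f g F u W"
        and nondeg: "nondegenerate N lam \<epsilon> F W"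
        and r: "0 < r" "r \<le> \<rho>'" and sub: "ball x r \<subseteq> \<Omega>"
        and lip: "tuple_lipschitz_on N C\<^sub>0 (ball x r) u"
        and meets: "ball x (r/2) \<inter> frontier {y \<in> \<Omega>. u 1 y > 0} \<noteq> {}"
      have lip_i: "\<bar>u i z - u i z'\<bar> \<le> C\<^sub>0 * dist z z'"
        if "i \<in> {1..N}" "z \<in> ball x r" "z' \<in> ball x r" for i z z'
      proof -
        have "\<bar>u i z - u i z'\<bar> \<le> L2_set (\<lambda>i. \<bar>u i z - u i z'\<bar>) {1..N}"
          using that(1) by (intro member_le_L2_set) auto
        also have "\<dots> = L2_set (\<lambda>i. u i z - u i z') {1..N}" by (simp add: L2_set_def)
        also have "\<dots> \<le> C\<^sub>0 * dist z z'" using lip that by (simp add: tuple_lipschitz_on_def)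
        finally show ?thesis .
      qed
      obtain y where y: "y \<in> ball x (r/2)" "y \<in> frontier {y \<in> \<Omega>. u 1 y > 0}" using meets by blast
      have "y \<in> ball x r" using y(1) r by simp
      then have y0: "u 1 y = 0"
        using lipschitz_zero_on_frontier[of x r "u 1" C\<^sub>0 \<Omega> y] lip_i[of 1] sub y(2) assms(2,5) by auto
      have ball_y: "ball y (r/2) \<subseteq> ball x r"
      proof
        fix z assume "z \<in> ball y (r/2)"
        then show "z \<in> ball x r" using y(1) dist_triangle[of x z y] by simp
      qed
      have M_ge: "\<bar>Mf i\<bar> \<le> M" "\<bar>Mg i\<bar> \<le> M" if "i \<in> {1..N}" for i
        using member_le_sum[of i "{1..N}" "\<lambda>i. \<bar>Mf i\<bar> + \<bar>Mg i\<bar>"] that by (auto simp: M_def)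
      show "\<kappa> / 2 ^ CARD('n) * r ^ CARD('n) \<le> measure lebesgue {y \<in> ball x r. u 1 y \<le> 0}"
      proof (rule ccontr)
        assume "\<not> ?thesis"
        then have small: "measure lebesgue {z \<in> ball x r. u 1 z \<le> 0} < \<kappa> * (r/2) ^ CARD('n)"
          by (simp add: power_divide)
        have u1: "u 1 \<in> borel_measurable lebesgue"
          using min assms(2) by (auto simp: is_J_minimizer_def admissible_pairs_def W12_def L2_loc_def)
        have "{z. u 1 z \<le> 0} \<in> sets lebesgue"
          using borel_measurable_le[OF u1 borel_measurable_const, of 0] by simp
        then have "ball x r \<inter> {z. u 1 z \<le> 0} \<in> lmeasurable"
          by (intro fmeasurable_Int_fmeasurable lmeasurable_ball)
        moreover have "ball x r \<inter> {z. u 1 z \<le> 0} = {z \<in> ball x r. u 1 z \<le> 0}" by blast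
        ultimately have "{z \<in> ball x r. u 1 z \<le> 0} \<in> lmeasurable" by simp
        then have "measure lebesgue {z \<in> ball y (r/2). u 1 z \<le> 0} \<le> measure lebesgue {z \<in> ball x r. u 1 z \<le> 0}"
          using ball_y by (intro measure_lebesgue_mono_AE AE_I2) auto
        then have thin: "measure lebesgue {z \<in> ball y (r/2). u 1 z \<le> 0} \<le> \<kappa> * (r/2) ^ CARD('n)"
          using small by linarith
        \<comment> \<open>around the frontier point the ball has half the radius, whence the factor \<open>2\<^sup>n\<close>\<close>
        interpret thin_contact_ball N \<Omega> f g u F W C\<^sub>F C\<^sub>0 M \<kappa> "r/2" L vol y
        proof
          show "norm (grad (cutoff a \<sigma>) z) \<le> L / \<sigma>" if "0 < \<sigma>" for a :: "real^'n" and \<sigma> z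
            using L\<^sub>1[OF that, of a z] divide_right_mono[of L\<^sub>1 L \<sigma>] that by (simp add: L_def)
          show "\<bar>flat_deriv 1 t\<bar> \<le> L" if "t \<le> 1" for t using L\<^sub>2(2)[OF that] by (simp add: L_def)
          show "AE z in lebesgue. \<bar>f i z\<bar> \<le> M" if "i \<in> {1..N}" for i
            using AE_le_of_sup_norm[of "f i" "Mf i"] f M_ge(1)[OF that] that
            by (auto elim!: eventually_mono)
          show "AE z in lebesgue. \<bar>g i z\<bar> \<le> M" if "i \<in> {1..N}" for i
            using AE_le_of_sup_norm[of "g i" "Mg i"] g M_ge(2)[OF that] that
            by (auto elim!: eventually_mono)
          show "0 < r / 2" "r / 2 \<le> 1" using r by (simp_all add: \<rho>'_def)
          show "f i \<in> borel_measurable lebesgue" if "i \<in> {1..N}" for i using f that by blast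
          show "g i \<in> borel_measurable lebesgue" if "i \<in> {1..N}" for i using g that by blast
          show "ball y (r/2) \<subseteq> \<Omega>" using ball_y sub by blast
          show "\<bar>u i z - u i z'\<bar> \<le> C\<^sub>0 * dist z z'"
            if "i \<in> {1..N}" "z \<in> ball y (r/2)" "z' \<in> ball y (r/2)" for i z z'
            using lip_i that ball_y by blast
        qed (fact assms min F M y0 thin vol_def \<kappa>_pos \<kappa>_vol)+
        have R: "r / 2 \<le> \<rho>" "vol * (r / 2) \<le> \<epsilon>"
          using r vol \<epsilon> by (auto simp: \<rho>'_def pos_le_divide_eq mult.commute)
        show False
          using thin_contact_inequality[OF nondeg assms(4) R(2) \<kappa>_small s t] contra[OF R(1)]
          unfolding average_error_def harmonicity_constant_def K_def[symmetric]
          by (simp add: mult_ac)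
      qed
    qed
  qed
qed

end
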